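(* Let $\mathcal{H}_6$ be the foliation on $\mathbb{P}^2$, with homogeneous coordinates $(x:y:z)$, defined by $$(xy^2-xyz+xz^2-5y^3+y^2z)\,\mathrm{d}x+x(5y^2-3yz-xy+xz)\,\mathrm{d}y+x(2y^2-xz)\,\mathrm{d}z=0.$$ It is a foliation of degree two, and it is a birational model for Santos's foliation $\mathcal{F}_6$ (that is, $\mathcal{H}_6$ and $\mathcal{F}_6$ are birationally equivalent). The foliation $\mathcal{H}_6$ is tangent to the nodal cubic $3y^3-xy^2+xyz-xz^2=0$, which gives rise to the link of $\mathcal{F}_6$, to the inflectional line $x=0$ of this cubic, and to the nodal cubic $8y^3-15xy^2+6xyz-3xz^2-6x^2y+6x^2z+x^3=0$. Moreover, $\mathcal{H}_6$ is the only degree-two foliation on $\mathbb{P}^2$ tangent to both cubics.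
   Context: All foliations are singular holomorphic foliations by curves with isolated singularities on complex surfaces. A foliation of degree $d$ on $\mathbb{P}^2$ is given by a homogeneous $1$-form $A\,\mathrm{d}x+B\,\mathrm{d}y+C\,\mathrm{d}z$ on $\mathbb{C}^3$ with $A,B,C$ homogeneous of degree $d+1$ without common factor and $xA+yB+zC=0$, up to multiplication by a nonzero constant. A foliation is tangent to a curve if the curve is invariant by the foliation. Two foliated surfaces are birationally equivalent if there is a birational map between the surfaces taking one foliation to the other. Santos's foliation $\mathcal{F}_6$: let $\omega$ be a primitive cubic root of unity, and $\mathcal{E}_3$ the foliation on $\mathbb{P}^2$ given by $\omega^2YZ\,\mathrm{d}X+\omega XZ\,\mathrm{d}Y+XY\,\mathrm{d}Z=0$. Let $\mathrm{Bl}_3(\mathbb{P}^2)$ be the blow-up of $\mathbb{P}^2$ at $(1:0:0)$, $(0:1:0)$, $(0:0:1)$, let $\mathcal{E}_6$ be the transform of $\mathcal{E}_3$ on it, and let $\Delta_6$ be the cycle of six $(-1)$-curves formed by the strict transforms of the coordinate lines and the three exceptional curves. Let $T_3(X:Y:Z)=(Z:X:Y)$ and $Q(X:Y:Z)=(YZ:ZX:XY)$; these commute, and $T_3\circ Q$ induces an order-six biholomorphism $T_6$ of $\mathrm{Bl}_3(\mathbb{P}^2)$ that preserves $\mathcal{E}_6$ and cyclically permutes the curves of $\Delta_6$. Let $M_6$ be the minimal desingularization of $\mathrm{Bl}_3(\mathbb{P}^2)/\langle T_6\rangle$ (a rational surface). $\mathcal{F}_6$ is the foliation on $M_6$ induced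 by $\mathcal{E}_6$. A link for a foliation on a smooth projective surface is an invariant rational curve $C$ with exactly one node, with $C^2>0$, such that the node is the unique singularity of the foliation along $C$ and is reduced and non-degenerate (non-zero eigenvalues $\lambda_1,\lambda_2$ with $\lambda_2/\lambda_1\notin\mathbb{Q}^+$). The image of $\Delta_6$ in $M_6$ is a link for $\mathcal{F}_6$, with $C^2=1$. That the first cubic "gives rise to the link" means that, under the birational equivalence between $\mathcal{H}_6$ and $\mathcal{F}_6$, the strict transform of this cubic is this link. *)

theory Defs
  imports "HOL-Analysis.Analysis"
begin

section \<open>Homogeneous polynomials on $\mathbb{C}^3$\<close>

type_synonym c2 = "complex \<times> complex"
type_synonym c3 = "complex \<times> complex \<times> complex"

definition csc :: "complex \<Rightarrow> c3 \<Rightarrow> c3" where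
  "csc c = (\<lambda>(x, y, z). (c * x, c * y, c * z))"

definition cdot :: "c3 \<Rightarrow> c3 \<Rightarrow> complex" where
  "cdot = (\<lambda>(a, b, c) (x, y, z). a * x + b * y + c * z)"

definition cindep :: "c3 \<Rightarrow> c3 \<Rightarrow> bool" where
  "cindep a b \<longleftrightarrow> (\<forall>s t. csc s a + csc t b = 0 \<longrightarrow> s = 0 \<and> t = 0)"

text \<open>Polynomials are identified with polynomial functions, which is harmless over an infinite field.\<close>

definition form :: "nat \<Rightarrow> (c3 \<Rightarrow> complex) \<Rightarrow> bool" where
  "form n p \<longleftrightarrow> (\<exists>c. \<forall>x y z.
     p (x, y, z) = (\<Sum>i\<le>n. \<Sum>j\<le>n - i. c i j * x ^ i * y ^ j * z ^ (n - i - j)))"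

text \<open>All factors of a homogeneous polynomial are homogeneous, so it is enough to consider
  homogeneous factors here and in the definition of foliations below.\<close>

definition irreducible_form :: "nat \<Rightarrow> (c3 \<Rightarrow> complex) \<Rightarrow> bool" where
  "irreducible_form n F \<longleftrightarrow> n \<ge> 1 \<and> form n F \<and> (\<exists>v. F v \<noteq> 0) \<and>
     (\<forall>i j G H. i + j = n \<and> form i G \<and> form j H \<and> (\<forall>v. F v = G v * H v) \<longrightarrow> i = 0 \<or> j = 0)"

definition grad :: "(c3 \<Rightarrow> complex) \<Rightarrow> c3 \<Rightarrow> c3" where
  "grad F = (\<lambda>(x, y, z).
     (deriv (\<lambda>t. F (t, y, z)) x, deriv (\<lambda>t. F (x, t, z)) y, deriv (\<lambda>t. F (x, y, t)) z))"

text \<open>A node of the curve \<open>F = 0\<close>: a singular point at which the leading term of \<open>F\<close>, of order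
  two, is the product of the equations of two distinct lines.\<close>

definition node :: "(c3 \<Rightarrow> complex) \<Rightarrow> c3 \<Rightarrow> bool" where
  "node F v \<longleftrightarrow> v \<noteq> 0 \<and> F v = 0 \<and> grad F v = 0 \<and>
     (\<exists>a b. cindep a b \<and>
        (\<forall>w. (deriv ^^ 2) (\<lambda>t. F (v + csc t w)) 0 = cdot a w * cdot b w))"

definition nodal_cubic :: "(c3 \<Rightarrow> complex) \<Rightarrow> bool" where
  "nodal_cubic F \<longleftrightarrow> irreducible_form 3 F \<and>
     (\<exists>v. node F v \<and>
        (\<forall>u. u \<noteq> 0 \<and> F u = 0 \<and> grad F u = 0 \<longrightarrow> (\<exists>c. c \<noteq> 0 \<and> u = csc c v)))"

text \<open>The line \<open>L = 0\<close> has contact of order at least three with the curve \<open>F = 0\<close> at one of its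
  smooth points.\<close>

definition inflectional_line :: "(c3 \<Rightarrow> complex) \<Rightarrow> (c3 \<Rightarrow> complex) \<Rightarrow> bool" where
  "inflectional_line L F \<longleftrightarrow> form 1 L \<and> (\<exists>v. L v \<noteq> 0) \<and>
     (\<exists>v. v \<noteq> 0 \<and> L v = 0 \<and> F v = 0 \<and> grad F v \<noteq> 0 \<and>
        (\<forall>w. L w = 0 \<longrightarrow> (\<forall>k<3. (deriv ^^ k) (\<lambda>t. F (v + csc t w)) 0 = 0)))"

section \<open>Foliations on the projective plane given by homogeneous 1-forms\<close>

text \<open>A 1-form \<open>A dx + B dy + C dz\<close> is given by its coefficient function \<open>v \<mapsto> (A v, B v, C v)\<close>.\<close>

definition foliation_form :: "nat \<Rightarrow> (c3 \<Rightarrow> c3) \<Rightarrow> bool" where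
  "foliation_form d \<Omega> \<longleftrightarrow>
     (let A = fst \<circ> \<Omega>; B = fst \<circ> snd \<circ> \<Omega>; C = snd \<circ> snd \<circ> \<Omega> in
       form (d + 1) A \<and> form (d + 1) B \<and> form (d + 1) C \<and>
       (\<nexists>m n G P Q R. m \<ge> 1 \<and> m + n = d + 1 \<and> form m G \<and> form n P \<and> form n Q \<and> form n R \<and>
          (\<forall>v. A v = G v * P v \<and> B v = G v * Q v \<and> C v = G v * R v)) \<and>
       (\<forall>v. cdot v (\<Omega> v) = 0))"

text \<open>The curve \<open>F = 0\<close> (with \<open>F\<close> reduced) is invariant: at its smooth points, the vectors tangent
  to it are in the kernel of the form.\<close>

definition tangent_to :: "(c3 \<Rightarrow> c3) \<Rightarrow> (c3 \<Rightarrow> complex) \<Rightarrow> bool" where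
  "tangent_to \<Omega> F \<longleftrightarrow>
     (\<forall>v. v \<noteq> 0 \<and> F v = 0 \<and> grad F v \<noteq> 0 \<longrightarrow> (\<forall>w. cdot (grad F v) w = 0 \<longrightarrow> cdot (\<Omega> v) w = 0))"

section \<open>Complex spaces\<close>

text \<open>A space with a sheaf of complex functions; \<open>holo X U g\<close> means that \<open>g\<close> is holomorphic on
  the open set \<open>U\<close>. The values of \<open>g\<close> outside \<open>U\<close> play no role.\<close>

datatype 'a cspace = CSpace (tp: "'a topology") (holo: "'a set \<Rightarrow> ('a \<Rightarrow> complex) \<Rightarrow> bool")

abbreviation points :: "'a cspace \<Rightarrow> 'a set" where
  "points X \<equiv> topspace (tp X)"

definition C2 :: "c2 cspace" where
  "C2 = CSpace euclidean
     (\<lambda>U g. \<forall>z\<in>U. \<exists>a b. (g has_derivative (\<lambda>(h, k). a * h + b * k)) (at z))"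

definition restrict_space :: "'a cspace \<Rightarrow> 'a set \<Rightarrow> 'a cspace" where
  "restrict_space X U = CSpace (subtopology (tp X) U) (holo X)"

text \<open>The final structure for a family of maps defined on \<open>X\<close>. It is used to glue affine charts and to
  form quotients: on a quotient, the holomorphic functions are those whose pull-back is
  holomorphic.\<close>

definition coinduced :: "'a cspace \<Rightarrow> ('a \<Rightarrow> 'b) set \<Rightarrow> 'b cspace" where
  "coinduced X P = CSpace
     (topology (\<lambda>U. U \<subseteq> (\<Union>p\<in>P. p ` points X) \<and> (\<forall>p\<in>P. openin (tp X) {x \<in> points X. p x \<in> U})))
     (\<lambda>U g. \<forall>p\<in>P. holo X {x \<in> points X. p x \<in> U} (g \<circ> p))"

lemma openin_coinduced:
  "openin (tp (coinduced X P)) U \<longleftrightarrow>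
     U \<subseteq> (\<Union>p\<in>P. p ` points X) \<and> (\<forall>p\<in>P. openin (tp X) {x \<in> points X. p x \<in> U})"
proof -
  define L where "L = (\<lambda>U. U \<subseteq> (\<Union>p\<in>P. p ` points X) \<and>
    (\<forall>p\<in>P. openin (tp X) {x \<in> points X. p x \<in> U}))"
  have "L (S \<inter> T)" if "L S" "L T" for S T
  proof -
    have "{x \<in> points X. p x \<in> S \<inter> T} = {x \<in> points X. p x \<in> S} \<inter> {x \<in> points X. p x \<in> T}" for p
      by auto
    with that show ?thesis unfolding L_def by (auto intro: openin_Int)
  qed
  moreover have "L (\<Union>K)" if "\<forall>S\<in>K. L S" for K
  proof -
    have "{x \<in> points X. p x \<in> \<Union>K} = (\<Union>S\<in>K. {x \<in> points X. p x \<in> S})" for p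
      by auto
    moreover have "openin (tp X) (\<Union>S\<in>K. {x \<in> points X. p x \<in> S})" if "p \<in> P" for p
      using that \<open>\<forall>S\<in>K. L S\<close> unfolding L_def by (intro openin_Union) auto
    ultimately show ?thesis using that unfolding L_def by auto
  qed
  ultimately have "istopology L" unfolding istopology_def by blast
  then show ?thesis by (simp add: coinduced_def L_def topology_inverse')
qed

lemma points_coinduced: "points (coinduced X P) = (\<Union>p\<in>P. p ` points X)" (is "_ = ?A")
proof
  show "points (coinduced X P) \<subseteq> ?A"
    using openin_topspace[of "tp (coinduced X P)"] unfolding openin_coinduced by simp
  have "{x \<in> points X. p x \<in> ?A} = points X" if "p \<in> P" for p
    using that by auto
  then have "openin (tp (coinduced X P)) ?A"
    unfolding openin_coinduced by auto
  then show "?A \<subseteq> points (coinduced X P)"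
    by (rule openin_subset)
qed

definition morphism :: "'a cspace \<Rightarrow> 'b cspace \<Rightarrow> ('a \<Rightarrow> 'b) \<Rightarrow> bool" where
  "morphism X Y f \<longleftrightarrow> continuous_map (tp X) (tp Y) f \<and>
     (\<forall>V g. openin (tp Y) V \<and> holo Y V g \<longrightarrow> holo X {x \<in> points X. f x \<in> V} (g \<circ> f))"

definition isomorphism :: "'a cspace \<Rightarrow> 'b cspace \<Rightarrow> ('a \<Rightarrow> 'b) \<Rightarrow> bool" where
  "isomorphism X Y f \<longleftrightarrow> bij_betw f (points X) (points Y) \<and>
     morphism X Y f \<and> morphism Y X (inv_into (points X) f)"

text \<open>Charts are parametrizations of open subsets of \<open>X\<close> by open subsets of $\mathbb{C}^2$.\<close>

definition chart :: "'a cspace \<Rightarrow> (c2 \<Rightarrow> 'a) \<Rightarrow> c2 set \<Rightarrow> bool" where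
  "chart X p W \<longleftrightarrow> open W \<and> openin (tp X) (p ` W) \<and>
     isomorphism (restrict_space C2 W) (restrict_space X (p ` W)) p"

definition smooth_locus :: "'a cspace \<Rightarrow> 'a set" where
  "smooth_locus X = \<Union>{p ` W |p W. chart X p W}"

definition function_sheaf :: "'a cspace \<Rightarrow> bool" where
  "function_sheaf X \<longleftrightarrow>
     (\<forall>U f g. openin (tp X) U \<and> (\<forall>x\<in>U. f x = g x) \<and> holo X U f \<longrightarrow> holo X U g) \<and>
     (\<forall>U V f. openin (tp X) U \<and> openin (tp X) V \<and> V \<subseteq> U \<and> holo X U f \<longrightarrow> holo X V f) \<and>
     (\<forall>\<U> f. (\<forall>U\<in>\<U>. openin (tp X) U \<and> holo X U f) \<longrightarrow> holo X (\<Union>\<U>) f)"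

definition complex_surface :: "'a cspace \<Rightarrow> bool" where
  "complex_surface X \<longleftrightarrow> function_sheaf X \<and> Hausdorff_space (tp X) \<and> second_countable (tp X) \<and>
     connected_space (tp X) \<and> points X \<noteq> {} \<and> smooth_locus X = points X"

definition desingularization :: "'b cspace \<Rightarrow> 'a cspace \<Rightarrow> ('a \<Rightarrow> 'b) \<Rightarrow> bool" where
  "desingularization Y M \<pi> \<longleftrightarrow> complex_surface M \<and> morphism M Y \<pi> \<and> proper_map (tp M) (tp Y) \<pi> \<and>
     (let U = {x \<in> points M. \<pi> x \<in> smooth_locus Y} in
       tp M closure_of U = points M \<and>
       isomorphism (restrict_space M U) (restrict_space Y (smooth_locus Y)) \<pi>)"

text \<open>Minimality is the usual universal property. All surfaces have the cardinality of the continuum,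
  so it is no restriction that the competitors live in the same type.\<close>

definition minimal_desingularization :: "'b cspace \<Rightarrow> 'a cspace \<Rightarrow> ('a \<Rightarrow> 'b) \<Rightarrow> bool" where
  "minimal_desingularization Y M \<pi> \<longleftrightarrow> desingularization Y M \<pi> \<and>
     (\<forall>(N :: 'a cspace) \<rho>. desingularization Y N \<rho> \<longrightarrow>
        (\<exists>h. morphism N M h \<and> (\<forall>x\<in>points N. \<pi> (h x) = \<rho> x)))"

section \<open>Foliations on complex surfaces\<close>

text \<open>A foliation with isolated singularities is given by local forms \<open>(p, W, a, b)\<close>: the form
  \<open>a du + b dv\<close> on the domain \<open>W\<close> of the chart \<open>p\<close>. Since their zeros are isolated, two forms differ by
  a nowhere vanishing holomorphic factor as soon as they are pointwise proportional.\<close>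

type_synonym 'a local_form = "(c2 \<Rightarrow> 'a) \<times> c2 set \<times> (c2 \<Rightarrow> complex) \<times> (c2 \<Rightarrow> complex)"

definition pd1 :: "(c2 \<Rightarrow> complex) \<Rightarrow> c2 \<Rightarrow> complex" where
  "pd1 f = (\<lambda>(u, v). deriv (\<lambda>t. f (t, v)) u)"

definition pd2 :: "(c2 \<Rightarrow> complex) \<Rightarrow> c2 \<Rightarrow> complex" where
  "pd2 f = (\<lambda>(u, v). deriv (\<lambda>t. f (u, t)) v)"

text \<open>On the open set \<open>U\<close>, the pull-back by \<open>f\<close> of each local form of \<open>\<G>\<close> is proportional to each local
  form of \<open>\<F>\<close>. When \<open>f\<close> is holomorphic on \<open>U\<close>, and generically a local biholomorphism, this says that
  \<open>\<F>\<close> is the transform of \<open>\<G>\<close> by \<open>f\<close>.\<close>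

definition pulls_back ::
    "('a \<Rightarrow> 'b) \<Rightarrow> 'a set \<Rightarrow> 'b local_form set \<Rightarrow> 'a local_form set \<Rightarrow> bool" where
  "pulls_back f U \<G> \<F> \<longleftrightarrow>
     (\<forall>(p, W, a, b)\<in>\<F>. \<forall>(q, W', a', b')\<in>\<G>. \<forall>z\<in>W. p z \<in> U \<and> f (p z) \<in> q ` W' \<longrightarrow>
        (let h = inv_into W' q \<circ> f \<circ> p;
             \<alpha> = a' (h z) * pd1 (fst \<circ> h) z + b' (h z) * pd1 (snd \<circ> h) z;
             \<beta> = a' (h z) * pd2 (fst \<circ> h) z + b' (h z) * pd2 (snd \<circ> h) z
         in a z * \<beta> = b z * \<alpha>))"

definition foliation :: "'a cspace \<Rightarrow> 'a local_form set \<Rightarrow> bool" where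
  "foliation X \<F> \<longleftrightarrow>
     (\<forall>(p, W, a, b)\<in>\<F>. chart X p W \<and> holo C2 W a \<and> holo C2 W b \<and>
        (\<forall>z\<in>W. \<forall>\<^sub>F w in at z. a w \<noteq> 0 \<or> b w \<noteq> 0)) \<and>
     (\<Union>(p, W, a, b)\<in>\<F>. p ` W) = points X \<and>
     pulls_back id (points X) \<F> \<F>"

section \<open>The projective plane\<close>

definition hpt :: "c3 \<Rightarrow> c3 set" where
  "hpt v = {csc c v |c. c \<noteq> 0}"

definition aff1 :: "c2 \<Rightarrow> c3 set" where "aff1 = (\<lambda>(u, v). hpt (1, u, v))"
definition aff2 :: "c2 \<Rightarrow> c3 set" where "aff2 = (\<lambda>(u, v). hpt (u, 1, v))"
definition aff3 :: "c2 \<Rightarrow> c3 set" where "aff3 = (\<lambda>(u, v). hpt (u, v, 1))"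

definition P2 :: "c3 set cspace" where
  "P2 = coinduced C2 {aff1, aff2, aff3}"

definition curve :: "(c3 \<Rightarrow> complex) \<Rightarrow> c3 set set" where
  "curve F = {hpt v |v. v \<noteq> 0 \<and> F v = 0}"

definition plane_foliation :: "(c3 \<Rightarrow> c3) \<Rightarrow> c3 set local_form set" where
  "plane_foliation \<Omega> =
     (let A = fst \<circ> \<Omega>; B = fst \<circ> snd \<circ> \<Omega>; C = snd \<circ> snd \<circ> \<Omega> in
       {(aff1, UNIV, \<lambda>(u, v). B (1, u, v), \<lambda>(u, v). C (1, u, v)),
        (aff2, UNIV, \<lambda>(u, v). A (u, 1, v), \<lambda>(u, v). C (u, 1, v)),
        (aff3, UNIV, \<lambda>(u, v). A (u, v, 1), \<lambda>(u, v). B (u, v, 1))})"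

section \<open>Birational maps to the projective plane\<close>

definition analytic_subset :: "'a cspace \<Rightarrow> 'a set \<Rightarrow> bool" where
  "analytic_subset X A \<longleftrightarrow> A \<subseteq> points X \<and>
     (\<forall>x\<in>points X. \<exists>N H. openin (tp X) N \<and> x \<in> N \<and> finite H \<and> (\<forall>g\<in>H. holo X N g) \<and>
        A \<inter> N = {y \<in> N. \<forall>g\<in>H. g y = 0})"

definition zariski_dense_open :: "'a cspace \<Rightarrow> 'a set \<Rightarrow> bool" where
  "zariski_dense_open X U \<longleftrightarrow> openin (tp X) U \<and> tp X closure_of U = points X \<and>
     analytic_subset X (points X - U)"

text \<open>A rational map to the plane is given locally by three holomorphic functions, not all zero; it is
  birational if it restricts to an isomorphism between Zariski open dense subsets \<open>U\<close> and \<open>V\<close>.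
  On projective surfaces, analytic subsets and meromorphic maps are algebraic.\<close>

definition birational_to_P2 ::
    "'a cspace \<Rightarrow> ('a \<Rightarrow> c3 set) \<Rightarrow> 'a set \<Rightarrow> c3 set set \<Rightarrow> bool" where
  "birational_to_P2 M f U V \<longleftrightarrow>
     zariski_dense_open M U \<and> zariski_dense_open P2 V \<and>
     isomorphism (restrict_space M U) (restrict_space P2 V) f \<and>
     (\<forall>x\<in>points M. \<exists>N g1 g2 g3. openin (tp M) N \<and> x \<in> N \<and>
        holo M N g1 \<and> holo M N g2 \<and> holo M N g3 \<and>
        N \<subseteq> tp M closure_of {y \<in> N. (g1 y, g2 y, g3 y) \<noteq> 0} \<and>
        (\<forall>y\<in>N \<inter> U. (g1 y, g2 y, g3 y) \<noteq> 0 \<longrightarrow> f y = hpt (g1 y, g2 y, g3 y)))"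

text \<open>The strict transform in \<open>M\<close> of a plane curve that meets \<open>V\<close> in a dense subset of the curve.\<close>

definition strict_transform ::
    "'a cspace \<Rightarrow> ('a \<Rightarrow> c3 set) \<Rightarrow> 'a set \<Rightarrow> c3 set set \<Rightarrow> 'a set" where
  "strict_transform M f U D = tp M closure_of {x \<in> U. f x \<in> D}"

section \<open>Santos's foliation\<close>

definition E3 :: "complex \<Rightarrow> c3 \<Rightarrow> c3" where
  "E3 \<omega> = (\<lambda>(X, Y, Z). (\<omega>\<^sup>2 * Y * Z, \<omega> * X * Z, X * Y))"

definition T3 :: "c3 \<Rightarrow> c3" where "T3 = (\<lambda>(X, Y, Z). (Z, X, Y))"

definition Q :: "c3 \<Rightarrow> c3" where "Q = (\<lambda>(X, Y, Z). (Y * Z, Z * X, X * Y))"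

text \<open>The blow-up of the plane at the three coordinate points is the graph closure of \<open>Q\<close>, the surface
  \<open>X A = Y B = Z C\<close> of pairs \<open>((X:Y:Z), (A:B:C))\<close>, with first projection as blow-down: near \<open>(1:0:0)\<close>,
  with affine coordinates \<open>(y, z)\<close>, the equations are \<open>y B = z C\<close> and \<open>A = y B\<close>, which is the standard
  blow-up of the origin of the plane with \<open>(C:B)\<close> as point of the exceptional curve. There is one affine
  chart for each node of the cycle of six (-1)-curves; in each of them the cycle is \<open>u v = 0\<close>.\<close>

definition bl_charts :: "(c2 \<Rightarrow> c3 set \<times> c3 set) set" where
  "bl_charts =
     {\<lambda>(u, v). (hpt (1, u * v, u), hpt (u * v, 1, v)),
      \<lambda>(u, v). (hpt (u * v, 1, v), hpt (1, u * v, u)),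
      \<lambda>(u, v). (hpt (u, 1, u * v), hpt (v, u * v, 1)),
      \<lambda>(u, v). (hpt (v, u * v, 1), hpt (u, 1, u * v)),
      \<lambda>(u, v). (hpt (u * v, u, 1), hpt (1, v, u * v)),
      \<lambda>(u, v). (hpt (1, v, u * v), hpt (u * v, u, 1))}"

definition Bl3 :: "(c3 set \<times> c3 set) cspace" where
  "Bl3 = coinduced C2 bl_charts"

definition coord_points :: "c3 set set" where
  "coord_points = {hpt (1, 0, 0), hpt (0, 1, 0), hpt (0, 0, 1)}"

definition transform_on_Bl3 ::
    "(c3 \<Rightarrow> c3) \<Rightarrow> (c3 set \<times> c3 set) local_form set \<Rightarrow> bool" where
  "transform_on_Bl3 \<Omega> \<E> \<longleftrightarrow> foliation Bl3 \<E> \<and>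
     pulls_back fst {x \<in> points Bl3. fst x \<notin> coord_points} (plane_foliation \<Omega>) \<E>"

text \<open>The strict transforms of the coordinate lines and the exceptional curves together form the
  preimage of the coordinate triangle.\<close>

definition Delta6 :: "(c3 set \<times> c3 set) set" where
  "Delta6 = {x \<in> points Bl3. fst x \<in> curve (\<lambda>(X, Y, Z). X * Y * Z)}"

text \<open>The involution of \<open>Bl3\<close> induced by \<open>Q\<close> exchanges the two factors, and the linear map \<open>T3\<close> acts
  on each of them.\<close>

definition T6 :: "c3 set \<times> c3 set \<Rightarrow> c3 set \<times> c3 set" where
  "T6 = (\<lambda>(p, q). (T3 ` q, T3 ` p))"

definition T6_orbit :: "c3 set \<times> c3 set \<Rightarrow> (c3 set \<times> c3 set) set" where
  "T6_orbit x = {(T6 ^^ n) x |n. True}"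

definition Bl3_mod_T6 :: "(c3 set \<times> c3 set) set cspace" where
  "Bl3_mod_T6 = coinduced Bl3 {T6_orbit}"

text \<open>\<open>\<F>\<close> is induced on \<open>M\<close> by \<open>\<E>\<close>: it is the pull-back of \<open>\<E>\<close> by all local holomorphic lifts
  of \<open>\<pi>\<close> to \<open>Bl3\<close>; these exist near every point outside the exceptional curves of \<open>\<pi>\<close>.\<close>

definition induced_foliation ::
    "'a cspace \<Rightarrow> ('a \<Rightarrow> (c3 set \<times> c3 set) set) \<Rightarrow> (c3 set \<times> c3 set) local_form set
     \<Rightarrow> 'a local_form set \<Rightarrow> bool" where
  "induced_foliation M \<pi> \<E> \<F> \<longleftrightarrow> foliation M \<F> \<and>
     (\<forall>W s. openin (tp M) W \<and> morphism (restrict_space M W) Bl3 s \<and>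
        (\<forall>x\<in>W. T6_orbit (s x) = \<pi> x) \<longrightarrow> pulls_back s W \<E> \<F>)"

definition santos_foliation ::
    "complex \<Rightarrow> 'a cspace \<Rightarrow> ('a \<Rightarrow> (c3 set \<times> c3 set) set) \<Rightarrow> 'a local_form set \<Rightarrow> bool" where
  "santos_foliation \<omega> M \<pi> \<F> \<longleftrightarrow> minimal_desingularization Bl3_mod_T6 M \<pi> \<and>
     (\<exists>\<E>6. transform_on_Bl3 (E3 \<omega>) \<E>6 \<and> induced_foliation M \<pi> \<E>6 \<F>)"

text \<open>\<open>T6\<close> generates a group acting freely along \<open>Delta6\<close>, so that \<open>\<pi>\<close> is an isomorphism near the
  image of \<open>Delta6\<close> in the quotient.\<close>

definition santos_link :: "'a cspace \<Rightarrow> ('a \<Rightarrow> (c3 set \<times> c3 set) set) \<Rightarrow> 'a set" where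
  "santos_link M \<pi> = {x \<in> points M. \<pi> x \<in> T6_orbit ` Delta6}"

subsection \<open>The explicit models agree with their descriptions\<close>

lemma hpt_eq_iff: "hpt v = hpt w \<longleftrightarrow> (\<exists>c. c \<noteq> 0 \<and> v = csc c w)"
proof
  assume "hpt v = hpt w"
  moreover have "v \<in> hpt v"
    unfolding hpt_def csc_def by (auto intro!: exI[of _ 1] split: prod.splits)
  ultimately have "v \<in> hpt w" by simp
  then show "\<exists>c. c \<noteq> 0 \<and> v = csc c w"
    unfolding hpt_def by auto
next
  assume "\<exists>c. c \<noteq> 0 \<and> v = csc c w"
  then obtain c where c: "c \<noteq> 0" "v = csc c w" by blast
  have 1: "csc d v = csc (d * c) w" for d
    by (simp add: c(2) csc_def split: prod.splits)
  have 2: "csc d w = csc (d / c) v" for d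
    using c(1) by (simp add: c(2) csc_def split: prod.splits)
  show "hpt v = hpt w"
  proof
    show "hpt v \<subseteq> hpt w"
    proof
      fix x assume "x \<in> hpt v"
      then obtain d where "d \<noteq> 0" "x = csc d v" unfolding hpt_def by blast
      then show "x \<in> hpt w"
        unfolding hpt_def using 1[of d] c(1) by (auto intro!: exI[of _ "d * c"])
    qed
    show "hpt w \<subseteq> hpt v"
    proof
      fix x assume "x \<in> hpt w"
      then obtain d where "d \<noteq> 0" "x = csc d w" unfolding hpt_def by blast
      then show "x \<in> hpt v"
        unfolding hpt_def using 2[of d] c(1) by (auto intro!: exI[of _ "d / c"])
    qed
  qed
qed

lemma hpt_scale: "c \<noteq> 0 \<Longrightarrow> hpt (c * x, c * y, c * z) = hpt (x, y, z)"
  unfolding hpt_eq_iff by (auto simp: csc_def)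

lemma T3_hpt: "T3 ` hpt v = hpt (T3 v)"
  unfolding hpt_def T3_def csc_def by (auto split: prod.splits simp: image_iff)

lemma points_P2: "points P2 = hpt ` (- {0})"
proof
  show "points P2 \<subseteq> hpt ` (- {0})"
    by (auto simp: P2_def points_coinduced C2_def aff1_def aff2_def aff3_def zero_prod_def
        intro!: imageI)
  show "hpt ` (- {0}) \<subseteq> points P2"
  proof
    fix p assume "p \<in> hpt ` (- {0})"
    then obtain x y z where p: "p = hpt (x, y, z)" and nz: "x \<noteq> 0 \<or> y \<noteq> 0 \<or> z \<noteq> 0"
      by (auto simp: zero_prod_def)
    have "p = aff1 (y / x, z / x)" if "x \<noteq> 0"
      using that hpt_scale[of x 1 "y / x" "z / x"] by (simp add: p aff1_def)
    moreover have "p = aff2 (x / y, z / y)" if "y \<noteq> 0"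
      using that hpt_scale[of y "x / y" 1 "z / y"] by (simp add: p aff2_def)
    moreover have "p = aff3 (x / z, y / z)" if "z \<noteq> 0"
      using that hpt_scale[of z "x / z" "y / z" 1] by (simp add: p aff3_def)
    ultimately show "p \<in> points P2"
      using nz by (auto simp: P2_def points_coinduced C2_def)
  qed
qed

lemma points_Bl3:
  "points Bl3 = {(hpt (X, Y, Z), hpt (A, B, C)) |X Y Z A B C.
     (X, Y, Z) \<noteq> 0 \<and> (A, B, C) \<noteq> 0 \<and> X * A = Y * B \<and> Y * B = Z * C}"
  (is "_ = ?S")
proof
  define S where "S = ?S"
  have S: "(hpt (X, Y, Z), hpt (A, B, C)) \<in> S"
    if "(X, Y, Z) \<noteq> 0" "(A, B, C) \<noteq> 0" "X * A = Y * B" "Y * B = Z * C" for X Y Z A B C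
    using that unfolding S_def by blast
  show "points Bl3 \<subseteq> ?S"
  proof
    fix p assume "p \<in> points Bl3"
    then obtain c u v where c: "c \<in> bl_charts" and p: "p = c (u, v)"
      unfolding Bl3_def points_coinduced by auto
    have "p = (hpt (1, u * v, u), hpt (u * v, 1, v)) \<or> p = (hpt (u * v, 1, v), hpt (1, u * v, u)) \<or>
        p = (hpt (u, 1, u * v), hpt (v, u * v, 1)) \<or> p = (hpt (v, u * v, 1), hpt (u, 1, u * v)) \<or>
        p = (hpt (u * v, u, 1), hpt (1, v, u * v)) \<or> p = (hpt (1, v, u * v), hpt (u * v, u, 1))"
      using c unfolding p bl_charts_def by (elim insertE emptyE) simp_all
    moreover have
      "(hpt (1, u * v, u), hpt (u * v, 1, v)) \<in> S" "(hpt (u * v, 1, v), hpt (1, u * v, u)) \<in> S"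
      "(hpt (u, 1, u * v), hpt (v, u * v, 1)) \<in> S" "(hpt (v, u * v, 1), hpt (u, 1, u * v)) \<in> S"
      "(hpt (u * v, u, 1), hpt (1, v, u * v)) \<in> S" "(hpt (1, v, u * v), hpt (u * v, u, 1)) \<in> S"
      by (rule S; simp add: zero_prod_def)+
    ultimately have "p \<in> S" by metis
    then show "p \<in> ?S" by (simp only: S_def)
  qed
  have "\<forall>c\<in>bl_charts. \<forall>u v. c (u, v) \<in> points Bl3"
    by (auto simp: Bl3_def points_coinduced C2_def)
  note charts = this[unfolded bl_charts_def ball_simps prod.case]
  show "?S \<subseteq> points Bl3"
  proof
    fix p assume "p \<in> ?S"
    then obtain X Y Z A B C where p: "p = (hpt (X, Y, Z), hpt (A, B, C))"
      and nz: "X \<noteq> 0 \<or> Y \<noteq> 0 \<or> Z \<noteq> 0" "A \<noteq> 0 \<or> B \<noteq> 0 \<or> C \<noteq> 0"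
      and eq: "X * A = Y * B" "Y * B = Z * C"
      by (auto simp: zero_prod_def)
    have 1: "\<exists>u v. p = (hpt (1, u * v, u), hpt (u * v, 1, v))" if "X \<noteq> 0" "B \<noteq> 0"
    proof -
      have "Y = X * (Z / X * (C / B))" "A = B * (Z / X * (C / B))"
        using that eq by (auto simp: field_simps)
      then show ?thesis
        using that hpt_scale[of X 1 "Z / X * (C / B)" "Z / X"] hpt_scale[of B "Z / X * (C / B)" 1 "C / B"]
        by (intro exI[of _ "Z / X"] exI[of _ "C / B"]) (simp add: p)
    qed
    have 2: "\<exists>u v. p = (hpt (u * v, 1, v), hpt (1, u * v, u))" if "Y \<noteq> 0" "A \<noteq> 0"
    proof -
      have "X = Y * (C / A * (Z / Y))" "B = A * (C / A * (Z / Y))"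
        using that eq by (auto simp: field_simps)
      then show ?thesis
        using that hpt_scale[of Y "C / A * (Z / Y)" 1 "Z / Y"] hpt_scale[of A 1 "C / A * (Z / Y)" "C / A"]
        by (intro exI[of _ "C / A"] exI[of _ "Z / Y"]) (simp add: p)
    qed
    have 3: "\<exists>u v. p = (hpt (u, 1, u * v), hpt (v, u * v, 1))" if "Y \<noteq> 0" "C \<noteq> 0"
    proof -
      have "Z = Y * (X / Y * (A / C))" "B = C * (X / Y * (A / C))"
        using that eq by (auto simp: field_simps)
      then show ?thesis
        using that hpt_scale[of Y "X / Y" 1 "X / Y * (A / C)"] hpt_scale[of C "A / C" "X / Y * (A / C)" 1]
        by (intro exI[of _ "X / Y"] exI[of _ "A / C"]) (simp add: p)
    qed
    have 4: "\<exists>u v. p = (hpt (v, u * v, 1), hpt (u, 1, u * v))" if "Z \<noteq> 0" "B \<noteq> 0"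
    proof -
      have "Y = Z * (A / B * (X / Z))" "C = B * (A / B * (X / Z))"
        using that eq by (auto simp: field_simps)
      then show ?thesis
        using that hpt_scale[of Z "X / Z" "A / B * (X / Z)" 1] hpt_scale[of B "A / B" 1 "A / B * (X / Z)"]
        by (intro exI[of _ "A / B"] exI[of _ "X / Z"]) (simp add: p)
    qed
    have 5: "\<exists>u v. p = (hpt (u * v, u, 1), hpt (1, v, u * v))" if "Z \<noteq> 0" "A \<noteq> 0"
    proof -
      have "X = Z * (Y / Z * (B / A))" "C = A * (Y / Z * (B / A))"
        using that eq by (auto simp: field_simps)
      then show ?thesis
        using that hpt_scale[of Z "Y / Z * (B / A)" "Y / Z" 1] hpt_scale[of A 1 "B / A" "Y / Z * (B / A)"]
        by (intro exI[of _ "Y / Z"] exI[of _ "B / A"]) (simp add: p)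
    qed
    have 6: "\<exists>u v. p = (hpt (1, v, u * v), hpt (u * v, u, 1))" if "X \<noteq> 0" "C \<noteq> 0"
    proof -
      have "Z = X * (B / C * (Y / X))" "A = C * (B / C * (Y / X))"
        using that eq by (auto simp: field_simps)
      then show ?thesis
        using that hpt_scale[of X 1 "Y / X" "B / C * (Y / X)"] hpt_scale[of C "B / C * (Y / X)" "B / C" 1]
        by (intro exI[of _ "B / C"] exI[of _ "Y / X"]) (simp add: p)
    qed
    have "X \<noteq> 0 \<and> B \<noteq> 0 \<or> Y \<noteq> 0 \<and> A \<noteq> 0 \<or> Y \<noteq> 0 \<and> C \<noteq> 0 \<or> Z \<noteq> 0 \<and> B \<noteq> 0 \<or>
      Z \<noteq> 0 \<and> A \<noteq> 0 \<or> X \<noteq> 0 \<and> C \<noteq> 0"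
      using nz eq by auto
    then show "p \<in> points Bl3"
      using 1 2 3 4 5 6 charts by metis
  qed
qed

lemma T6_lifts_T3_Q:
  assumes "(p, q) \<in> points Bl3" "p = hpt v" "Q v \<noteq> 0"
  shows "q = hpt (Q v)" "fst (T6 (p, q)) = hpt (T3 (Q v))"
proof -
  from assms(1) obtain X Y Z A B C where
    pq: "p = hpt (X, Y, Z)" "q = hpt (A, B, C)" and
    nz: "(A, B, C) \<noteq> 0" and eq: "X * A = Y * B" "Y * B = Z * C"
    unfolding points_Bl3 by blast
  obtain c where c: "c \<noteq> 0" "v = csc c (X, Y, Z)"
    using assms(2) pq(1) hpt_eq_iff by metis
  have Qv: "Q v = csc (c\<^sup>2) (Y * Z, Z * X, X * Y)"
    by (simp add: c(2) Q_def csc_def power2_eq_square)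
  then have Qnz: "Y * Z \<noteq> 0 \<or> Z * X \<noteq> 0 \<or> X * Y \<noteq> 0"
    using assms(3) by (auto simp: csc_def zero_prod_def)
  have "\<exists>d. d \<noteq> 0 \<and> (A, B, C) = csc d (Y * Z, Z * X, X * Y)"
  proof -
    consider "Y * Z \<noteq> 0" | "Z * X \<noteq> 0" | "X * Y \<noteq> 0" using Qnz by blast
    then show ?thesis
    proof cases
      case 1
      define d where "d = A / (Y * Z)"
      have "A = d * (Y * Z)" "B = d * (Z * X)" "C = d * (X * Y)"
        using eq 1 by (auto simp: d_def field_simps)
      moreover from this have "d \<noteq> 0" using nz by (auto simp: zero_prod_def)
      ultimately show ?thesis by (intro exI[of _ d]) (simp add: csc_def)
    next
      case 2
      define d where "d = B / (Z * X)"
      have "A = d * (Y * Z)" "B = d * (Z * X)" "C = d * (X * Y)"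
        using eq 2 by (auto simp: d_def field_simps)
      moreover from this have "d \<noteq> 0" using nz by (auto simp: zero_prod_def)
      ultimately show ?thesis by (intro exI[of _ d]) (simp add: csc_def)
    next
      case 3
      define d where "d = C / (X * Y)"
      have "A = d * (Y * Z)" "B = d * (Z * X)" "C = d * (X * Y)"
        using eq 3 by (auto simp: d_def field_simps)
      moreover from this have "d \<noteq> 0" using nz by (auto simp: zero_prod_def)
      ultimately show ?thesis by (intro exI[of _ d]) (simp add: csc_def)
    qed
  qed
  then have "q = hpt (Y * Z, Z * X, X * Y)" by (simp add: pq(2) hpt_eq_iff)
  moreover have "hpt (Q v) = hpt (Y * Z, Z * X, X * Y)"
    unfolding hpt_eq_iff using Qv c(1) by (intro exI[of _ "c\<^sup>2"]) simp
  ultimately show q: "q = hpt (Q v)" by simp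
  then show "fst (T6 (p, q)) = hpt (T3 (Q v))"
    by (simp add: T6_def T3_hpt)
qed

section \<open>The foliation of degree two and its invariant curves\<close>

definition H6 :: "c3 \<Rightarrow> c3" where
  "H6 = (\<lambda>(x, y, z).
     (x * y\<^sup>2 - x * y * z + x * z\<^sup>2 - 5 * y ^ 3 + y\<^sup>2 * z,
      x * (5 * y\<^sup>2 - 3 * y * z - x * y + x * z),
      x * (2 * y\<^sup>2 - x * z)))"

definition cubic1 :: "c3 \<Rightarrow> complex" where
  "cubic1 = (\<lambda>(x, y, z). 3 * y ^ 3 - x * y\<^sup>2 + x * y * z - x * z\<^sup>2)"

definition line_x :: "c3 \<Rightarrow> complex" where
  "line_x = (\<lambda>(x, y, z). x)"

definition cubic2 :: "c3 \<Rightarrow> complex" where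
  "cubic2 = (\<lambda>(x, y, z).
     8 * y ^ 3 - 15 * x * y\<^sup>2 + 6 * x * y * z - 3 * x * z\<^sup>2 - 6 * x\<^sup>2 * y + 6 * x\<^sup>2 * z + x ^ 3)"

end

theory Submission
  imports Defs "HOL-Complex_Analysis.Complex_Analysis" "HOL-Computational_Algebra.Fundamental_Theorem_Algebra"
begin

text \<open>Put \<zeta> = \<omega> + 1, a primitive sixth root of unity with \<zeta>^2 = \<zeta> - 1
  = \<omega>. The blow-up \<open>Bl3\<close> is the sextic del Pezzo surface. In the chart
  \<open>cc\<close> its anticanonical sections are spanned by uv and by the six boundary monomials
  1, v, uv^2, u^2v^2, u^2v, u. The map \<open>T6\<close>, which sends (u, v) to (1/v, uv), fixes the
  first and permutes the others cyclically, up to a common factor 1/v. Hence the discrete Fourier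
  transforms \<open>s0\<close>, ..., \<open>s5\<close> of the boundary monomials are eigenvectors
  with eigenvalues \<zeta>^j, and \<open>dd\<close> = s0 - 6uv is invariant.

  The quadratic equations of the surface become \<open>quadrics\<close>. Set w = dd/s1, Y = s2
  dd/s1^2 and Z = s3 dd^2/s1^3. Then Y and Z are invariant, w is multiplied by a sixth root of
  unity, and w^6 = 12YZ - 8Y^3 - 3Z^2. Conversely Y, Z and w determine all ratios s_j/s1, and
  Fourier inversion then gives back u and v (\<open>section_algebra\<close>). So \<open>R\<close>,
  which is (Y, Z) after an affine change of coordinates, separates the orbits (\<open>R_inj\<close>)
  and has local holomorphic sections (\<open>local_section\<close>): it is a birational map from the
  quotient to the plane. In the plane coordinates w^6 is \<open>cubic2\<close>
  (\<open>cubic2_R\<close>), while \<open>cubic1\<close> pulls back to uv times a power of dd/s1 and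
  a power of 1/s1 (\<open>cubic1_R\<close>), so the cycle of six curves goes to the first cubic.

  In the same chart the foliation is generated by the vector field (\<zeta> - 1) u d/du - \<zeta> v
  d/dv, which sends s_j to s_(j+1) - s_j and dd to s1 - dd. The derivatives of Y and Z along it are
  therefore again expressible by the ratios s_j/s1 and w, and \<open>H6\<close> is seen to
  annihilate them (\<open>foliation_identity\<close>).

  To globalise, all six charts are translates of \<open>cc\<close>, so the quotient is the image of
  one map \<open>tau\<close> from the plane of (u, v). On the open set \<open>O0\<close> this yields
  an isomorphism from an open part of the quotient to the complement of \<open>cubic2\<close> in the
  affine chart x = 1 (\<open>iso_Y0\<close>). That part is smooth, so a desingularization is
  unchanged over it, which gives \<open>birational\<close>, \<open>pulls_back_H6\<close> (first at
  general points, then everywhere by continuity) and \<open>link\<close> (by closure, since the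
  quotient is smooth along the cycle).

  The plane statements are direct computations with gradients and tangent cones. For uniqueness, let
  a second form with coefficients A, B, C be tangent to both cubics and let A', B', C' be those of
  \<open>H6\<close>. On a general line z = c x the minor C A' - A C' has degree at most 6 in y but
  vanishes at 7 points: y = 0 and the three points of each cubic. So it vanishes identically, and
  the factorisation of C' forces the two forms to be proportional
  (\<open>uniqueness\<close>).\<close>

section \<open>Fourier eigenvectors of \<open>T6\<close> and the quotient map\<close>

locale sixth_root =
  fixes \<zeta> :: complex
  assumes zeta_sq: "\<zeta>\<^sup>2 = \<zeta> - 1"
begin

text \<open>With m_0, ..., m_5 the boundary monomials 1, v, uv^2, u^2v^2, u^2v, u, the section
  \<open>sj\<close> is the sum of \<zeta>^(-jk) m_k over k, written with \<zeta>^2 = \<zeta> - 1.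
  The monomials are the cubics through the three coordinate points, other than XYZ, after division
  by the equation u of the exceptional curve. Of the two-dimensional space of invariant sections
  spanned by \<open>s0\<close> and uv, \<open>dd\<close> is the element vanishing at the fixed point
  u = v = 1.\<close>

definition s0 :: "c2 \<Rightarrow> complex" where
  "s0 = (\<lambda>(u, v). 1 + v + u * v\<^sup>2 + u\<^sup>2 * v\<^sup>2 + u\<^sup>2 * v + u)"
definition s1 :: "c2 \<Rightarrow> complex" where
  "s1 = (\<lambda>(u, v). (1 - u\<^sup>2 * v\<^sup>2) + (1 - \<zeta>) * (v - u\<^sup>2 * v) - \<zeta> * (u * v\<^sup>2 - u))"
definition s2 :: "c2 \<Rightarrow> complex" where
  "s2 = (\<lambda>(u, v). (1 + u\<^sup>2 * v\<^sup>2) - \<zeta> * (v + u\<^sup>2 * v) + (\<zeta> - 1) * (u * v\<^sup>2 + u))"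
definition s3 :: "c2 \<Rightarrow> complex" where
  "s3 = (\<lambda>(u, v). 1 - v + u * v\<^sup>2 - u\<^sup>2 * v\<^sup>2 + u\<^sup>2 * v - u)"
definition s4 :: "c2 \<Rightarrow> complex" where
  "s4 = (\<lambda>(u, v). (1 + u\<^sup>2 * v\<^sup>2) + (\<zeta> - 1) * (v + u\<^sup>2 * v) - \<zeta> * (u * v\<^sup>2 + u))"
definition s5 :: "c2 \<Rightarrow> complex" where
  "s5 = (\<lambda>(u, v). (1 - u\<^sup>2 * v\<^sup>2) + \<zeta> * (v - u\<^sup>2 * v) + (\<zeta> - 1) * (u * v\<^sup>2 - u))"
definition dd :: "c2 \<Rightarrow> complex" where
  "dd = (\<lambda>(u, v). s0 (u, v) - 6 * u * v)"

lemmas s_defs = s0_def s1_def s2_def s3_def s4_def s5_def dd_def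

text \<open>Fourier transforms of the equations m_(k-1) m_(k+1) = uv m_k and m_k m_(k+3) = (uv)^2 of
  the del Pezzo surface. They allow s4, s5 and s0 to be eliminated once dd, s1, s2, s3 are
  known.\<close>

lemma quadrics:
  "dd z * s1 z = 2 * s2 z * s5 z - s3 z * s4 z"
  "dd z * s4 z = 3 * s1 z * s3 z - 2 * (s2 z)\<^sup>2"
  "dd z * s5 z = 2 * s1 z * s4 z - s2 z * s3 z"
  "dd z * s0 z = s1 z * s5 z + s2 z * s4 z - (s3 z)\<^sup>2"
proof -
  obtain u v where z: "z = (u, v)" by fastforce
  show "dd z * s1 z = 2 * s2 z * s5 z - s3 z * s4 z"
  "dd z * s4 z = 3 * s1 z * s3 z - 2 * (s2 z)\<^sup>2"
  "dd z * s5 z = 2 * s1 z * s4 z - s2 z * s3 z"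
  "dd z * s0 z = s1 z * s5 z + s2 z * s4 z - (s3 z)\<^sup>2"
  using zeta_sq unfolding z s_defs prod.case by algebra+
qed

text \<open>The exponents make the characters cancel, so these quotients are invariant under
  \<open>T6\<close>. The affine change in \<open>R\<close> puts the node (1:1:2) of
  \<open>cubic2\<close> at Y = Z = 0.\<close>

definition yy :: "c2 \<Rightarrow> complex" where "yy z = s2 z * dd z / (s1 z)\<^sup>2"
definition zz :: "c2 \<Rightarrow> complex" where "zz z = s3 z * (dd z)\<^sup>2 / (s1 z) ^ 3"
definition R :: "c2 \<Rightarrow> c2" where "R z = (1 - yy z, zz z + 2 - 3 * yy z)"

lemma cubic2_YZ: "cubic2 (1, 1 - Y, Z + 2 - 3 * Y) = 12 * Y * Z - 8 * Y ^ 3 - 3 * Z\<^sup>2"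
  by (simp add: cubic2_def) algebra

lemma cubic1_YZ:
  "-2 * cubic1 (1, 1 - Y, Z + 2 - 3 * Y) = 6 * Y ^ 3 + 2 * Z\<^sup>2 - 10 * Y * Z - 4 * Y\<^sup>2 + 6 * Z"
  by (simp add: cubic1_def) algebra

text \<open>In terms of the ratios a, b, c, f of s2, s3, s4, s5 to s1, three of the quadrics
  eliminate c and f and leave the equation of w^6. Thus w is a sixth root of \<open>cubic2\<close>
  along the image, and its six values label the points of an orbit.\<close>

lemma cubic2_R:
  assumes "s1 z \<noteq> 0"
  shows "cubic2 (1, R z) = (dd z / s1 z) ^ 6"
proof -
  define w where "w = dd z / s1 z"
  have d: "dd z = w * s1 z" using assms by (simp add: w_def)
  have y: "yy z = s2 z / s1 z * w" and z: "zz z = s3 z / s1 z * w\<^sup>2"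
    using assms by (simp_all add: yy_def zz_def d power2_eq_square power3_eq_cube)
  obtain a b c f where abc: "s2 z = a * s1 z" "s3 z = b * s1 z" "s4 z = c * s1 z" "s5 z = f * s1 z"
    using assms by (metis nonzero_divide_eq_eq)
  have "w = 2 * a * f - b * c" "w * c = 3 * b - 2 * a\<^sup>2" "w * f = 2 * c - a * b"
  proof -
    have "s1 z * (s1 z * w) = s1 z * (s1 z * (2 * a * f - b * c))" "s1 z * (s1 z * (w * c)) = s1 z * (s1 z * (3 * b - 2 * a\<^sup>2))" "s1 z * (s1 z * (w * f)) = s1 z * (s1 z * (2 * c - a * b))"
      using quadrics(1-3)[of z] unfolding d abc by algebra+
    then show "w = 2 * a * f - b * c" "w * c = 3 * b - 2 * a\<^sup>2" "w * f = 2 * c - a * b" using assms by (simp_all only: mult_cancel_left) simp_all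
  qed
  then have "12 * (a * w) * (b * w\<^sup>2) - 8 * (a * w) ^ 3 - 3 * (b * w\<^sup>2)\<^sup>2 = w ^ 6"
    by algebra
  then show ?thesis
    using assms unfolding R_def cubic2_YZ w_def[symmetric] y z abc by simp
qed


text \<open>Here uv enters through s0 = dd + 6uv and the fourth quadric. It shows that the first
  cubic corresponds to the cycle uv = 0.\<close>

lemma cubic1_R:
  assumes "s1 z \<noteq> 0"
  shows "cubic1 (1, R z) = -3 * (fst z * snd z) * (dd z) ^ 5 / (s1 z) ^ 6"
proof -
  define w where "w = dd z / s1 z"
  define e where "e = fst z * snd z / s1 z"
  have d: "dd z = w * s1 z" using assms by (simp add: w_def)
  have y: "yy z = s2 z / s1 z * w" and z: "zz z = s3 z / s1 z * w\<^sup>2"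
    using assms by (simp_all add: yy_def zz_def d power2_eq_square power3_eq_cube)
  obtain a b c f where abc: "s2 z = a * s1 z" "s3 z = b * s1 z" "s4 z = c * s1 z" "s5 z = f * s1 z"
    using assms by (metis nonzero_divide_eq_eq)
  have s0: "s0 z = (w + 6 * e) * s1 z"
    using assms d by (cases z) (simp add: dd_def e_def algebra_simps)
  have "w = 2 * a * f - b * c" "w * c = 3 * b - 2 * a\<^sup>2" "w * f = 2 * c - a * b"
    "w * (w + 6 * e) = f + a * c - b\<^sup>2"
  proof -
    have "s1 z * (s1 z * w) = s1 z * (s1 z * (2 * a * f - b * c))"
      "s1 z * (s1 z * (w * c)) = s1 z * (s1 z * (3 * b - 2 * a\<^sup>2))"
      "s1 z * (s1 z * (w * f)) = s1 z * (s1 z * (2 * c - a * b))"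
      "s1 z * (s1 z * (w * (w + 6 * e))) = s1 z * (s1 z * (f + a * c - b\<^sup>2))"
      using quadrics[of z] unfolding d abc s0 by algebra+
    then show "w = 2 * a * f - b * c" "w * c = 3 * b - 2 * a\<^sup>2" "w * f = 2 * c - a * b"
      "w * (w + 6 * e) = f + a * c - b\<^sup>2"
      using assms by (simp_all only: mult_cancel_left) simp_all
  qed
  then have "6 * (a * w) ^ 3 + 2 * (b * w\<^sup>2)\<^sup>2 - 10 * (a * w) * (b * w\<^sup>2) - 4 * (a * w)\<^sup>2 + 6 * (b * w\<^sup>2)
      = -2 * (- 3 * e * w ^ 5)"
    by algebra
  then have "- 2 * cubic1 (1, R z) = - 2 * (- 3 * e * w ^ 5)"
    using assms unfolding R_def cubic1_YZ y z abc by simp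
  then have "cubic1 (1, R z) = - 3 * e * w ^ 5" by (simp only: mult_cancel_left) simp
  also have "\<dots> = -3 * (fst z * snd z) * (dd z) ^ 5 / (s1 z) ^ 6"
    using assms by (simp add: e_def w_def power_divide eval_nat_numeral)
  finally show ?thesis .
qed

text \<open>The \<open>T6\<close>-orbit of (u, v) in the coordinates of the chart \<open>cc\<close>;
  the side conditions say when a translate remains in that chart.\<close>

definition rel :: "c2 \<Rightarrow> c2 \<Rightarrow> bool" where
  "rel = (\<lambda>(u, v) z. z = (u, v) \<or> v \<noteq> 0 \<and> z = (1 / v, u * v) \<or> u \<noteq> 0 \<and> z = (u * v, 1 / u) \<or>
     u \<noteq> 0 \<and> v \<noteq> 0 \<and> (z = (1 / (u * v), u) \<or> z = (1 / u, 1 / v) \<or> z = (v, 1 / (u * v))))"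

lemma zeta_mult: "\<zeta> * \<zeta> = \<zeta> - 1" "\<zeta> * (\<zeta> * x) = \<zeta> * x - x"
proof -
  show "\<zeta> * \<zeta> = \<zeta> - 1" using zeta_sq by (simp add: power2_eq_square)
  then have "\<zeta> * \<zeta> * x = (\<zeta> - 1) * x" by simp
  then show "\<zeta> * (\<zeta> * x) = \<zeta> * x - x" by (simp add: algebra_simps)
qed

lemma zeta_6: "\<zeta> ^ 6 = 1" using zeta_sq by algebra

text \<open>\<rho> is a change of trivialisation and \<eta> a character value; both cancel in the
  quotients defining \<open>R\<close>.\<close>

lemma scale:
  assumes "s0 z' = \<rho> * s0 z" "s1 z' = \<rho> * \<eta> * s1 z" "s2 z' = \<rho> * \<eta>\<^sup>2 * s2 z" "s3 z' = \<rho> * \<eta> ^ 3 * s3 z"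
    "dd z' = \<rho> * dd z" "\<rho> \<noteq> 0" "\<eta> \<noteq> 0"
  shows "(s1 z' = 0 \<longleftrightarrow> s1 z = 0) \<and> (dd z' = 0 \<longleftrightarrow> dd z = 0) \<and> R z' = R z"
  using assms(6,7) unfolding R_def yy_def zz_def assms(1-5)
  by (simp add: power_mult_distrib power2_eq_square power3_eq_cube)

lemma rel_step_R:
  assumes "v \<noteq> 0"
  shows "(s1 (1 / v, u * v) = 0 \<longleftrightarrow> s1 (u, v) = 0) \<and> (dd (1 / v, u * v) = 0 \<longleftrightarrow> dd (u, v) = 0) \<and>
    R (1 / v, u * v) = R (u, v)"
proof -
  define b where "b = 1 / v"
  have i: "v * b = 1" using assms by (simp add: b_def)
  have z0: "\<zeta> \<noteq> 0" using zeta_sq by auto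
  have g0: "s0 (b, u * v) = b * s0 (u, v)" using i zeta_sq unfolding s_defs prod.case by algebra
  have g1: "s1 (b, u * v) = b * \<zeta> * s1 (u, v)" using i zeta_sq unfolding s_defs prod.case by algebra
  have g2: "s2 (b, u * v) = b * \<zeta>\<^sup>2 * s2 (u, v)" using i zeta_sq unfolding s_defs prod.case by algebra
  have g3: "s3 (b, u * v) = b * \<zeta> ^ 3 * s3 (u, v)" using i zeta_sq unfolding s_defs prod.case by algebra
  have g4: "dd (b, u * v) = b * dd (u, v)" using i zeta_sq unfolding s_defs prod.case by algebra
  show ?thesis unfolding b_def[symmetric] by (rule scale[OF g0 g1 g2 g3 g4]) (use i z0 in auto)
qed

lemma rel_R:
  assumes "rel z z'"
  shows "(s1 z' = 0 \<longleftrightarrow> s1 z = 0) \<and> (dd z' = 0 \<longleftrightarrow> dd z = 0) \<and> R z' = R z"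
proof -
  obtain u v where z: "z = (u, v)" by fastforce
  consider "z' = (u, v)" | "v \<noteq> 0" "z' = (1 / v, u * v)" | "u \<noteq> 0" "z' = (u * v, 1 / u)"
    | "u \<noteq> 0" "v \<noteq> 0" "z' = (1 / (u * v), u) \<or> z' = (1 / u, 1 / v) \<or> z' = (v, 1 / (u * v))"
    using assms unfolding rel_def z by auto
  then show ?thesis
  proof cases
    case 1 then show ?thesis by (simp add: z)
  next
    case 2 then show ?thesis using rel_step_R[of v u] by (simp add: z)
  next
    case 3 then show ?thesis using rel_step_R[of "1 / u" "u * v"] by (simp add: z)
  next
    \<comment> \<open>The other translates are reached from (u, v) by iterating the generator up to
      four times.\<close>
    case 4
    then show ?thesis
      using rel_step_R[of v u] rel_step_R[of "u * v" "1 / v"] rel_step_R[of u "1 / (u * v)"]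
        rel_step_R[of "1 / v" "1 / u"] by (auto simp: z)
  qed
qed

lemma root6_cases:
  assumes "\<eta> ^ 6 = (1::complex)"
  obtains "\<eta> = 1" | "\<eta> = \<zeta>" | "\<eta> = \<zeta> - 1" | "\<eta> = - 1" | "\<eta> = - \<zeta>" | "\<eta> = 1 - \<zeta>"
proof -
  have "(\<eta> - 1) * (\<eta> - \<zeta>) * (\<eta> - (\<zeta> - 1)) * (\<eta> - - 1) * (\<eta> - - \<zeta>) * (\<eta> - (1 - \<zeta>)) = 0"
    using assms zeta_sq by algebra
  then show thesis using that unfolding mult_eq_0_iff right_minus_eq by blast
qed

text \<open>Fourier inversion on the cyclic group of order six recovers the boundary monomials from
  their transforms.\<close>

lemma fourier:
  "s0 (u, v) + s1 (u, v) + s2 (u, v) + s3 (u, v) + s4 (u, v) + s5 (u, v) = 6"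
  "s0 (u, v) + \<zeta> * s1 (u, v) + (\<zeta> - 1) * s2 (u, v) - s3 (u, v) - \<zeta> * s4 (u, v) + (1 - \<zeta>) * s5 (u, v) = 6 * v"
  "s0 (u, v) + (\<zeta> - 1) * s1 (u, v) - \<zeta> * s2 (u, v) + s3 (u, v) + (\<zeta> - 1) * s4 (u, v) - \<zeta> * s5 (u, v) = 6 * (u * v\<^sup>2)"
  "s0 (u, v) - s1 (u, v) + s2 (u, v) - s3 (u, v) + s4 (u, v) - s5 (u, v) = 6 * (u\<^sup>2 * v\<^sup>2)"
  "s0 (u, v) - \<zeta> * s1 (u, v) + (\<zeta> - 1) * s2 (u, v) + s3 (u, v) - \<zeta> * s4 (u, v) + (\<zeta> - 1) * s5 (u, v) = 6 * (u\<^sup>2 * v)"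
  "s0 (u, v) + (1 - \<zeta>) * s1 (u, v) - \<zeta> * s2 (u, v) - s3 (u, v) + (\<zeta> - 1) * s4 (u, v) + \<zeta> * s5 (u, v) = 6 * u"
proof -
  show "s0 (u, v) + s1 (u, v) + s2 (u, v) + s3 (u, v) + s4 (u, v) + s5 (u, v) = 6"
    unfolding s_defs prod.case by (simp add: algebra_simps)
  show "s0 (u, v) + \<zeta> * s1 (u, v) + (\<zeta> - 1) * s2 (u, v) - s3 (u, v) - \<zeta> * s4 (u, v) + (1 - \<zeta>) * s5 (u, v) = 6 * v"
    using zeta_sq unfolding s_defs prod.case by algebra
  show "s0 (u, v) + (\<zeta> - 1) * s1 (u, v) - \<zeta> * s2 (u, v) + s3 (u, v) + (\<zeta> - 1) * s4 (u, v) - \<zeta> * s5 (u, v) = 6 * (u * v\<^sup>2)"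
    using zeta_sq unfolding s_defs prod.case by algebra
  show "s0 (u, v) - s1 (u, v) + s2 (u, v) - s3 (u, v) + s4 (u, v) - s5 (u, v) = 6 * (u\<^sup>2 * v\<^sup>2)"
    unfolding s_defs prod.case by (simp add: algebra_simps)
  show "s0 (u, v) - \<zeta> * s1 (u, v) + (\<zeta> - 1) * s2 (u, v) + s3 (u, v) - \<zeta> * s4 (u, v) + (\<zeta> - 1) * s5 (u, v) = 6 * (u\<^sup>2 * v)"
    using zeta_sq unfolding s_defs prod.case by algebra
  show "s0 (u, v) + (1 - \<zeta>) * s1 (u, v) - \<zeta> * s2 (u, v) - s3 (u, v) + (\<zeta> - 1) * s4 (u, v) + \<zeta> * s5 (u, v) = 6 * u"
    using zeta_sq unfolding s_defs prod.case by algebra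
qed

text \<open>Equal images have equal w^6, so w' = \<eta> w with \<eta>^6 = 1. The quadrics then
  determine all ratios s_j/s1 at z' from those at z, multiplied by powers of \<eta>. Multiplying
  Fourier coefficients by a character is a cyclic shift of the monomials, which is one of the six
  moves of \<open>rel\<close>.\<close>

lemma R_inj:
  assumes nz: "s1 z \<noteq> 0" "dd z \<noteq> 0" "s1 z' \<noteq> 0" "dd z' \<noteq> 0" and R: "R z' = R z"
  shows "rel z z'"
proof -
  obtain u v where z: "z = (u, v)" by fastforce
  obtain u' v' where z': "z' = (u', v')" by fastforce
  define w where "w = dd z / s1 z"
  define w' where "w' = dd z' / s1 z'"
  have w0: "w \<noteq> 0" "w' \<noteq> 0" using nz by (simp_all add: w_def w'_def)
  define \<eta> where "\<eta> = w' / w"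
  have w': "w' = \<eta> * w" using w0 by (simp add: \<eta>_def)
  have "w ^ 6 = w' ^ 6"
    using cubic2_R[of z] cubic2_R[of z'] nz R by (simp add: w_def w'_def)
  then have eta: "\<eta> ^ 6 = 1" using w0 by (simp add: \<eta>_def power_divide)
  have d: "dd z = w * s1 z" "dd z' = w' * s1 z'" using nz by (simp_all add: w_def w'_def)
  have yz: "yy z = s2 z / s1 z * w" "zz z = s3 z / s1 z * w\<^sup>2"
    "yy z' = s2 z' / s1 z' * w'" "zz z' = s3 z' / s1 z' * w'\<^sup>2"
    using nz by (simp_all add: yy_def zz_def d power2_eq_square power3_eq_cube)
  obtain a b c f g where abc: "s2 z = a * s1 z" "s3 z = b * s1 z" "s4 z = c * s1 z" "s5 z = f * s1 z"
    "s0 z = g * s1 z"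
    using nz by (metis nonzero_divide_eq_eq)
  obtain a' b' c' f' g' where abc': "s2 z' = a' * s1 z'" "s3 z' = b' * s1 z'" "s4 z' = c' * s1 z'"
    "s5 z' = f' * s1 z'" "s0 z' = g' * s1 z'"
    using nz by (metis nonzero_divide_eq_eq)
  have yy: "yy z' = yy z" and zz: "zz z' = zz z" using R by (auto simp: R_def)
  have 1: "a' * (\<eta> * w) = a * w" using yy nz unfolding yz abc abc' w' by simp
  have 2: "b' * (\<eta> * w)\<^sup>2 = b * w\<^sup>2" using zz nz unfolding yz abc abc' w' by simp
  have 3: "w * c = 3 * b - 2 * a\<^sup>2" "w * f = 2 * c - a * b" "w * g = f + a * c - b\<^sup>2"
  proof -
    have "s1 z * (s1 z * (w * c)) = s1 z * (s1 z * (3 * b - 2 * a\<^sup>2))"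
      "s1 z * (s1 z * (w * f)) = s1 z * (s1 z * (2 * c - a * b))"
      "s1 z * (s1 z * (w * g)) = s1 z * (s1 z * (f + a * c - b\<^sup>2))"
      using quadrics[of z] unfolding d abc by algebra+
    then show "w * c = 3 * b - 2 * a\<^sup>2" "w * f = 2 * c - a * b" "w * g = f + a * c - b\<^sup>2"
      using nz by (simp_all only: mult_cancel_left) simp_all
  qed
  have 4: "\<eta> * w * c' = 3 * b' - 2 * a'\<^sup>2" "\<eta> * w * f' = 2 * c' - a' * b'"
    "\<eta> * w * g' = f' + a' * c' - b'\<^sup>2"
  proof -
    have "s1 z' * (s1 z' * (\<eta> * w * c')) = s1 z' * (s1 z' * (3 * b' - 2 * a'\<^sup>2))"
      "s1 z' * (s1 z' * (\<eta> * w * f')) = s1 z' * (s1 z' * (2 * c' - a' * b'))"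
      "s1 z' * (s1 z' * (\<eta> * w * g')) = s1 z' * (s1 z' * (f' + a' * c' - b'\<^sup>2))"
      using quadrics[of z'] unfolding d abc' w' by algebra+
    then show "\<eta> * w * c' = 3 * b' - 2 * a'\<^sup>2" "\<eta> * w * f' = 2 * c' - a' * b'"
      "\<eta> * w * g' = f' + a' * c' - b'\<^sup>2"
      using nz by (simp_all only: mult_cancel_left) simp_all
  qed
  have cancel: "x = y" if "w * x = w * y" for x y using that w0 by simp
  have aw: "a' * \<eta> = a" by (rule cancel) (use 1 in algebra)
  have bw: "b' * \<eta>\<^sup>2 = b" by (rule cancel, rule cancel) (use 2 in algebra)
  have "a' = \<eta> ^ 6 * a'" by (simp add: eta)
  also have "\<dots> = \<eta> ^ 5 * (a' * \<eta>)" by (simp add: eval_nat_numeral algebra_simps)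
  finally have a': "a' = \<eta> ^ 5 * a" by (simp only: aw)
  have "b' = \<eta> ^ 6 * b'" by (simp add: eta)
  also have "\<dots> = \<eta> ^ 4 * (b' * \<eta>\<^sup>2)" by (simp add: eval_nat_numeral algebra_simps)
  finally have b': "b' = \<eta> ^ 4 * b" by (simp only: bw)
  have e0: "\<eta> \<noteq> 0" using eta by auto
  have cancel': "x = y" if "\<eta> * x = \<eta> * y" for x y using that e0 by simp
  have e6: "\<eta> ^ (6 + k) = \<eta> ^ k" for k by (simp only: power_add eta mult_1)
  note e_red = e6[of 0, simplified] e6[of 1, simplified] e6[of 2, simplified] e6[of 3, simplified] e6[of 4, simplified]
  have "\<eta> * w * c' = \<eta> ^ 4 * (3 * b) - \<eta> ^ 10 * (2 * a\<^sup>2)" unfolding 4 a' b' by (simp add: eval_nat_numeral algebra_simps)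
  also have "\<dots> = \<eta> * (w * (\<eta> ^ 3 * c))" unfolding e_red left_diff_distrib right_diff_distrib[symmetric] 3(1)[symmetric] by (simp add: eval_nat_numeral)
  finally have c': "c' = \<eta> ^ 3 * c" by (metis cancel cancel' mult.assoc)
  have "\<eta> * w * f' = \<eta> ^ 3 * (2 * c) - \<eta> ^ 9 * (a * b)" unfolding 4 a' b' c' by (simp add: eval_nat_numeral algebra_simps)
  also have "\<dots> = \<eta> * (w * (\<eta>\<^sup>2 * f))" unfolding e_red right_diff_distrib[symmetric] 3(2)[symmetric] by (simp add: eval_nat_numeral)
  finally have f': "f' = \<eta>\<^sup>2 * f" by (metis cancel cancel' mult.assoc)
  have "\<eta> * w * g' = \<eta>\<^sup>2 * f + \<eta> ^ 8 * (a * c) - \<eta> ^ 8 * b\<^sup>2" unfolding 4 a' b' c' f' by (simp add: eval_nat_numeral algebra_simps)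
  also have "\<dots> = \<eta> * (w * (\<eta> * g))" unfolding e_red right_diff_distrib[symmetric] distrib_left[symmetric] 3(3)[symmetric] by (simp add: eval_nat_numeral)
  finally have g': "g' = \<eta> * g" by (metis cancel cancel' mult.assoc)
  define \<rho> where "\<rho> = s1 z' * \<eta> / s1 z"
  have "\<rho> * \<eta> ^ 5 = \<eta> ^ 6 * s1 z' / s1 z" unfolding \<rho>_def by (simp add: power_numeral_reduce)
  then have s1': "s1 z' = \<rho> * \<eta> ^ 5 * s1 z" using nz eta by simp
  \<comment> \<open>Modulo \<eta>^6 = 1 these say that s_j at z' is \<rho> \<eta>^(-j) times s_j at
    z, for all j.\<close>
  have "s0 z' = \<rho> * \<eta> ^ 6 * s0 z" "s2 z' = \<rho> * \<eta> ^ 10 * s2 z"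
    "s3 z' = \<rho> * \<eta> ^ 9 * s3 z" "s4 z' = \<rho> * \<eta> ^ 8 * s4 z" "s5 z' = \<rho> * \<eta> ^ 7 * s5 z"
    unfolding abc abc' a' b' c' f' g' s1' by (simp_all add: eval_nat_numeral algebra_simps)
  note s' = this[unfolded e_red] s1'
  note F' = fourier[of u' v', folded z', unfolded s']
  note F = fourier[of u v, folded z]
  \<comment> \<open>In each case the first inverse Fourier equation fixes \<rho>, since the monomial
    1 at z' is \<rho> times the shifted monomial at z; the second and sixth equations then give v'
    and u'.\<close>
  from eta show ?thesis
  proof (cases rule: root6_cases)
    case 1
    note G = F'[unfolded 1 power_one mult_1_right]
    have "\<rho> * 6 = 6" using G(1) unfolding F(1)[symmetric] by (simp add: algebra_simps)
    then have c0: "\<rho> = 1" by simp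
    have c1: "u' = u" using G(6) F(6) unfolding c0 by simp
    have c2: "v' = v" using G(2) F(2) unfolding c0 by simp
    from c0 c1 c2 show ?thesis by (simp add: z z' rel_def)
  next
    case 2
    have p: "\<eta> ^ 2 = \<zeta> - 1" "\<eta> ^ 3 = - 1" "\<eta> ^ 4 = - \<zeta>" "\<eta> ^ 5 = 1 - \<zeta>"
      by (simp_all add: 2 eval_nat_numeral algebra_simps zeta_mult)
    have "6 = \<rho> * (6 * u)"
      by (rule trans[OF F'(1)[unfolded p, unfolded 2, symmetric]], subst F(6)[symmetric], simp add: algebra_simps zeta_mult)
    then have c0: "\<rho> * u = 1" by simp
    have "6 * u' = \<rho> * (6 * (u\<^sup>2 * v))"
      by (rule trans[OF F'(6)[unfolded p, unfolded 2, symmetric]], subst F(5)[symmetric], simp add: algebra_simps zeta_mult)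
    then have c1: "u' = \<rho> * (u\<^sup>2 * v)" by simp
    have "6 * v' = \<rho> * 6"
      by (rule trans[OF F'(2)[unfolded p, unfolded 2, symmetric]], subst F(1)[symmetric], simp add: algebra_simps zeta_mult)
    then have c2: "v' = \<rho>" by simp
    from c0 have nz: "u \<noteq> 0" by auto
    have r: "\<rho> = 1 / u" using c0 nz by (simp add: eq_divide_eq)
    have "u' = u * v" "v' = 1 / u"
      unfolding c1 c2 r using nz by (simp_all add: field_simps power2_eq_square)
    with nz show ?thesis by (simp add: z z' rel_def)
  next
    case 3
    have p: "\<eta> ^ 2 = - \<zeta>" "\<eta> ^ 3 = 1" "\<eta> ^ 4 = \<zeta> - 1" "\<eta> ^ 5 = - \<zeta>"
      by (simp_all add: 3 eval_nat_numeral algebra_simps zeta_mult)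
    have "6 = \<rho> * (6 * (u\<^sup>2 * v))"
      by (rule trans[OF F'(1)[unfolded p, unfolded 3, symmetric]], subst F(5)[symmetric], simp add: algebra_simps zeta_mult)
    then have c0: "\<rho> * (u\<^sup>2 * v) = 1" by simp
    have "6 * u' = \<rho> * (6 * (u\<^sup>2 * v\<^sup>2))"
      by (rule trans[OF F'(6)[unfolded p, unfolded 3, symmetric]], subst F(4)[symmetric], simp add: algebra_simps zeta_mult)
    then have c1: "u' = \<rho> * (u\<^sup>2 * v\<^sup>2)" by simp
    have "6 * v' = \<rho> * (6 * u)"
      by (rule trans[OF F'(2)[unfolded p, unfolded 3, symmetric]], subst F(6)[symmetric], simp add: algebra_simps zeta_mult)
    then have c2: "v' = \<rho> * u" by simp
    from c0 have nz: "u \<noteq> 0" "v \<noteq> 0" by auto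
    have r: "\<rho> = 1 / (u\<^sup>2 * v)" using c0 nz by (simp add: eq_divide_eq)
    have "u' = v" "v' = 1 / (u * v)"
      unfolding c1 c2 r using nz by (simp_all add: field_simps power2_eq_square)
    with nz show ?thesis by (simp add: z z' rel_def)
  next
    case 4
    have p: "\<eta> ^ 2 = 1" "\<eta> ^ 3 = - 1" "\<eta> ^ 4 = 1" "\<eta> ^ 5 = - 1"
      by (simp_all add: 4 eval_nat_numeral algebra_simps zeta_mult)
    have "6 = \<rho> * (6 * (u\<^sup>2 * v\<^sup>2))"
      by (rule trans[OF F'(1)[unfolded p, unfolded 4, symmetric]], subst F(4)[symmetric], simp add: algebra_simps zeta_mult)
    then have c0: "\<rho> * (u\<^sup>2 * v\<^sup>2) = 1" by simp
    have "6 * u' = \<rho> * (6 * (u * v\<^sup>2))"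
      by (rule trans[OF F'(6)[unfolded p, unfolded 4, symmetric]], subst F(3)[symmetric], simp add: algebra_simps zeta_mult)
    then have c1: "u' = \<rho> * (u * v\<^sup>2)" by simp
    have "6 * v' = \<rho> * (6 * (u\<^sup>2 * v))"
      by (rule trans[OF F'(2)[unfolded p, unfolded 4, symmetric]], subst F(5)[symmetric], simp add: algebra_simps zeta_mult)
    then have c2: "v' = \<rho> * (u\<^sup>2 * v)" by simp
    from c0 have nz: "u \<noteq> 0" "v \<noteq> 0" by auto
    have r: "\<rho> = 1 / (u\<^sup>2 * v\<^sup>2)" using c0 nz by (simp add: eq_divide_eq)
    have "u' = 1 / u" "v' = 1 / v"
      unfolding c1 c2 r using nz by (simp_all add: field_simps power2_eq_square)
    with nz show ?thesis by (simp add: z z' rel_def)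
  next
    case 5
    have p: "\<eta> ^ 2 = \<zeta> - 1" "\<eta> ^ 3 = 1" "\<eta> ^ 4 = - \<zeta>" "\<eta> ^ 5 = \<zeta> - 1"
      by (simp_all add: 5 eval_nat_numeral algebra_simps zeta_mult)
    have "6 = \<rho> * (6 * (u * v\<^sup>2))"
      by (rule trans[OF F'(1)[unfolded p, unfolded 5, symmetric]], subst F(3)[symmetric], simp add: algebra_simps zeta_mult)
    then have c0: "\<rho> * (u * v\<^sup>2) = 1" by simp
    have "6 * u' = \<rho> * (6 * v)"
      by (rule trans[OF F'(6)[unfolded p, unfolded 5, symmetric]], subst F(2)[symmetric], simp add: algebra_simps zeta_mult)
    then have c1: "u' = \<rho> * v" by simp
    have "6 * v' = \<rho> * (6 * (u\<^sup>2 * v\<^sup>2))"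
      by (rule trans[OF F'(2)[unfolded p, unfolded 5, symmetric]], subst F(4)[symmetric], simp add: algebra_simps zeta_mult)
    then have c2: "v' = \<rho> * (u\<^sup>2 * v\<^sup>2)" by simp
    from c0 have nz: "u \<noteq> 0" "v \<noteq> 0" by auto
    have r: "\<rho> = 1 / (u * v\<^sup>2)" using c0 nz by (simp add: eq_divide_eq)
    have "u' = 1 / (u * v)" "v' = u"
      unfolding c1 c2 r using nz by (simp_all add: field_simps power2_eq_square)
    with nz show ?thesis by (simp add: z z' rel_def)
  next
    case 6
    have p: "\<eta> ^ 2 = - \<zeta>" "\<eta> ^ 3 = - 1" "\<eta> ^ 4 = \<zeta> - 1" "\<eta> ^ 5 = \<zeta>"
      by (simp_all add: 6 eval_nat_numeral algebra_simps zeta_mult)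
    have "6 = \<rho> * (6 * v)"
      by (rule trans[OF F'(1)[unfolded p, unfolded 6, symmetric]], subst F(2)[symmetric], simp add: algebra_simps zeta_mult)
    then have c0: "\<rho> * v = 1" by simp
    have "6 * u' = \<rho> * 6"
      by (rule trans[OF F'(6)[unfolded p, unfolded 6, symmetric]], subst F(1)[symmetric], simp add: algebra_simps zeta_mult)
    then have c1: "u' = \<rho>" by simp
    have "6 * v' = \<rho> * (6 * (u * v\<^sup>2))"
      by (rule trans[OF F'(2)[unfolded p, unfolded 6, symmetric]], subst F(3)[symmetric], simp add: algebra_simps zeta_mult)
    then have c2: "v' = \<rho> * (u * v\<^sup>2)" by simp
    from c0 have nz: "v \<noteq> 0" by auto
    have r: "\<rho> = 1 / v" using c0 nz by (simp add: eq_divide_eq)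
    have "u' = 1 / v" "v' = u * v"
      unfolding c1 c2 r using nz by (simp_all add: field_simps power2_eq_square)
    with nz show ?thesis by (simp add: z z' rel_def)
  qed
qed

end

section \<open>Holomorphic functions of two complex variables\<close>

definition hol2 :: "(c2 \<Rightarrow> complex) \<Rightarrow> c2 \<Rightarrow> bool" where
  "hol2 f z \<longleftrightarrow> (\<exists>a b. (f has_derivative (\<lambda>(h, k). a * h + b * k)) (at z))"

lemma hol2I: "(f has_derivative (\<lambda>h. a * fst h + b * snd h)) (at z) \<Longrightarrow> hol2 f z"
  unfolding hol2_def by (auto simp: case_prod_unfold)

lemma hol2E:
  assumes "hol2 f z"
  obtains a b where "(f has_derivative (\<lambda>h. a * fst h + b * snd h)) (at z)"
  using assms unfolding hol2_def by (auto simp: case_prod_unfold)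

named_theorems hol2

lemma hol2_const [hol2]: "hol2 (\<lambda>z. c) z"
  by (rule hol2I[of _ 0 0]) (auto intro!: derivative_eq_intros)
lemma hol2_fst' [hol2]: "hol2 fst z"
  by (rule hol2I[of _ 1 0]) (auto intro!: derivative_eq_intros)
lemma hol2_snd' [hol2]: "hol2 snd z"
  by (rule hol2I[of _ 0 1]) (auto intro!: derivative_eq_intros)
lemma hol2_fst [hol2]: "hol2 (\<lambda>z. fst z) z" using hol2_fst' .
lemma hol2_snd [hol2]: "hol2 (\<lambda>z. snd z) z" using hol2_snd' .

lemma hol2_add [hol2]:
  assumes "hol2 f z" "hol2 g z" shows "hol2 (\<lambda>z. f z + g z) z"
proof -
  obtain a b where f: "(f has_derivative (\<lambda>h. a * fst h + b * snd h)) (at z)"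
    using assms(1) by (rule hol2E)
  obtain c d where g: "(g has_derivative (\<lambda>h. c * fst h + d * snd h)) (at z)"
    using assms(2) by (rule hol2E)
  show ?thesis
    by (rule hol2I[of _ "a + c" "b + d"], rule has_derivative_eq_rhs[OF has_derivative_add[OF f g]])
      (auto simp: algebra_simps)
qed

lemma hol2_mult [hol2]:
  assumes "hol2 f z" "hol2 g z" shows "hol2 (\<lambda>z. f z * g z) z"
proof -
  obtain a b where f: "(f has_derivative (\<lambda>h. a * fst h + b * snd h)) (at z)"
    using assms(1) by (rule hol2E)
  obtain c d where g: "(g has_derivative (\<lambda>h. c * fst h + d * snd h)) (at z)"
    using assms(2) by (rule hol2E)
  show ?thesis
    by (rule hol2I[of _ "f z * c + a * g z" "f z * d + b * g z"],
        rule has_derivative_eq_rhs[OF has_derivative_mult[OF f g]])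
      (auto simp: algebra_simps)
qed

lemma hol2_compose_field:
  assumes "(F has_field_derivative c) (at (f z))" "hol2 f z"
  shows "hol2 (\<lambda>z. F (f z)) z"
proof -
  obtain a b where f: "(f has_derivative (\<lambda>h. a * fst h + b * snd h)) (at z)"
    using assms(2) by (rule hol2E)
  show ?thesis
    by (rule hol2I[of _ "c * a" "c * b"],
        rule has_derivative_eq_rhs[OF has_derivative_compose[OF f assms(1)[THEN has_field_derivative_imp_has_derivative]]])
      (auto simp: algebra_simps)
qed

lemma hol2_minus [hol2]: "hol2 f z \<Longrightarrow> hol2 (\<lambda>z. - f z) z"
  by (rule hol2_compose_field[of uminus "-1"]) (auto intro!: derivative_eq_intros)
lemma hol2_diff [hol2]: "hol2 f z \<Longrightarrow> hol2 g z \<Longrightarrow> hol2 (\<lambda>z. f z - g z) z"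
  using hol2_add[of f z "\<lambda>z. - g z"] hol2_minus by simp
lemma hol2_power [hol2]: "hol2 f z \<Longrightarrow> hol2 (\<lambda>z. f z ^ n) z"
  by (rule hol2_compose_field[of "\<lambda>x. x ^ n"]) (auto intro!: derivative_eq_intros)
lemma hol2_divide [hol2]: 
  assumes "hol2 f z" "hol2 g z" "g z \<noteq> 0" shows "hol2 (\<lambda>z. f z / g z) z"
proof -
  have "hol2 (\<lambda>z. inverse (g z)) z"
    by (rule hol2_compose_field[of inverse]) (use assms in \<open>auto intro!: derivative_eq_intros\<close>)
  then show ?thesis using hol2_mult[OF assms(1)] by (simp add: divide_inverse)
qed
lemma hol2_exp [hol2]: "hol2 f z \<Longrightarrow> hol2 (\<lambda>z. exp (f z)) z"
  by (rule hol2_compose_field[of exp]) (auto intro!: derivative_eq_intros)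
lemma hol2_Ln [hol2]: "hol2 f z \<Longrightarrow> f z \<notin> \<real>\<^sub>\<le>\<^sub>0 \<Longrightarrow> hol2 (\<lambda>z. Ln (f z)) z"
  by (rule hol2_compose_field[of Ln]) (auto intro!: derivative_eq_intros)

lemma hol2_isCont: "hol2 f z \<Longrightarrow> isCont f z"
  unfolding hol2_def using has_derivative_continuous by blast

lemma hol2_transform:
  assumes "hol2 f z" "open S" "z \<in> S" "\<And>x. x \<in> S \<Longrightarrow> f x = g x"
  shows "hol2 g z"
  using assms has_derivative_transform_within_open unfolding hol2_def by blast

lemma hol2_compose:
  assumes "hol2 f (g1 z, g2 z)" "hol2 g1 z" "hol2 g2 z"
  shows "hol2 (\<lambda>z. f (g1 z, g2 z)) z"
proof -
  obtain a b where f: "(f has_derivative (\<lambda>h. a * fst h + b * snd h)) (at (g1 z, g2 z))"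
    using assms(1) by (rule hol2E)
  obtain c d where g1: "(g1 has_derivative (\<lambda>h. c * fst h + d * snd h)) (at z)"
    using assms(2) by (rule hol2E)
  obtain c' d' where g2: "(g2 has_derivative (\<lambda>h. c' * fst h + d' * snd h)) (at z)"
    using assms(3) by (rule hol2E)
  show ?thesis
    by (rule hol2I[of _ "a * c + b * c'" "a * d + b * d'"],
        rule has_derivative_eq_rhs[OF has_derivative_compose[OF has_derivative_Pair[OF g1 g2] f]])
      (auto simp: algebra_simps)
qed

lemma holo_C2: "holo C2 U g \<longleftrightarrow> (\<forall>z\<in>U. hol2 g z)"
  by (simp add: C2_def hol2_def)
lemma tp_C2: "tp C2 = euclidean" by (simp add: C2_def)

section \<open>Explicit inversion of the quotient map\<close>

context sixth_root
begin

text \<open>Values obtained by solving the quadrics for the ratios s_j/s1 in terms of Y, Z, w: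
  \<open>e6\<close> is 6uv/s1, and \<open>n0\<close>, \<open>n1\<close>, \<open>n5\<close> are the
  inverse Fourier sums 6/s1, 6v/s1, 6u/s1.\<close>

definition e6 :: "complex \<Rightarrow> complex \<Rightarrow> complex \<Rightarrow> complex" where
  "e6 Y Z w = (6 * Y ^ 3 + 2 * Z\<^sup>2 - 10 * Y * Z - 4 * Y\<^sup>2 + 6 * Z) / w ^ 5"
definition n0 :: "complex \<Rightarrow> complex \<Rightarrow> complex \<Rightarrow> complex" where
  "n0 Y Z w = w + e6 Y Z w + 1 + Y / w + Z / w\<^sup>2 + (3 * Z - 2 * Y\<^sup>2) / w ^ 3 + (6 * Z - 4 * Y\<^sup>2 - Y * Z) / w ^ 4"
definition n1 :: "complex \<Rightarrow> complex \<Rightarrow> complex \<Rightarrow> complex" where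
  "n1 Y Z w = w + e6 Y Z w + \<zeta> + (\<zeta> - 1) * (Y / w) - Z / w\<^sup>2 - \<zeta> * ((3 * Z - 2 * Y\<^sup>2) / w ^ 3)
     + (1 - \<zeta>) * ((6 * Z - 4 * Y\<^sup>2 - Y * Z) / w ^ 4)"
definition n5 :: "complex \<Rightarrow> complex \<Rightarrow> complex \<Rightarrow> complex" where
  "n5 Y Z w = w + e6 Y Z w + (1 - \<zeta>) - \<zeta> * (Y / w) - Z / w\<^sup>2 + (\<zeta> - 1) * ((3 * Z - 2 * Y\<^sup>2) / w ^ 3)
     + \<zeta> * ((6 * Z - 4 * Y\<^sup>2 - Y * Z) / w ^ 4)"

lemma n0_root:
  assumes "\<eta> ^ 6 = 1" "w \<noteq> 0"
  shows "n0 Y Z (\<eta> * w) = \<eta> * (w + e6 Y Z w) + 1 + \<eta> ^ 5 * (Y / w) + \<eta> ^ 4 * (Z / w\<^sup>2)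
    + \<eta> ^ 3 * ((3 * Z - 2 * Y\<^sup>2) / w ^ 3) + \<eta>\<^sup>2 * ((6 * Z - 4 * Y\<^sup>2 - Y * Z) / w ^ 4)"
proof -
  have "x / (\<eta> ^ k * y) = \<eta> ^ (6 - k) * (x / y)" if "k \<le> 6" for x y k
  proof -
    have "\<eta> ^ k * \<eta> ^ (6 - k) = 1" using that assms(1) by (simp flip: power_add)
    then have "1 / \<eta> ^ k = \<eta> ^ (6 - k)" by (metis mult_eq_0_iff nonzero_mult_div_cancel_left zero_neq_one)
    then show ?thesis by (metis divide_divide_eq_left times_divide_eq_left mult_1 mult.commute)
  qed
  from this[of 1] this[of 2] this[of 3] this[of 4] this[of 5] show ?thesis
    unfolding n0_def e6_def power_mult_distrib by (simp add: distrib_left)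
qed

text \<open>Summed over the six roots, every term of \<open>n0\<close> cancels except the constant
  one, which contributes 6. Geometrically, some point of each orbit lies in the chart
  \<open>cc\<close>.\<close>

lemma n0_nonzero:
  assumes "w \<noteq> 0"
  obtains \<eta> where "\<eta> ^ 6 = 1" "n0 Y Z (\<eta> * w) \<noteq> 0"
proof (rule ccontr)
  assume t: "\<not> thesis"
  have *: "\<eta> ^ 6 = 1 \<Longrightarrow> n0 Y Z (\<eta> * w) = 0" for \<eta> using that t by blast
  have r: "1 ^ 6 = (1::complex)" "\<zeta> ^ 6 = 1" "(\<zeta> - 1) ^ 6 = 1" "(-1) ^ 6 = (1::complex)" "(- \<zeta>) ^ 6 = 1" "(1 - \<zeta>) ^ 6 = 1"
    by (simp_all add: eval_nat_numeral algebra_simps zeta_mult)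
  define A B C F G where "A = Y / w" "B = Z / w\<^sup>2" "C = (3 * Z - 2 * Y\<^sup>2) / w ^ 3"
    "F = (6 * Z - 4 * Y\<^sup>2 - Y * Z) / w ^ 4" "G = w + e6 Y Z w"
  note root = r[THEN n0_root, OF assms, of Y Z, folded this]
  have "n0 Y Z (1 * w) + n0 Y Z (\<zeta> * w) + n0 Y Z ((\<zeta> - 1) * w) + n0 Y Z ((-1) * w) + n0 Y Z ((- \<zeta>) * w)
    + n0 Y Z ((1 - \<zeta>) * w) = 6"
    unfolding root by (simp add: eval_nat_numeral algebra_simps zeta_mult)
  then show False unfolding r[THEN *] by simp
qed

text \<open>The ratios built from Y, Z, w satisfy the quadrics, so their inverse Fourier transforms
  m0, ..., m5 satisfy the del Pezzo equations with e in the role of uv. Hence they are proportional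
  to the boundary monomials at u = m5/m0, v = m1/m0, and transforming forward again recovers the
  given ratios.\<close>

lemma section_algebra:
  assumes w6: "w ^ 6 = 12 * Y * Z - 8 * Y ^ 3 - 3 * Z\<^sup>2" and w: "w \<noteq> 0" and n0: "n0 Y Z w \<noteq> 0"
  defines "z \<equiv> (n5 Y Z w / n0 Y Z w, n1 Y Z w / n0 Y Z w)"
  shows "s1 z \<noteq> 0 \<and> dd z \<noteq> 0 \<and> R z = (1 - Y, Z + 2 - 3 * Y)"
proof -
  define i where "i = 1 / w"
  have iw: "i * w = 1" using w by (simp add: i_def)
  define e where "e = (6 * Y ^ 3 + 2 * Z\<^sup>2 - 10 * Y * Z - 4 * Y\<^sup>2 + 6 * Z) * i ^ 5 / 6"
  \<comment> \<open>a, b, c, f, g are the candidates for the ratios of s2, s3, s4, s5, s0 to s1, and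
    e is that for uv/s1. The m_k are the candidates for the boundary monomials divided by
    s1.\<close>
  define a where "a = Y * i"
  define b where "b = Z * i\<^sup>2"
  define c where "c = (3 * Z - 2 * Y\<^sup>2) * i ^ 3"
  define f where "f = (6 * Z - 4 * Y\<^sup>2 - Y * Z) * i ^ 4"
  define g where "g = w + 6 * e"
  define m0 where "m0 = (g + 1 + a + b + c + f) / 6"
  define m1 where "m1 = (g + \<zeta> + (\<zeta> - 1) * a - b - \<zeta> * c + (1 - \<zeta>) * f) / 6"
  define m2 where "m2 = (g + (\<zeta> - 1) - \<zeta> * a + b + (\<zeta> - 1) * c - \<zeta> * f) / 6"
  define m3 where "m3 = (g - 1 + a - b + c - f) / 6"
  define m4 where "m4 = (g - \<zeta> + (\<zeta> - 1) * a + b - \<zeta> * c + (\<zeta> - 1) * f) / 6"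
  define m5 where "m5 = (g + (1 - \<zeta>) - \<zeta> * a - b + (\<zeta> - 1) * c + \<zeta> * f) / 6"
  have E: "6 * e = (6 * Y ^ 3 + 2 * Z\<^sup>2 - 10 * Y * Z - 4 * Y\<^sup>2 + 6 * Z) * i ^ 5" by (simp add: e_def)
  have n: "n0 Y Z w = 6 * m0" "n1 Y Z w = 6 * m1" "n5 Y Z w = 6 * m5"
  proof -
    have d: "x / w ^ k = x * i ^ k" "x / w = x * i" for x k by (simp_all add: i_def power_divide)
    show "n0 Y Z w = 6 * m0" "n1 Y Z w = 6 * m1" "n5 Y Z w = 6 * m5"
      unfolding n0_def n1_def n5_def m0_def m1_def m5_def g_def e6_def a_def b_def c_def f_def E d
      by simp_all
  qed
  have m0: "m0 \<noteq> 0" using n0 n by simp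
  have wi: "w = (12 * Y * Z - 8 * Y ^ 3 - 3 * Z\<^sup>2) * i ^ 5"
    using w unfolding w6[symmetric] i_def by (simp add: field_simps eval_nat_numeral)
  have q1: "w = 2 * a * f - b * c" using wi unfolding a_def b_def c_def f_def by algebra
  have qc: "w * c = 3 * b - 2 * a\<^sup>2" unfolding a_def b_def c_def using iw by algebra
  have qf: "w * f = 2 * c - a * b" unfolding a_def b_def c_def f_def using iw by algebra
  have aw: "a * w = Y" "b * w\<^sup>2 = Z" unfolding a_def b_def using iw by algebra+
  have cancel: "x = y" if "w ^ k * x = w ^ k * y" for x y k using that w by simp
  have ew: "w ^ 5 * (6 * e) = 6 * Y ^ 3 + 2 * Z\<^sup>2 - 10 * Y * Z - 4 * Y\<^sup>2 + 6 * Z"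
    unfolding E i_def using w by (simp add: power_divide)
  have cw: "w ^ 3 * c = 3 * Z - 2 * Y\<^sup>2" "w ^ 4 * f = 6 * Z - 4 * Y\<^sup>2 - Y * Z"
    unfolding c_def f_def i_def using w by (simp_all add: power_divide)
  have q0: "w * g = f + a * c - b\<^sup>2"
  proof (rule cancel[of 4])
    have "w ^ 4 * (w * g) = w ^ 6 + w ^ 5 * (6 * e)" by (simp add: g_def algebra_simps eval_nat_numeral)
    also have "\<dots> = w ^ 4 * f + (a * w) * (w ^ 3 * c) - (b * w\<^sup>2)\<^sup>2"
      unfolding w6 ew cw aw by algebra
    also have "\<dots> = w ^ 4 * (f + a * c - b\<^sup>2)" by (simp add: algebra_simps eval_nat_numeral)
    finally show "w ^ 4 * (w * g) = w ^ 4 * (f + a * c - b\<^sup>2)" .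
  qed
  \<comment> \<open>r1 to r5 prepare the equations Q and P below. Each is checked after
    multiplication by a power of w, using the values of w^6, a w, b w^2, c w^3, f w^4 and 6 e
    w^5.\<close>
  have r1: "2 = 3 * w * a + 24 * e * a - b * f"
  proof (rule cancel[of 6])
    have "w ^ 6 * (3 * w * a + 24 * e * a - b * f)
        = 3 * (a * w) * w ^ 6 + 4 * (w ^ 5 * (6 * e)) * (a * w) - (b * w\<^sup>2) * (w ^ 4 * f)"
      by (simp add: algebra_simps eval_nat_numeral)
    also have "\<dots> = w ^ 6 * 2" unfolding w6 ew cw aw by algebra
    finally show "w ^ 6 * 2 = w ^ 6 * (3 * w * a + 24 * e * a - b * f)" by simp
  qed
  have r2: "2 * c\<^sup>2 = - w * a + 3 * b * f"
  proof (rule cancel[of 6])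
    have "w ^ 6 * (2 * c\<^sup>2) = 2 * (w ^ 3 * c)\<^sup>2" by (simp add: algebra_simps eval_nat_numeral)
    also have "\<dots> = - (w ^ 6) * (a * w) + 3 * (b * w\<^sup>2) * (w ^ 4 * f)" unfolding w6 cw aw by algebra
    also have "\<dots> = w ^ 6 * (- w * a + 3 * b * f)" by (simp add: algebra_simps eval_nat_numeral)
    finally show "w ^ 6 * (2 * c\<^sup>2) = w ^ 6 * (- w * a + 3 * b * f)" .
  qed
  have r3: "2 * f\<^sup>2 = 3 * w * c + 24 * e * c - b"
  proof (rule cancel[of 8])
    have "w ^ 8 * (2 * f\<^sup>2) = 2 * (w ^ 4 * f)\<^sup>2" by (simp add: algebra_simps eval_nat_numeral)
    also have "\<dots> = 3 * w ^ 6 * (w ^ 3 * c) + 4 * (w ^ 5 * (6 * e)) * (w ^ 3 * c) - w ^ 6 * (b * w\<^sup>2)"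
      unfolding w6 ew cw aw by algebra
    also have "\<dots> = w ^ 8 * (3 * w * c + 24 * e * c - b)" by (simp add: algebra_simps eval_nat_numeral)
    finally show "w ^ 8 * (2 * f\<^sup>2) = w ^ 8 * (3 * w * c + 24 * e * c - b)" .
  qed
  have r4: "a + c * f = 2 * w * b + 18 * e * b"
  proof (rule cancel[of 7])
    have "w ^ 7 * (a + c * f) = w ^ 6 * (a * w) + (w ^ 3 * c) * (w ^ 4 * f)"
      by (simp add: algebra_simps eval_nat_numeral)
    also have "\<dots> = 2 * w ^ 6 * (b * w\<^sup>2) + 3 * (w ^ 5 * (6 * e)) * (b * w\<^sup>2)"
      unfolding w6 ew cw aw by algebra
    also have "\<dots> = w ^ 7 * (2 * w * b + 18 * e * b)" by (simp add: algebra_simps eval_nat_numeral)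
    finally show "w ^ 7 * (a + c * f) = w ^ 7 * (2 * w * b + 18 * e * b)" .
  qed
  have r5: "g\<^sup>2 - 2 * f + 2 * a * c - b\<^sup>2 = 36 * e\<^sup>2"
  proof (rule cancel[of 4])
    have "w ^ 4 * (g\<^sup>2 - 2 * f + 2 * a * c - b\<^sup>2) = w ^ 6 + 2 * (w ^ 5 * (6 * e)) + w ^ 4 * (36 * e\<^sup>2)
       - 2 * (w ^ 4 * f) + 2 * (a * w) * (w ^ 3 * c) - (b * w\<^sup>2)\<^sup>2"
      by (simp add: g_def algebra_simps eval_nat_numeral)
    also have "\<dots> = w ^ 4 * (36 * e\<^sup>2)" unfolding w6 ew cw aw by algebra
    finally show "w ^ 4 * (g\<^sup>2 - 2 * f + 2 * a * c - b\<^sup>2) = w ^ 4 * (36 * e\<^sup>2)" .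
  qed
  have gw: "w = g - 6 * e" by (simp add: g_def)
  have half: "x = 0" if "2 * x = 0" for x :: complex using that by simp
  \<comment> \<open>Q0 to Q5 are the Fourier components of m_(k-1) m_(k+1) = e m_k, and P0, P2, P4
    those of m_k m_(k+3) = e^2, which have only even frequencies.\<close>
  have Q0: "g\<^sup>2 - f - a * c + b\<^sup>2 - 6 * e * g = 0" using q0 unfolding gw by algebra
  have Q1: "g - 2 * a * f + b * c - 6 * e = 0" using q1 unfolding gw by algebra
  have Q2: "- g * a + 1 - b * f + c\<^sup>2 - 6 * e * a = 0"
    by (rule half) (use r1 r2 in \<open>unfold gw, algebra\<close>)
  have Q3: "- 2 * g * b + a + c * f - 6 * e * b = 0" using r4 unfolding gw by algebra
  have Q4: "- g * c + f\<^sup>2 - b + a\<^sup>2 - 6 * e * c = 0"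
    by (rule half) (use r3 qc in \<open>unfold gw, algebra\<close>)
  have Q5: "g * f - 2 * c + a * b - 6 * e * f = 0" using qf unfolding gw by algebra
  have P0: "g\<^sup>2 - 2 * f + 2 * a * c - b\<^sup>2 - 36 * e\<^sup>2 = 0" using r5 by simp
  have P2: "2 * g * a - 1 - 2 * b * f + c\<^sup>2 = 0"
    by (rule half) (use r1 r2 in \<open>unfold gw, algebra\<close>)
  have P4: "2 * g * c + a\<^sup>2 - 2 * b - f\<^sup>2 = 0"
    by (rule half) (use r3 qc in \<open>unfold gw, algebra\<close>)
  have M6: "6 * m0 = g + 1 + a + b + c + f" "6 * m1 = g + \<zeta> + (\<zeta> - 1) * a - b - \<zeta> * c + (1 - \<zeta>) * f"
    "6 * m2 = g + (\<zeta> - 1) - \<zeta> * a + b + (\<zeta> - 1) * c - \<zeta> * f" "6 * m3 = g - 1 + a - b + c - f"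
    "6 * m4 = g - \<zeta> + (\<zeta> - 1) * a + b - \<zeta> * c + (\<zeta> - 1) * f"
    "6 * m5 = g + (1 - \<zeta>) - \<zeta> * a - b + (\<zeta> - 1) * c + \<zeta> * f"
    by (simp_all add: m0_def m1_def m2_def m3_def m4_def m5_def)
  have sq: "x = y" if "(6 * p) * (6 * q) - 6 * r * (6 * s) = (0::complex)" "x = p * q" "y = r * s" for x y p q r s
    using that by simp
  have H: "m5 * m1 = e * m0" "m0 * m2 = e * m1" "m0 * m4 = e * m5" "m0 * m3 = e * e"
  proof -
    have "(6 * m5) * (6 * m1) - 6 * e * (6 * m0) = (g\<^sup>2 - f - a * c + b\<^sup>2 - 6 * e * g)
      + (g - 2 * a * f + b * c - 6 * e) + (- g * a + 1 - b * f + c\<^sup>2 - 6 * e * a)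
      + (- 2 * g * b + a + c * f - 6 * e * b) + (- g * c + f\<^sup>2 - b + a\<^sup>2 - 6 * e * c)
      + (g * f - 2 * c + a * b - 6 * e * f)"
      unfolding M6 by (simp add: algebra_simps power2_eq_square zeta_mult)
    then have "(6 * m5) * (6 * m1) - 6 * e * (6 * m0) = 0" unfolding Q0 Q1 Q2 Q3 Q4 Q5 by simp
    then show "m5 * m1 = e * m0" by simp
    have "(6 * m0) * (6 * m2) - 6 * e * (6 * m1) = (g\<^sup>2 - f - a * c + b\<^sup>2 - 6 * e * g)
      + \<zeta> * (g - 2 * a * f + b * c - 6 * e) + (\<zeta> - 1) * (- g * a + 1 - b * f + c\<^sup>2 - 6 * e * a)
      - (- 2 * g * b + a + c * f - 6 * e * b) - \<zeta> * (- g * c + f\<^sup>2 - b + a\<^sup>2 - 6 * e * c)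
      + (1 - \<zeta>) * (g * f - 2 * c + a * b - 6 * e * f)"
      unfolding M6 by (simp add: algebra_simps power2_eq_square zeta_mult)
    then have "(6 * m0) * (6 * m2) - 6 * e * (6 * m1) = 0" unfolding Q0 Q1 Q2 Q3 Q4 Q5 by simp
    then show "m0 * m2 = e * m1" by simp
    have "(6 * m0) * (6 * m4) - 6 * e * (6 * m5) = (g\<^sup>2 - f - a * c + b\<^sup>2 - 6 * e * g)
      + (1 - \<zeta>) * (g - 2 * a * f + b * c - 6 * e) - \<zeta> * (- g * a + 1 - b * f + c\<^sup>2 - 6 * e * a)
      - (- 2 * g * b + a + c * f - 6 * e * b) + (\<zeta> - 1) * (- g * c + f\<^sup>2 - b + a\<^sup>2 - 6 * e * c)
      + \<zeta> * (g * f - 2 * c + a * b - 6 * e * f)"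
      unfolding M6 by (simp add: algebra_simps power2_eq_square zeta_mult)
    then have "(6 * m0) * (6 * m4) - 6 * e * (6 * m5) = 0" unfolding Q0 Q1 Q2 Q3 Q4 Q5 by simp
    then show "m0 * m4 = e * m5" by simp
    have "(6 * m0) * (6 * m3) - 36 * (e * e) = (g\<^sup>2 - 2 * f + 2 * a * c - b\<^sup>2 - 36 * e\<^sup>2)
      + (2 * g * a - 1 - 2 * b * f + c\<^sup>2) + (2 * g * c + a\<^sup>2 - 2 * b - f\<^sup>2)"
      unfolding M6 by (simp add: algebra_simps power2_eq_square)
    then have "(6 * m0) * (6 * m3) - 36 * (e * e) = 0" unfolding P0 P2 P4 by simp
    then show "m0 * m3 = e * e" by simp
  qed
  define u where "u = m5 / m0"
  define v where "v = m1 / m0"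
  have z: "z = (u, v)" unfolding z_def n u_def v_def by simp
  define k where "k = 1 / m0"
  have k: "k * m0 = 1" using m0 by (simp add: k_def)
  have uv: "u = m5 * k" "v = m1 * k" by (simp_all add: u_def v_def k_def)
  \<comment> \<open>By the del Pezzo equations in \<open>H\<close>, the products of u and v are the
    quotients e/m0 and m_j/m0, so each \<open>sj\<close> at z is a Fourier sum of the m_j times k =
    1/m0.\<close>
  have M1: "u * v = e * k" unfolding uv using H k by algebra
  have M2: "u * v\<^sup>2 = m2 * k" unfolding uv using H k by algebra
  have M3: "u\<^sup>2 * v\<^sup>2 = m3 * k" unfolding uv using H k by algebra
  have M4: "u\<^sup>2 * v = m4 * k" unfolding uv using H k by algebra
  note M = M1 M2 M3 M4 
  have "s1 z = (m0 * k - m3 * k) + (1 - \<zeta>) * (m1 * k - m4 * k) - \<zeta> * (m2 * k - m5 * k)"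
    unfolding z s1_def s0_def prod.case mult.assoc[of 6 u v] unfolding M unfolding uv by (simp add: k mult.commute[of m0 k])
  then have "6 * s1 z = 6 * ((m0 * k - m3 * k) + (1 - \<zeta>) * (m1 * k - m4 * k) - \<zeta> * (m2 * k - m5 * k))" by (rule arg_cong)
  also have "\<dots> = (6 * m0 * k - 6 * m3 * k) + (1 - \<zeta>) * (6 * m1 * k - 6 * m4 * k) - \<zeta> * (6 * m2 * k - 6 * m5 * k)" by (simp only: algebra_simps)
  also have "\<dots> = 6 * (1 * k)" unfolding M6 by (simp add: algebra_simps zeta_mult)
  finally have S1: "s1 z = 1 * k" by simp
  have "s2 z = (m0 * k + m3 * k) - \<zeta> * (m1 * k + m4 * k) + (\<zeta> - 1) * (m2 * k + m5 * k)"
    unfolding z s2_def s0_def prod.case mult.assoc[of 6 u v] unfolding M unfolding uv by (simp add: k mult.commute[of m0 k])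
  then have "6 * s2 z = 6 * ((m0 * k + m3 * k) - \<zeta> * (m1 * k + m4 * k) + (\<zeta> - 1) * (m2 * k + m5 * k))" by (rule arg_cong)
  also have "\<dots> = (6 * m0 * k + 6 * m3 * k) - \<zeta> * (6 * m1 * k + 6 * m4 * k) + (\<zeta> - 1) * (6 * m2 * k + 6 * m5 * k)" by (simp only: algebra_simps)
  also have "\<dots> = 6 * (a * k)" unfolding M6 by (simp add: algebra_simps zeta_mult)
  finally have S2: "s2 z = a * k" by simp
  have "s3 z = m0 * k - m1 * k + m2 * k - m3 * k + m4 * k - m5 * k"
    unfolding z s3_def s0_def prod.case mult.assoc[of 6 u v] unfolding M unfolding uv by (simp add: k mult.commute[of m0 k])
  then have "6 * s3 z = 6 * (m0 * k - m1 * k + m2 * k - m3 * k + m4 * k - m5 * k)" by (rule arg_cong)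
  also have "\<dots> = 6 * m0 * k - 6 * m1 * k + 6 * m2 * k - 6 * m3 * k + 6 * m4 * k - 6 * m5 * k" by (simp only: algebra_simps)
  also have "\<dots> = 6 * (b * k)" unfolding M6 by (simp add: algebra_simps zeta_mult)
  finally have S3: "s3 z = b * k" by simp
  have "dd z = m0 * k + m1 * k + m2 * k + m3 * k + m4 * k + m5 * k - 6 * (e * k)"
    unfolding z dd_def s0_def prod.case mult.assoc[of 6 u v] unfolding M unfolding uv by (simp add: k mult.commute[of m0 k])
  then have "6 * dd z = 6 * (m0 * k + m1 * k + m2 * k + m3 * k + m4 * k + m5 * k - 6 * (e * k))" by (rule arg_cong)
  also have "\<dots> = 6 * m0 * k + 6 * m1 * k + 6 * m2 * k + 6 * m3 * k + 6 * m4 * k + 6 * m5 * k - 6 * (6 * (e * k))" by (simp only: algebra_simps)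
  also have "\<dots> = 6 * (w * k)" unfolding M6 gw by (simp add: algebra_simps zeta_mult)
  finally have S4: "dd z = w * k" by simp
  have k0: "k \<noteq> 0" using k by auto
  note S = S1 S2 S3 S4
  show ?thesis using k0 w aw unfolding R_def yy_def zz_def S
    by (simp add: power2_eq_square power3_eq_cube power_mult_distrib)
qed

end

section \<open>Morphisms, restrictions and isomorphisms of ringed spaces\<close>

text \<open>The congruence and restriction clauses of \<open>function_sheaf\<close>. They pass from
  a space to any structure coinduced from it, so they are available at once for the plane, the
  blow-up and the quotient.\<close>

definition presheaf :: "'a cspace \<Rightarrow> bool" where
  "presheaf X \<longleftrightarrow>
     (\<forall>U f g. openin (tp X) U \<and> (\<forall>x\<in>U. f x = g x) \<and> holo X U f \<longrightarrow> holo X U g) \<and>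
     (\<forall>U V f. openin (tp X) U \<and> openin (tp X) V \<and> V \<subseteq> U \<and> holo X U f \<longrightarrow> holo X V f)"

lemma presheaf_cong: "presheaf X \<Longrightarrow> holo X U f \<Longrightarrow> openin (tp X) U \<Longrightarrow> (\<And>x. x \<in> U \<Longrightarrow> f x = g x) \<Longrightarrow> holo X U g"
  unfolding presheaf_def by (elim conjE) (erule allE[of _ U], erule allE[of _ f], erule allE[of _ g], simp)
lemma presheaf_sub: "presheaf X \<Longrightarrow> holo X U f \<Longrightarrow> openin (tp X) U \<Longrightarrow> openin (tp X) V \<Longrightarrow> V \<subseteq> U \<Longrightarrow> holo X V f"
  unfolding presheaf_def by (elim conjE) (drule spec[of _ U], drule spec[of _ U], drule spec[of _ V], drule spec[of _ f], simp)

lemma function_sheaf_presheaf: "function_sheaf X \<Longrightarrow> presheaf X"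
  unfolding function_sheaf_def presheaf_def by (elim conjE, intro conjI; assumption)

lemma presheaf_C2: "presheaf C2"
  unfolding presheaf_def holo_C2 tp_C2 open_openin[symmetric]
  by (intro conjI allI impI ballI; elim conjE) (metis hol2_transform, blast)

lemma holo_coinduced: "holo (coinduced X P) U g \<longleftrightarrow> (\<forall>p\<in>P. holo X {x \<in> points X. p x \<in> U} (g \<circ> p))"
  by (simp add: coinduced_def)

lemma presheaf_coinduced:
  assumes "presheaf X"
  shows "presheaf (coinduced X P)"
proof -
  have op: "openin (tp X) {x \<in> points X. p x \<in> U}" if "openin (tp (coinduced X P)) U" "p \<in> P" for U p
    using that unfolding openin_coinduced by blast
  have "holo (coinduced X P) U g"
    if U: "openin (tp (coinduced X P)) U" and fg: "\<And>x. x \<in> U \<Longrightarrow> f x = g x" and f: "holo (coinduced X P) U f" for U f g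
    unfolding holo_coinduced
  proof
    fix p assume p: "p \<in> P"
    then have "holo X {x \<in> points X. p x \<in> U} (f \<circ> p)" using f unfolding holo_coinduced by blast
    then show "holo X {x \<in> points X. p x \<in> U} (g \<circ> p)"
      by (rule presheaf_cong[OF assms _ op[OF U p]]) (simp add: fg)
  qed
  moreover have "holo (coinduced X P) V f"
    if U: "openin (tp (coinduced X P)) U" "openin (tp (coinduced X P)) V" "V \<subseteq> U" and f: "holo (coinduced X P) U f" for U V f
    unfolding holo_coinduced
  proof
    fix p assume p: "p \<in> P"
    then have "holo X {x \<in> points X. p x \<in> U} (f \<circ> p)" using f unfolding holo_coinduced by blast
    then show "holo X {x \<in> points X. p x \<in> V} (f \<circ> p)"
      by (rule presheaf_sub[OF assms _ op[OF U(1) p] op[OF U(2) p]]) (use U(3) in blast)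
  qed
  ultimately show ?thesis unfolding presheaf_def by metis
qed

lemma tp_restrict: "tp (restrict_space X U) = subtopology (tp X) U"
  by (simp add: restrict_space_def)
lemma holo_restrict: "holo (restrict_space X U) = holo X"
  by (simp add: restrict_space_def)

lemma points_restrict: "openin (tp X) U \<Longrightarrow> points (restrict_space X U) = U"
  by (metis Int_absorb1 openin_subset tp_restrict topspace_subtopology)

lemma openin_restrict: "openin (tp X) U \<Longrightarrow> openin (tp (restrict_space X U)) S \<longleftrightarrow> openin (tp X) S \<and> S \<subseteq> U"
  by (simp add: tp_restrict openin_open_subtopology)

lemma restrict_points: "restrict_space X (points X) = X"
  by (cases X) (simp add: restrict_space_def)

lemma restrict_restrict: "V \<subseteq> U \<Longrightarrow> restrict_space (restrict_space X U) V = restrict_space X V"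
  by (simp add: restrict_space_def subtopology_subtopology Int_absorb1)

lemma morphism_restrict:
  assumes "openin (tp X) U" "openin (tp Y) V"
  shows "morphism (restrict_space X U) (restrict_space Y V) f \<longleftrightarrow> f ` U \<subseteq> V \<and>
    (\<forall>S. openin (tp Y) S \<and> S \<subseteq> V \<longrightarrow> openin (tp X) {x \<in> U. f x \<in> S}) \<and>
    (\<forall>S g. openin (tp Y) S \<and> S \<subseteq> V \<and> holo Y S g \<longrightarrow> holo X {x \<in> U. f x \<in> S} (g \<circ> f))"
  unfolding morphism_def continuous_map_def points_restrict[OF assms(1)] points_restrict[OF assms(2)]
    openin_restrict[OF assms(1)] openin_restrict[OF assms(2)] holo_restrict by blast

lemma morphismD:
  assumes "morphism (restrict_space X U) (restrict_space Y V) f" "openin (tp X) U" "openin (tp Y) V"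
  shows "\<And>x. x \<in> U \<Longrightarrow> f x \<in> V"
    "\<And>S. openin (tp Y) S \<Longrightarrow> S \<subseteq> V \<Longrightarrow> openin (tp X) {x \<in> U. f x \<in> S}"
    "\<And>S g. openin (tp Y) S \<Longrightarrow> S \<subseteq> V \<Longrightarrow> holo Y S g \<Longrightarrow> holo X {x \<in> U. f x \<in> S} (g \<circ> f)"
  using assms(1) unfolding morphism_restrict[OF assms(2,3)] by (simp_all add: image_subset_iff)

lemma morphism_compose:
  assumes "morphism X Y f" "morphism Y Z g"
  shows "morphism X Z (g \<circ> f)"
  unfolding morphism_def
proof (intro conjI allI impI)
  show "continuous_map (tp X) (tp Z) (g \<circ> f)"
    using assms[unfolded morphism_def, THEN conjunct1] by (rule continuous_map_compose)
next
  fix V h assume V: "openin (tp Z) V \<and> holo Z V h"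
  have cf: "continuous_map (tp X) (tp Y) f" using assms(1) by (simp add: morphism_def)
  have fp: "f x \<in> points Y" if "x \<in> points X" for x
    using continuous_map_image_subset_topspace[OF cf] that by (simp add: image_subset_iff)
  have g: "continuous_map (tp Y) (tp Z) g" using assms(2) by (simp add: morphism_def)
  have op: "openin (tp Y) {y \<in> points Y. g y \<in> V}"
    by (rule openin_continuous_map_preimage[OF g]) (use V in simp)
  have ho: "holo Y {y \<in> points Y. g y \<in> V} (h \<circ> g)"
    using assms(2)[unfolded morphism_def, THEN conjunct2, rule_format, OF V] .
  have "holo X {x \<in> points X. f x \<in> {y \<in> points Y. g y \<in> V}} ((h \<circ> g) \<circ> f)"
    using assms(1)[unfolded morphism_def, THEN conjunct2, rule_format, OF conjI[OF op ho]] .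
  moreover have "{x \<in> points X. f x \<in> {y \<in> points Y. g y \<in> V}} = {x \<in> points X. (g \<circ> f) x \<in> V}"
    using fp by auto
  ultimately show "holo X {x \<in> points X. (g \<circ> f) x \<in> V} (h \<circ> (g \<circ> f))"
    by (simp add: comp_assoc)
qed

lemma morphism_cong:
  assumes "morphism (restrict_space X U) (restrict_space Y V) f" "openin (tp X) U" "openin (tp Y) V"
    "presheaf X" "\<And>x. x \<in> U \<Longrightarrow> f x = g x"
  shows "morphism (restrict_space X U) (restrict_space Y V) g"
  unfolding morphism_restrict[OF assms(2,3)]
proof (intro conjI allI impI)
  show "g ` U \<subseteq> V"
  proof (intro image_subsetI)
    fix x assume x: "x \<in> U"
    show "g x \<in> V" using morphismD(1)[OF assms(1-3) x] assms(5)[OF x] by simp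
  qed
next
  fix S
  have e: "{x \<in> U. g x \<in> S} = {x \<in> U. f x \<in> S}" using assms(5) by auto
  assume S: "openin (tp Y) S \<and> S \<subseteq> V"
  show "openin (tp X) {x \<in> U. g x \<in> S}"
    unfolding e by (rule morphismD(2)[OF assms(1-3) conjunct1[OF S] conjunct2[OF S]])
next
  fix S h assume S: "openin (tp Y) S \<and> S \<subseteq> V \<and> holo Y S h"
  have e: "{x \<in> U. g x \<in> S} = {x \<in> U. f x \<in> S}" using assms(5) by auto
  have S': "openin (tp Y) S" "S \<subseteq> V" "holo Y S h" using S by simp_all
  show "holo X {x \<in> U. g x \<in> S} (h \<circ> g)"
    unfolding e
    by (rule presheaf_cong[OF assms(4) morphismD(3)[OF assms(1-3) S'] morphismD(2)[OF assms(1-3) S'(1,2)]])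
      (simp add: assms(5))
qed

lemma morphism_sub:
  assumes "morphism (restrict_space X U) (restrict_space Y V) f" "openin (tp X) U" "openin (tp Y) V"
    "presheaf X" "openin (tp X) U'" "U' \<subseteq> U" "openin (tp Y) V'" "V' \<subseteq> V" "f ` U' \<subseteq> V'"
  shows "morphism (restrict_space X U') (restrict_space Y V') f"
  unfolding morphism_restrict[OF assms(5,7)]
proof (intro conjI allI impI)
  show "f ` U' \<subseteq> V'" by fact
next
  fix S
  have e: "{x \<in> U'. f x \<in> S} = U' \<inter> {x \<in> U. f x \<in> S}" using assms(6) by auto
  assume S: "openin (tp Y) S \<and> S \<subseteq> V'"
  then have S': "openin (tp Y) S" "S \<subseteq> V" using assms(8) by auto
  show "openin (tp X) {x \<in> U'. f x \<in> S}"
    unfolding e by (rule openin_Int[OF assms(5) morphismD(2)[OF assms(1-3) S']])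
next
  fix S h assume S: "openin (tp Y) S \<and> S \<subseteq> V' \<and> holo Y S h"
  have e: "{x \<in> U'. f x \<in> S} = U' \<inter> {x \<in> U. f x \<in> S}" using assms(6) by auto
  from S have S': "openin (tp Y) S" "S \<subseteq> V" "holo Y S h" using assms(8) by auto
  note op = morphismD(2)[OF assms(1-3) S'(1,2)]
  show "holo X {x \<in> U'. f x \<in> S} (h \<circ> f)"
    unfolding e
    by (rule presheaf_sub[OF assms(4) morphismD(3)[OF assms(1-3) S'] op openin_Int[OF assms(5) op]]) simp
qed

lemma isomorphismI:
  assumes op: "openin (tp X) U" "openin (tp Y) V" and "presheaf Y"
    and f: "morphism (restrict_space X U) (restrict_space Y V) f"
    and g: "morphism (restrict_space Y V) (restrict_space X U) g"
    and gf: "\<And>x. x \<in> U \<Longrightarrow> g (f x) = x" and fg: "\<And>y. y \<in> V \<Longrightarrow> f (g y) = y"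
  shows "isomorphism (restrict_space X U) (restrict_space Y V) f"
proof -
  have fU: "f x \<in> V" if "x \<in> U" for x using morphismD(1)[OF f op that] .
  have gV: "g y \<in> U" if "y \<in> V" for y using morphismD(1)[OF g op(2,1) that] .
  have b: "bij_betw f U V"
    by (rule bij_betw_byWitness[of _ g]) (use gf fg fU gV in auto)
  have "inv_into U f y = g y" if "y \<in> V" for y
    using b gV fg that by (metis bij_betw_imp_inj_on inv_into_f_eq)
  then have "morphism (restrict_space Y V) (restrict_space X U) (inv_into U f)"
    using morphism_cong[OF g op(2,1) assms(3)] by metis
  then show ?thesis
    unfolding isomorphism_def points_restrict[OF op(1)] points_restrict[OF op(2)] using b f by blast
qed

lemma isomorphismE:
  assumes "isomorphism (restrict_space X U) (restrict_space Y V) f" "openin (tp X) U" "openin (tp Y) V"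
  obtains g where "morphism (restrict_space X U) (restrict_space Y V) f"
    "morphism (restrict_space Y V) (restrict_space X U) g"
    "\<And>x. x \<in> U \<Longrightarrow> f x \<in> V" "\<And>y. y \<in> V \<Longrightarrow> g y \<in> U"
    "\<And>x. x \<in> U \<Longrightarrow> g (f x) = x" "\<And>y. y \<in> V \<Longrightarrow> f (g y) = y" "g = inv_into U f"
proof
  have b: "bij_betw f U V" and f: "morphism (restrict_space X U) (restrict_space Y V) f"
    and g: "morphism (restrict_space Y V) (restrict_space X U) (inv_into U f)"
    using assms(1) unfolding isomorphism_def points_restrict[OF assms(2)] points_restrict[OF assms(3)]
    by blast+
  show "morphism (restrict_space X U) (restrict_space Y V) f" by fact
  show "morphism (restrict_space Y V) (restrict_space X U) (inv_into U f)" by fact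
  show "f x \<in> V" if "x \<in> U" for x using b that by (auto simp: bij_betw_def)
  show "inv_into U f y \<in> U" if "y \<in> V" for y using b that by (auto simp: bij_betw_def inv_into_into)
  show "inv_into U f (f x) = x" if "x \<in> U" for x using b that by (auto simp: bij_betw_def)
  show "f (inv_into U f y) = y" if "y \<in> V" for y using b that by (auto simp: bij_betw_def f_inv_into_f)
qed simp

lemma isomorphism_open_image:
  assumes "isomorphism (restrict_space X U) (restrict_space Y V) f" "openin (tp X) U" "openin (tp Y) V"
    "openin (tp X) S" "S \<subseteq> U"
  shows "openin (tp Y) (f ` S)"
proof -
  obtain g where g: "morphism (restrict_space Y V) (restrict_space X U) g"
    "\<And>x. x \<in> U \<Longrightarrow> f x \<in> V" "\<And>x. x \<in> U \<Longrightarrow> g (f x) = x" "\<And>y. y \<in> V \<Longrightarrow> f (g y) = y"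
    using isomorphismE[OF assms(1-3)] by metis
  have "f ` S = {y \<in> V. g y \<in> S}" using g assms(5) by force
  then show ?thesis using morphismD(2)[OF g(1) assms(3,2,4,5)] by simp
qed

lemma isomorphism_sub:
  assumes "isomorphism (restrict_space X U) (restrict_space Y V) f" "openin (tp X) U" "openin (tp Y) V"
    "presheaf X" "presheaf Y" "openin (tp Y) V'" "V' \<subseteq> V"
  shows "openin (tp X) {x \<in> U. f x \<in> V'}"
    "isomorphism (restrict_space X {x \<in> U. f x \<in> V'}) (restrict_space Y V') f"
proof -
  obtain g where g: "morphism (restrict_space X U) (restrict_space Y V) f"
    "morphism (restrict_space Y V) (restrict_space X U) g"
    "\<And>x. x \<in> U \<Longrightarrow> f x \<in> V" "\<And>y. y \<in> V \<Longrightarrow> g y \<in> U" "\<And>x. x \<in> U \<Longrightarrow> g (f x) = x" "\<And>y. y \<in> V \<Longrightarrow> f (g y) = y"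
    using isomorphismE[OF assms(1-3)] by metis
  show op: "openin (tp X) {x \<in> U. f x \<in> V'}" by (rule morphismD(2)[OF g(1) assms(2,3,6,7)])
  show "isomorphism (restrict_space X {x \<in> U. f x \<in> V'}) (restrict_space Y V') f"
    by (rule isomorphismI[OF op assms(6,5) morphism_sub[OF g(1) assms(2,3,4) op _ assms(6)]
          morphism_sub[OF g(2) assms(3,2,5,6,7) op]])
      (use g assms(7) in auto)
qed

lemma isomorphism_compose:
  assumes "isomorphism (restrict_space X U) (restrict_space Y V) f" "isomorphism (restrict_space Y V) (restrict_space Z W) g"
    "openin (tp X) U" "openin (tp Y) V" "openin (tp Z) W" "presheaf Z"
  shows "isomorphism (restrict_space X U) (restrict_space Z W) (g \<circ> f)"
proof -
  obtain f' where f: "morphism (restrict_space X U) (restrict_space Y V) f"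
    "morphism (restrict_space Y V) (restrict_space X U) f'"
    "\<And>x. x \<in> U \<Longrightarrow> f x \<in> V" "\<And>y. y \<in> V \<Longrightarrow> f' y \<in> U" "\<And>x. x \<in> U \<Longrightarrow> f' (f x) = x" "\<And>y. y \<in> V \<Longrightarrow> f (f' y) = y"
    using isomorphismE[OF assms(1,3,4)] by metis
  obtain g' where g: "morphism (restrict_space Y V) (restrict_space Z W) g"
    "morphism (restrict_space Z W) (restrict_space Y V) g'"
    "\<And>x. x \<in> V \<Longrightarrow> g x \<in> W" "\<And>y. y \<in> W \<Longrightarrow> g' y \<in> V" "\<And>x. x \<in> V \<Longrightarrow> g' (g x) = x" "\<And>y. y \<in> W \<Longrightarrow> g (g' y) = y"
    using isomorphismE[OF assms(2,4,5)] by metis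
  show ?thesis
    by (rule isomorphismI[OF assms(3,5,6) morphism_compose[OF f(1) g(1)] morphism_compose[OF g(2) f(2)]])
      (use f g in auto)
qed

lemma isomorphism_inverse:
  assumes "isomorphism (restrict_space X U) (restrict_space Y V) f" "openin (tp X) U" "openin (tp Y) V" "presheaf X"
    "\<And>x. x \<in> U \<Longrightarrow> g (f x) = x" "presheaf Y"
  shows "isomorphism (restrict_space Y V) (restrict_space X U) g"
proof -
  obtain f' where f: "morphism (restrict_space X U) (restrict_space Y V) f"
    "morphism (restrict_space Y V) (restrict_space X U) f'"
    "\<And>x. x \<in> U \<Longrightarrow> f x \<in> V" "\<And>y. y \<in> V \<Longrightarrow> f' y \<in> U" "\<And>x. x \<in> U \<Longrightarrow> f' (f x) = x" "\<And>y. y \<in> V \<Longrightarrow> f (f' y) = y"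
    using isomorphismE[OF assms(1-3)] by metis
  have "morphism (restrict_space Y V) (restrict_space X U) g"
    by (rule morphism_cong[OF f(2) assms(3,2,6)]) (metis f(4,6) assms(5))
  then show ?thesis
    by (rule isomorphismI[OF assms(3,2,4) _ f(1)]) (metis f(4,6) assms(5), use assms(5) in blast)
qed

lemma morphism_to_C2:
  assumes "openin (tp X) U" "open W"
    "morphism (restrict_space X U) (restrict_space C2 W) f"
  shows "holo X U (fst \<circ> f)" "holo X U (snd \<circ> f)"
proof -
  have W: "openin (tp C2) W" using assms(2) by (simp add: tp_C2)
  have "{x \<in> U. f x \<in> W} = U" using morphismD(1)[OF assms(3,1) W] by auto
  moreover have "holo C2 W fst" "holo C2 W snd" by (simp_all add: holo_C2 hol2_fst' hol2_snd')
  ultimately show "holo X U (fst \<circ> f)" "holo X U (snd \<circ> f)"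
    using morphismD(3)[OF assms(3,1) W W order_refl] by metis+
qed

text \<open>The Hartogs problem does not arise: \<open>hol2\<close> is complex differentiability in
  both variables together, so composition is the chain rule and continuity is automatic.\<close>

lemma morphism_C2_C2:
  assumes "open U" "open W"
  shows "morphism (restrict_space C2 U) (restrict_space C2 W) f \<longleftrightarrow>
    f ` U \<subseteq> W \<and> (\<forall>z\<in>U. hol2 (fst \<circ> f) z \<and> hol2 (snd \<circ> f) z)"
proof
  assume "morphism (restrict_space C2 U) (restrict_space C2 W) f"
  then show "f ` U \<subseteq> W \<and> (\<forall>z\<in>U. hol2 (fst \<circ> f) z \<and> hol2 (snd \<circ> f) z)"
    using morphism_to_C2[of C2 U W f] morphismD(1)[of C2 U C2 W f] assms
    by (auto simp: tp_C2 holo_C2)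
next
  assume *: "f ` U \<subseteq> W \<and> (\<forall>z\<in>U. hol2 (fst \<circ> f) z \<and> hol2 (snd \<circ> f) z)"
  have "continuous_on U (\<lambda>z. ((fst \<circ> f) z, (snd \<circ> f) z))"
    by (intro continuous_on_Pair continuous_at_imp_continuous_on ballI hol2_isCont) (use * in \<open>simp_all add: comp_def\<close>)
  then have c: "continuous_on U f" by simp
  have comp: "hol2 (g \<circ> f) z" if "hol2 g (f z)" "z \<in> U" for g z
    using hol2_compose[of g "fst \<circ> f" z "snd \<circ> f"] * that by (simp add: comp_def)
  have op: "open {z \<in> U. f z \<in> S}" if "open S" for S
    using continuous_open_preimage[OF c assms(1) that] by (metis (no_types, lifting) Collect_cong Int_def vimage_eq)
  have UW: "openin (tp C2) U" "openin (tp C2) W" using assms by (simp_all add: tp_C2)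
  show "morphism (restrict_space C2 U) (restrict_space C2 W) f"
    unfolding morphism_restrict[OF UW] tp_C2 open_openin[symmetric] holo_C2
  proof (intro conjI allI impI ballI)
    show "f ` U \<subseteq> W" using * by (rule conjunct1)
  next
    fix S assume "open S \<and> S \<subseteq> W"
    then show "open {z \<in> U. f z \<in> S}" by (elim conjE) (rule op)
  next
    fix S :: "c2 set" and g z assume "open S \<and> S \<subseteq> W \<and> Ball S (hol2 g)" "z \<in> {z \<in> U. f z \<in> S}"
    then show "hol2 (g \<circ> f) z" by (intro comp; simp)
  qed
qed

lemma hol2_continuous_on: "(\<And>z. z \<in> S \<Longrightarrow> hol2 f z) \<Longrightarrow> continuous_on S f"
  by (intro continuous_at_imp_continuous_on ballI hol2_isCont)

lemma open_preimage_pair: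
  assumes "open U" "\<And>z. z \<in> U \<Longrightarrow> hol2 (\<lambda>z. fst (f z)) z" "\<And>z. z \<in> U \<Longrightarrow> hol2 (\<lambda>z. snd (f z)) z" "open S"
  shows "open {z \<in> U. f z \<in> S}"
proof -
  have "continuous_on U (\<lambda>z. (fst (f z), snd (f z)))"
    by (intro continuous_on_Pair hol2_continuous_on assms)
  then have "continuous_on U f" by simp
  from continuous_open_preimage[OF this assms(1,4)] show ?thesis
    by (simp add: vimage_def Int_def)
qed

lemma open_hol2_neq:
  assumes "open U" "\<And>z. z \<in> U \<Longrightarrow> hol2 f z" shows "open {z \<in> U. f z \<noteq> 0}"
proof -
  have "open {z \<in> U. (f z, 0::complex) \<in> (- {0}) \<times> UNIV}"
    by (rule open_preimage_pair) (simp_all add: assms hol2_const open_Times open_Compl)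
  then show ?thesis by simp
qed

section \<open>Local sections of the quotient map, and the foliation identity\<close>

context sixth_root
begin

lemma hol2_s0 [hol2]: "hol2 s0 z" unfolding s_defs case_prod_unfold fst_conv snd_conv by (rule hol2)+
lemma hol2_s1 [hol2]: "hol2 s1 z" unfolding s_defs case_prod_unfold fst_conv snd_conv by (rule hol2)+
lemma hol2_s2 [hol2]: "hol2 s2 z" unfolding s_defs case_prod_unfold fst_conv snd_conv by (rule hol2)+
lemma hol2_s3 [hol2]: "hol2 s3 z" unfolding s_defs case_prod_unfold fst_conv snd_conv by (rule hol2)+
lemma hol2_s4 [hol2]: "hol2 s4 z" unfolding s_defs case_prod_unfold fst_conv snd_conv by (rule hol2)+
lemma hol2_s5 [hol2]: "hol2 s5 z" unfolding s_defs case_prod_unfold fst_conv snd_conv by (rule hol2)+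
lemma hol2_dd [hol2]: "hol2 dd z" unfolding s_defs case_prod_unfold fst_conv snd_conv by (rule hol2)+

lemma hol2_R [hol2]: assumes "s1 z \<noteq> 0" shows "hol2 (\<lambda>z. fst (R z)) z" "hol2 (\<lambda>z. snd (R z)) z"
  unfolding R_def yy_def zz_def fst_conv snd_conv by (intro hol2; simp add: assms)+

text \<open>Off \<open>cubic2\<close> a branch of its sixth root exists locally; inserted into
  \<open>section_algebra\<close> it gives a holomorphic section.\<close>

lemma local_section:
  assumes "cubic2 (1, b0) \<noteq> 0"
  obtains W \<phi> where "open W" "b0 \<in> W" "\<And>b. b \<in> W \<Longrightarrow> s1 (\<phi> b) \<noteq> 0 \<and> dd (\<phi> b) \<noteq> 0 \<and> R (\<phi> b) = b"
    "\<And>b. b \<in> W \<Longrightarrow> hol2 (\<lambda>b. fst (\<phi> b)) b" "\<And>b. b \<in> W \<Longrightarrow> hol2 (\<lambda>b. snd (\<phi> b)) b"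
proof -
  define K where "K b = cubic2 (1, b)" for b
  define Y where "Y b = 1 - fst b" for b :: c2
  define Z where "Z b = snd b + 1 - 3 * fst b" for b :: c2
  have b: "b = (1 - Y b, Z b + 2 - 3 * Y b)" for b by (simp add: Y_def Z_def)
  have K: "K b = 12 * Y b * Z b - 8 * Y b ^ 3 - 3 * (Z b)\<^sup>2" for b
    unfolding K_def using cubic2_YZ[of "Y b" "Z b"] b by metis
  have hY: "hol2 Y b" and hZ: "hol2 Z b" for b
    unfolding Y_def Z_def by (intro hol2)+
  have hK: "hol2 K b" for b unfolding K by (intro hol2 hY hZ)
  have K0: "K b0 \<noteq> 0" using assms by (simp add: K_def)
  define w1 where "w1 = exp (Ln (K b0) / 6)"
  have "w1 ^ 6 = exp (Ln (K b0))" unfolding w1_def exp_of_nat_mult[symmetric] by simp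
  then have w1: "w1 ^ 6 = K b0" using K0 by simp
  have "w1 \<noteq> 0" by (simp add: w1_def)
  from n0_nonzero[OF this] obtain \<eta> where eta: "\<eta> ^ 6 = 1" "n0 (Y b0) (Z b0) (\<eta> * w1) \<noteq> 0" by metis
  \<comment> \<open>The branch with value \<eta> w1 at b0: the quotient K b / K b0 is 1 at b0, so
    the principal logarithm is holomorphic nearby. The root \<eta> was chosen to make
    \<open>n0\<close> non-zero at b0.\<close>
  define w where "w b = \<eta> * w1 * exp (Ln (K b / K b0) / 6)" for b
  define W1 where "W1 = {b \<in> UNIV. (K b / K b0, 0::complex) \<in> (- \<real>\<^sub>\<le>\<^sub>0) \<times> UNIV}"
  have W1: "open W1" unfolding W1_def
    by (rule open_preimage_pair)
      (auto intro!: hol2 hK open_Times open_Compl closed_nonpos_Reals_complex simp: K0)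
  have eta0: "\<eta> \<noteq> 0" using eta by auto
  have w0: "w b \<noteq> 0" for b using eta0 by (simp add: w_def w1_def)
  have w6: "w b ^ 6 = K b" if "b \<in> W1" for b
  proof -
    have "K b / K b0 \<noteq> 0" using that by (auto simp: W1_def)
    then have "exp (Ln (K b / K b0) / 6) ^ 6 = K b / K b0" unfolding exp_of_nat_mult[symmetric] by simp
    then show ?thesis using K0 by (simp add: w_def power_mult_distrib eta w1)
  qed
  have hw: "hol2 w b" if "b \<in> W1" for b
    unfolding w_def by (intro hol2 hK) (use that K0 in \<open>auto simp: W1_def\<close>)
  have hn: "hol2 (\<lambda>b. n0 (Y b) (Z b) (w b)) b" "hol2 (\<lambda>b. n1 (Y b) (Z b) (w b)) b"
    "hol2 (\<lambda>b. n5 (Y b) (Z b) (w b)) b" if "b \<in> W1" for b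
    unfolding n0_def n1_def n5_def e6_def by (intro hol2 hY hZ hw[OF that]; use w0 in simp)+
  define W where "W = {b \<in> W1. n0 (Y b) (Z b) (w b) \<noteq> 0}"
  define \<phi> where "\<phi> b = (n5 (Y b) (Z b) (w b) / n0 (Y b) (Z b) (w b), n1 (Y b) (Z b) (w b) / n0 (Y b) (Z b) (w b))" for b
  show thesis
  proof (rule that)
    show "open W" unfolding W_def by (rule open_hol2_neq[OF W1 hn(1)])
    have "b0 \<in> W1" using K0 by (simp add: W1_def)
    moreover have "w b0 = \<eta> * w1" using K0 by (simp add: w_def)
    ultimately show "b0 \<in> W" using eta by (simp add: W_def)
  next
    fix b assume "b \<in> W"
    then have b1: "b \<in> W1" "n0 (Y b) (Z b) (w b) \<noteq> 0" by (simp_all add: W_def)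
    show "s1 (\<phi> b) \<noteq> 0 \<and> dd (\<phi> b) \<noteq> 0 \<and> R (\<phi> b) = b"
      unfolding \<phi>_def using section_algebra[OF w6[OF b1(1), unfolded K] w0 b1(2)] b[of b] by simp
    show "hol2 (\<lambda>b. fst (\<phi> b)) b" "hol2 (\<lambda>b. snd (\<phi> b)) b"
      unfolding \<phi>_def fst_conv snd_conv by (intro hol2 hn b1)+
  qed
qed

text \<open>In the chart \<open>cc\<close> the form \<open>E3\<close>, for \<omega> = \<zeta> - 1,
  is proportional to \<zeta> du/u + (\<zeta> - 1) dv/v, whose kernel is spanned by (\<zeta> - 1) u
  d/du - \<zeta> v d/dv. The conclusion says that the pull-back of \<open>H6\<close> by
  \<open>R\<close> kills this vector field. It holds because the field shifts the index of the
  Fourier eigenvectors.\<close>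

lemma foliation_identity:
  assumes nz: "s1 (u, v) \<noteq> 0" "dd (u, v) \<noteq> 0"
    and d1: "((\<lambda>z. fst (R z)) has_derivative (\<lambda>h. a * fst h + b * snd h)) (at (u, v))"
    and d2: "((\<lambda>z. snd (R z)) has_derivative (\<lambda>h. c * fst h + d * snd h)) (at (u, v))"
    and B: "H6 (1, R (u, v)) = (A, B, C)"
  shows "(B * a + C * c) * (\<zeta> - 1) * u = (B * b + C * d) * \<zeta> * v"
proof -
  \<comment> \<open>The integral curve of the vector field through (u, v). On it the monomial m_k
    grows with exponent \<zeta>^(-k) - 1, so s_j has derivative s_(j+1) - s_j.\<close>
  define \<gamma> where "\<gamma> t = (u * exp ((\<zeta> - 1) * t), v * exp (- \<zeta> * t))" for t
  have g0: "\<gamma> 0 = (u, v)" by (simp add: \<gamma>_def)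
  have s: "((\<lambda>t. s1 (\<gamma> t)) has_field_derivative (s2 (u, v) - s1 (u, v))) (at 0)"
    "((\<lambda>t. s2 (\<gamma> t)) has_field_derivative (s3 (u, v) - s2 (u, v))) (at 0)"
    "((\<lambda>t. s3 (\<gamma> t)) has_field_derivative (s4 (u, v) - s3 (u, v))) (at 0)"
    "((\<lambda>t. dd (\<gamma> t)) has_field_derivative (s1 (u, v) - dd (u, v))) (at 0)"
    unfolding s_defs \<gamma>_def prod.case
    by (auto intro!: derivative_eq_intros simp: algebra_simps power2_eq_square zeta_mult)
  have y: "((\<lambda>t. yy (\<gamma> t)) has_field_derivative
      ((s3 (u, v) * dd (u, v) + s2 (u, v) * s1 (u, v)) / (s1 (u, v))\<^sup>2 - 2 * (s2 (u, v))\<^sup>2 * dd (u, v) / (s1 (u, v)) ^ 3)) (at 0)"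
    unfolding yy_def using nz
    by (auto intro!: derivative_eq_intros s simp: g0) (simp add: field_simps eval_nat_numeral)
  have z: "((\<lambda>t. zz (\<gamma> t)) has_field_derivative
      ((s4 (u, v) * (dd (u, v))\<^sup>2 + 2 * s3 (u, v) * dd (u, v) * s1 (u, v)) / (s1 (u, v)) ^ 3
        - 3 * s3 (u, v) * (dd (u, v))\<^sup>2 * s2 (u, v) / (s1 (u, v)) ^ 4)) (at 0)"
    unfolding zz_def using nz
    by (auto intro!: derivative_eq_intros s simp: g0) (simp add: field_simps eval_nat_numeral)
  have dg: "(\<gamma> has_derivative (\<lambda>h. ((\<zeta> - 1) * u * h, - \<zeta> * v * h))) (at 0)"
  proof -
    have "((\<lambda>t. u * exp ((\<zeta> - 1) * t)) has_field_derivative (\<zeta> - 1) * u) (at 0)"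
      "((\<lambda>t. v * exp (- \<zeta> * t)) has_field_derivative - \<zeta> * v) (at 0)"
      by (auto intro!: derivative_eq_intros)
    then show ?thesis
      unfolding \<gamma>_def has_field_derivative_def by (rule has_derivative_Pair)
  qed
  have 1: "((\<lambda>t. fst (R (\<gamma> t))) has_field_derivative (a * ((\<zeta> - 1) * u) - b * (\<zeta> * v))) (at 0)"
    unfolding has_field_derivative_def
    by (rule has_derivative_eq_rhs[OF has_derivative_compose[OF dg d1[folded g0]]]) (auto simp: algebra_simps)
  have 2: "((\<lambda>t. snd (R (\<gamma> t))) has_field_derivative (c * ((\<zeta> - 1) * u) - d * (\<zeta> * v))) (at 0)"
    unfolding has_field_derivative_def
    by (rule has_derivative_eq_rhs[OF has_derivative_compose[OF dg d2[folded g0]]]) (auto simp: algebra_simps)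
  define w where "w = dd (u, v) / s1 (u, v)"
  obtain p q r where pqr: "s2 (u, v) = p * s1 (u, v)" "s3 (u, v) = q * s1 (u, v)" "s4 (u, v) = r * s1 (u, v)"
    using nz by (metis nonzero_divide_eq_eq)
  have dw: "dd (u, v) = w * s1 (u, v)" using nz by (simp add: w_def)
  have "s1 (u, v) * (s1 (u, v) * (w * r)) = s1 (u, v) * (s1 (u, v) * (3 * q - 2 * p\<^sup>2))"
    using quadrics(2)[of "(u, v)"] unfolding pqr dw by algebra
  then have r: "w * r = 3 * q - 2 * p\<^sup>2" using nz by (simp_all only: mult_cancel_left) simp_all
  have 3: "((\<lambda>t. fst (R (\<gamma> t))) has_field_derivative - (q * w + p - 2 * p\<^sup>2 * w)) (at 0)"
    unfolding R_def fst_conv using nz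
    by (auto intro!: derivative_eq_intros y simp: pqr dw) (simp add: field_simps eval_nat_numeral)
  have 4: "((\<lambda>t. snd (R (\<gamma> t))) has_field_derivative
      (r * w\<^sup>2 + 2 * q * w - 3 * q * w\<^sup>2 * p) - 3 * (q * w + p - 2 * p\<^sup>2 * w)) (at 0)"
    unfolding R_def snd_conv using nz
    by (auto intro!: derivative_eq_intros y z simp: pqr dw) (simp add: field_simps eval_nat_numeral)
  \<comment> \<open>Two evaluations of the derivative along the integral curve: by the chain rule,
    and from the shift of the eigenvectors.\<close>
  have e1: "a * ((\<zeta> - 1) * u) - b * (\<zeta> * v) = - (q * w + p - 2 * p\<^sup>2 * w)"
    by (rule DERIV_unique[OF 1 3])
  have e2: "c * ((\<zeta> - 1) * u) - d * (\<zeta> * v) = (r * w\<^sup>2 + 2 * q * w - 3 * q * w\<^sup>2 * p) - 3 * (q * w + p - 2 * p\<^sup>2 * w)"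
    by (rule DERIV_unique[OF 2 4])
  have Rz: "R (u, v) = (1 - p * w, q * w\<^sup>2 + 2 - 3 * (p * w))"
    using nz by (simp add: R_def yy_def zz_def pqr dw power2_eq_square power3_eq_cube)
  have BC: "B = 5 * (1 - p * w)\<^sup>2 - 3 * (1 - p * w) * (q * w\<^sup>2 + 2 - 3 * (p * w)) - (1 - p * w) + (q * w\<^sup>2 + 2 - 3 * (p * w))"
    "C = 2 * (1 - p * w)\<^sup>2 - (q * w\<^sup>2 + 2 - 3 * (p * w))"
    using B by (auto simp: H6_def Rz)
  have "B * (- (q * w + p - 2 * p\<^sup>2 * w)) + C * ((r * w\<^sup>2 + 2 * q * w - 3 * q * w\<^sup>2 * p) - 3 * (q * w + p - 2 * p\<^sup>2 * w)) = 0"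
    unfolding BC using r by algebra
  then have "B * (a * ((\<zeta> - 1) * u) - b * (\<zeta> * v)) + C * (c * ((\<zeta> - 1) * u) - d * (\<zeta> * v)) = 0"
    unfolding e1 e2 .
  then show ?thesis by (simp add: algebra_simps)
qed

end

section \<open>The quotient by \<open>T6\<close> seen through one chart\<close>

lemma hpt_eq: "hpt (a, b, c) = hpt (x, y, z) \<longleftrightarrow> (\<exists>k. k \<noteq> 0 \<and> a = k * x \<and> b = k * y \<and> c = k * z)"
  unfolding hpt_eq_iff csc_def by auto

definition cc :: "c2 \<Rightarrow> c3 set \<times> c3 set" where
  "cc = (\<lambda>(u, v). (hpt (1, u * v, u), hpt (u * v, 1, v)))"

text \<open>Every orbit meets the image of \<open>cc\<close>, so this map is onto the quotient, and
  openness and holomorphy on the quotient can be tested after composition with it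
  (\<open>points_Y\<close>, \<open>openin_Y\<close>, \<open>holo_Y\<close>).\<close>

definition tau :: "c2 \<Rightarrow> (c3 set \<times> c3 set) set" where
  "tau z = T6_orbit (cc z)"

lemma T6_cc:
  "cc (u, v) = (hpt (1, u * v, u), hpt (u * v, 1, v))"
  "T6 (cc (u, v)) = (hpt (v, u * v, 1), hpt (u, 1, u * v))"
  "T6 (T6 (cc (u, v))) = (hpt (u * v, u, 1), hpt (1, v, u * v))"
  "T6 (T6 (T6 (cc (u, v)))) = (hpt (u * v, 1, v), hpt (1, u * v, u))"
  "T6 (T6 (T6 (T6 (cc (u, v))))) = (hpt (u, 1, u * v), hpt (v, u * v, 1))"
  "T6 (T6 (T6 (T6 (T6 (cc (u, v)))))) = (hpt (1, v, u * v), hpt (u * v, u, 1))"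
  by (simp_all add: cc_def T6_def T3_hpt) (simp_all add: T3_def)

lemma T6_6: "T6 (T6 (T6 (T6 (T6 (T6 x))))) = x"
proof -
  have "T3 (T3 (T3 v)) = v" for v by (cases v) (simp add: T3_def)
  then have "T3 ` T3 ` T3 ` A = A" for A
    by (simp add: image_image)
  then show ?thesis by (cases x) (simp add: T6_def)
qed

lemma T6_pow_cases:
  obtains "(T6 ^^ n) x = x" | "(T6 ^^ n) x = T6 x" | "(T6 ^^ n) x = T6 (T6 x)" | "(T6 ^^ n) x = T6 (T6 (T6 x))"
    | "(T6 ^^ n) x = T6 (T6 (T6 (T6 x)))" | "(T6 ^^ n) x = T6 (T6 (T6 (T6 (T6 x))))"
proof -
  have "(T6 ^^ n) x \<in> {x, T6 x, T6 (T6 x), T6 (T6 (T6 x)), T6 (T6 (T6 (T6 x))), T6 (T6 (T6 (T6 (T6 x))))}"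
  proof (induction n)
    case (Suc n)
    then show ?case by (elim insertE emptyE) (simp_all add: T6_6)
  qed simp
  then show thesis using that by blast
qed

lemma T6_orbit_T6: "T6_orbit (T6 x) = T6_orbit x"
proof -
  have 1: "(T6 ^^ n) (T6 x) = (T6 ^^ Suc n) x" for n by (simp add: funpow_swap1)
  have "(T6 ^^ 5) (T6 x) = x" by (simp add: numeral_eq_Suc T6_6)
  then have 2: "(T6 ^^ n) x = (T6 ^^ (n + 5)) (T6 x)" for n by (simp add: funpow_add)
  show ?thesis unfolding T6_orbit_def using 1 2 by blast
qed

lemma T6_orbit_self: "x \<in> T6_orbit x"
  unfolding T6_orbit_def by (auto intro: exI[of _ 0])

text \<open>\<open>T6\<close> rotates the hexagon of curves, hence permutes its six nodes, and there
  is one chart for each node.\<close>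

lemma bl_charts_T6:
  "bl_charts = {cc, T6 \<circ> cc, T6 \<circ> (T6 \<circ> cc), T6 \<circ> (T6 \<circ> (T6 \<circ> cc)), T6 \<circ> (T6 \<circ> (T6 \<circ> (T6 \<circ> cc))),
    T6 \<circ> (T6 \<circ> (T6 \<circ> (T6 \<circ> (T6 \<circ> cc))))}"
proof -
  have e: "(\<lambda>(u, v). f u v) = g" if "\<And>u v. g (u, v) = f u v" for f and g :: "c2 \<Rightarrow> c3 set \<times> c3 set"
    using that by auto
  have "(\<lambda>(u, v). (hpt (1, u * v, u), hpt (u * v, 1, v))) = cc"
    "(\<lambda>(u, v). (hpt (u * v, 1, v), hpt (1, u * v, u))) = T6 \<circ> (T6 \<circ> (T6 \<circ> cc))"
    "(\<lambda>(u, v). (hpt (u, 1, u * v), hpt (v, u * v, 1))) = T6 \<circ> (T6 \<circ> (T6 \<circ> (T6 \<circ> cc)))"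
    "(\<lambda>(u, v). (hpt (v, u * v, 1), hpt (u, 1, u * v))) = T6 \<circ> cc"
    "(\<lambda>(u, v). (hpt (u * v, u, 1), hpt (1, v, u * v))) = T6 \<circ> (T6 \<circ> cc)"
    "(\<lambda>(u, v). (hpt (1, v, u * v), hpt (u * v, u, 1))) = T6 \<circ> (T6 \<circ> (T6 \<circ> (T6 \<circ> (T6 \<circ> cc))))"
    by (rule e, (simp only: comp_apply)?, rule T6_cc)+
  then show ?thesis unfolding bl_charts_def by (simp only: insert_commute)
qed

lemma T6_orbit_chart: "c \<in> bl_charts \<Longrightarrow> T6_orbit (c z) = tau z"
  unfolding bl_charts_T6 tau_def by (elim insertE emptyE) (simp_all add: T6_orbit_T6)

lemma cc_bl_charts: "cc \<in> bl_charts" unfolding bl_charts_T6 by simp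

lemma openin_Bl3: "openin (tp Bl3) U \<longleftrightarrow> U \<subseteq> (\<Union>p\<in>bl_charts. range p) \<and> (\<forall>p\<in>bl_charts. open {x. p x \<in> U})"
  unfolding Bl3_def openin_coinduced by (simp add: tp_C2)

lemma points_Bl3_charts: "points Bl3 = (\<Union>p\<in>bl_charts. range p)"
  unfolding Bl3_def points_coinduced by (simp add: tp_C2)

lemma holo_Bl3: "holo Bl3 U g \<longleftrightarrow> (\<forall>p\<in>bl_charts. holo C2 {x. p x \<in> U} (g \<circ> p))"
  unfolding Bl3_def holo_coinduced by (simp add: tp_C2)

lemma points_Y: "points Bl3_mod_T6 = range tau"
  unfolding Bl3_mod_T6_def points_coinduced points_Bl3_charts
  using cc_bl_charts T6_orbit_chart by (force simp: image_iff)

lemma openin_Y: "openin (tp Bl3_mod_T6) U \<longleftrightarrow> U \<subseteq> range tau \<and> open {z. tau z \<in> U}"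
proof -
  have c: "{x. p x \<in> {x \<in> points Bl3. T6_orbit x \<in> U}} = {z. tau z \<in> U}" if "p \<in> bl_charts" for p
    using that T6_orbit_chart unfolding points_Bl3_charts by auto
  have "openin (tp Bl3) {x \<in> points Bl3. T6_orbit x \<in> U} \<longleftrightarrow> (\<forall>p\<in>bl_charts. open {z. tau z \<in> U})"
    unfolding openin_Bl3 using c by (simp add: points_Bl3_charts) blast
  also have "\<dots> \<longleftrightarrow> open {z. tau z \<in> U}" using cc_bl_charts by blast
  finally have "openin (tp Bl3) {x \<in> points Bl3. T6_orbit x \<in> U} \<longleftrightarrow> open {z. tau z \<in> U}" .
  then show ?thesis
    unfolding Bl3_mod_T6_def openin_coinduced using points_Y[unfolded Bl3_mod_T6_def points_coinduced] by simp
qed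

lemma holo_Y: "holo Bl3_mod_T6 U g \<longleftrightarrow> holo C2 {z. tau z \<in> U} (g \<circ> tau)"
proof -
  have c: "{x. p x \<in> {x \<in> points Bl3. T6_orbit x \<in> U}} = {z. tau z \<in> U}" if "p \<in> bl_charts" for p
    using that T6_orbit_chart unfolding points_Bl3_charts by auto
  have d: "g \<circ> T6_orbit \<circ> p = g \<circ> tau" if "p \<in> bl_charts" for p
    using that T6_orbit_chart by auto
  show ?thesis
    unfolding Bl3_mod_T6_def holo_coinduced ball_simps holo_Bl3 using c d cc_bl_charts by auto
qed

lemma presheaf_Y: "presheaf Bl3_mod_T6"
  unfolding Bl3_mod_T6_def Bl3_def by (intro presheaf_coinduced presheaf_C2)

lemma tau_step: "v \<noteq> 0 \<Longrightarrow> tau (1 / v, u * v) = tau (u, v)"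
proof -
  assume v: "v \<noteq> 0"
  have "cc (1 / v, u * v) = T6 (cc (u, v))"
    unfolding T6_cc(2) unfolding T6_cc(1) prod.inject hpt_eq using v by (intro conjI exI[of _ "1 / v"] exI[of _ 1]) simp_all
  then show ?thesis unfolding tau_def using T6_orbit_T6 by simp
qed

context sixth_root
begin

lemma tau_eq: "tau z = tau z' \<longleftrightarrow> rel z z'"
proof
  obtain u v where z: "z = (u, v)" by fastforce
  obtain u' v' where z': "z' = (u', v')" by fastforce
  assume "tau z = tau z'"
  then have "cc z' \<in> T6_orbit (cc z)" using T6_orbit_self unfolding tau_def by metis
  then obtain n where n: "cc z' = (T6 ^^ n) (cc z)" unfolding T6_orbit_def by blast
  have k: "k * x \<noteq> 0 \<Longrightarrow> k \<noteq> 0" for k x :: complex by simp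
  show "rel z z'"
  proof (cases rule: T6_pow_cases[of n "cc z"])
    case 1
    show ?thesis using n unfolding 1 unfolding z z' unfolding T6_cc(1) prod.inject hpt_eq rel_def by auto
  next
    case 2
    from n[unfolded 2, unfolded z z', unfolded T6_cc(2), unfolded T6_cc(1) prod.inject hpt_eq]
    obtain k l where e: "1 = k * v" "u' = k * 1" "1 = l * 1" "v' = l * (u * v)" by blast
    have nz: "v \<noteq> 0" using e by auto
    have "u' * v = 1" "v' = u * v" using e by algebra+
    then show ?thesis using nz unfolding rel_def z z' by (simp add: eq_divide_eq)
  next
    case 3
    from n[unfolded 3, unfolded z z', unfolded T6_cc(3), unfolded T6_cc(1) prod.inject hpt_eq]
    obtain k l where e: "1 = k * (u * v)" "u' = k * 1" "1 = l * v" "v' = l * (u * v)" by blast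
    have nz: "u \<noteq> 0" "v \<noteq> 0" using e by auto
    have "u' * (u * v) = 1" "v' = u" using e by algebra+
    then show ?thesis using nz unfolding rel_def z z' by (simp add: eq_divide_eq)
  next
    case 4
    from n[unfolded 4, unfolded z z', unfolded T6_cc(4), unfolded T6_cc(1) prod.inject hpt_eq]
    obtain k l where e: "1 = k * (u * v)" "u' = k * v" "1 = l * (u * v)" "v' = l * u" by blast
    have nz: "u \<noteq> 0" "v \<noteq> 0" using e by auto
    have "u' * u = 1" "v' * v = 1" using e by algebra+
    then show ?thesis using nz unfolding rel_def z z' by (simp add: eq_divide_eq)
  next
    case 5
    from n[unfolded 5, unfolded z z', unfolded T6_cc(5), unfolded T6_cc(1) prod.inject hpt_eq]
    obtain k l where e: "1 = k * u" "u' = k * (u * v)" "1 = l * (u * v)" "v' = l * 1" by blast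
    have nz: "u \<noteq> 0" "v \<noteq> 0" using e by auto
    have "u' = v" "v' * (u * v) = 1" using e by algebra+
    then show ?thesis using nz unfolding rel_def z z' by (simp add: eq_divide_eq)
  next
    case 6
    from n[unfolded 6, unfolded z z', unfolded T6_cc(6), unfolded T6_cc(1) prod.inject hpt_eq]
    obtain k l where e: "1 = k * 1" "u' = k * (u * v)" "1 = l * u" "v' = l * 1" by blast
    have nz: "u \<noteq> 0" using e by auto
    have "u' = u * v" "v' * u = 1" using e by algebra+
    then show ?thesis using nz unfolding rel_def z z' by (simp add: eq_divide_eq)
  qed
next
  assume "rel z z'"
  obtain u v where z: "z = (u, v)" by fastforce
  consider "z' = (u, v)" | "v \<noteq> 0" "z' = (1 / v, u * v)" | "u \<noteq> 0" "z' = (u * v, 1 / u)"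
    | "u \<noteq> 0" "v \<noteq> 0" "z' = (1 / (u * v), u) \<or> z' = (1 / u, 1 / v) \<or> z' = (v, 1 / (u * v))"
    using \<open>rel z z'\<close> unfolding rel_def z by auto
  then show "tau z = tau z'"
  proof cases
    case 1 then show ?thesis by (simp add: z)
  next
    case 2 then show ?thesis using tau_step[of v u] by (simp add: z)
  next
    case 3 then show ?thesis using tau_step[of "1 / u" "u * v"] by (simp add: z)
  next
    case 4
    then show ?thesis
      using tau_step[of v u] tau_step[of "u * v" "1 / v"] tau_step[of u "1 / (u * v)"]
        tau_step[of "1 / v" "1 / u"] by (auto simp: z)
  qed
qed

text \<open>The moves of \<open>rel\<close> are given by Laurent monomials, so each extends
  holomorphically to nearby points as a map preserving orbits. These local deck transformations make
  \<open>tau\<close> open and its local inverses holomorphic.\<close>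

lemma tau_transition:
  assumes "tau z' = tau z"
  obtains \<theta> N where "open N" "z' \<in> N" "\<theta> z' = z" "\<And>x. x \<in> N \<Longrightarrow> tau (\<theta> x) = tau x"
    "\<And>x. x \<in> N \<Longrightarrow> hol2 (\<lambda>x. fst (\<theta> x)) x" "\<And>x. x \<in> N \<Longrightarrow> hol2 (\<lambda>x. snd (\<theta> x)) x"
proof -
  obtain u v where z': "z' = (u, v)" by fastforce
  have o: "open {z :: c2. fst z \<noteq> 0}" "open {z :: c2. snd z \<noteq> 0}"
    using open_hol2_neq[of UNIV fst] open_hol2_neq[of UNIV snd] by (simp_all add: hol2_fst' hol2_snd')
  have o2: "open {z :: c2. fst z \<noteq> 0 \<and> snd z \<noteq> 0}" using open_Int[OF o] by (simp add: Int_def)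
  have r: "tau (\<theta> x) = tau x" if "rel x (\<theta> x)" for \<theta> x using tau_eq that by metis
  consider "z = (u, v)" | "v \<noteq> 0" "z = (1 / v, u * v)" | "u \<noteq> 0" "z = (u * v, 1 / u)"
    | "u \<noteq> 0" "v \<noteq> 0" "z = (1 / (u * v), u)" | "u \<noteq> 0" "v \<noteq> 0" "z = (1 / u, 1 / v)"
    | "u \<noteq> 0" "v \<noteq> 0" "z = (v, 1 / (u * v))"
    using assms unfolding tau_eq rel_def z' by auto
  then show thesis
  proof cases
    case 1 show thesis
      by (rule that[of UNIV "\<lambda>x. x"]) (simp_all add: z' 1 hol2_fst' hol2_snd')
  next
    case 2
    show thesis
      by (rule that[OF o(2), of "\<lambda>x. (1 / snd x, fst x * snd x)"])
        (use 2 in \<open>auto simp: z' rel_def intro!: r hol2\<close>)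
  next
    case 3
    show thesis
      by (rule that[OF o(1), of "\<lambda>x. (fst x * snd x, 1 / fst x)"])
        (use 3 in \<open>auto simp: z' rel_def intro!: r hol2\<close>)
  next
    case 4
    show thesis
      by (rule that[OF o2, of "\<lambda>x. (1 / (fst x * snd x), fst x)"])
        (use 4 in \<open>auto simp: z' rel_def intro!: r hol2\<close>)
  next
    case 5
    show thesis
      by (rule that[OF o2, of "\<lambda>x. (1 / fst x, 1 / snd x)"])
        (use 5 in \<open>auto simp: z' rel_def intro!: r hol2\<close>)
  next
    case 6
    show thesis
      by (rule that[OF o2, of "\<lambda>x. (snd x, 1 / (fst x * snd x))"])
        (use 6 in \<open>auto simp: z' rel_def intro!: r hol2\<close>)
  qed
qed

end

section \<open>Density, charts of the quotient, and its open part isomorphic to a plane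
  domain\<close>

lemma hol2_line:
  assumes "hol2 P (a + t * c, b + t * d)"
  shows "(\<lambda>t. P (a + t * c, b + t * d)) field_differentiable (at t)"
proof -
  obtain x y where P: "(P has_derivative (\<lambda>h. x * fst h + y * snd h)) (at (a + t * c, b + t * d))"
    using assms by (rule hol2E)
  have "((\<lambda>t. (a + t * c, b + t * d)) has_derivative (\<lambda>h. (h * c, h * d))) (at t)"
    by (auto intro!: derivative_eq_intros)
  from has_derivative_compose[OF this P]
  have "((\<lambda>t. P (a + t * c, b + t * d)) has_field_derivative (x * c + y * d)) (at t)"
    unfolding has_field_derivative_def by (rule has_derivative_eq_rhs) (auto simp: algebra_simps)
  then show ?thesis unfolding field_differentiable_def by blast
qed

text \<open>On the complex line joining z0 to w the restriction of P is entire; if P vanished on S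
  the identity theorem would give P w = 0.\<close>

lemma dense_nonzero:
  assumes "\<And>z. hol2 P z" "P w \<noteq> 0" "open S" "z0 \<in> S"
  obtains z where "z \<in> S" "P z \<noteq> 0"
proof (rule ccontr)
  assume a: "\<not> thesis"
  then have z: "z \<in> S \<Longrightarrow> P z = 0" for z using that by blast
  define g where "g t = P (fst z0 + t * (fst w - fst z0), snd z0 + t * (snd w - snd z0))" for t
  have hg: "g holomorphic_on UNIV"
    unfolding holomorphic_on_def g_def using hol2_line assms(1) by (auto intro: field_differentiable_at_within)
  have "continuous_on UNIV (\<lambda>t. (fst z0 + t * (fst w - fst z0), snd z0 + t * (snd w - snd z0)))"
    by (intro continuous_intros)
  from open_vimage[OF assms(3) this]
  have op: "open ((\<lambda>t. (fst z0 + t * (fst w - fst z0), snd z0 + t * (snd w - snd z0))) -` S)" (is "open ?T") .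
  have "g 1 = 0"
  proof (rule analytic_continuation_open[OF op open_UNIV _ _ _ hg, of "\<lambda>_. 0"])
    have "0 \<in> ?T" using assms(4) by simp
    then show "?T \<noteq> {}" by blast
    show "g t = 0" if "t \<in> ?T" for t using that z unfolding g_def by simp
  qed auto
  then show False using assms(2) by (simp add: g_def)
qed

context sixth_root
begin

lemma rel_invariant:
  assumes "\<And>u v. v \<noteq> 0 \<Longrightarrow> F (1 / v, u * v) = F (u, v)" "rel z z'"
  shows "F z' = F z"
proof -
  obtain u v where z: "z = (u, v)" by fastforce
  consider "z' = (u, v)" | "v \<noteq> 0" "z' = (1 / v, u * v)" | "u \<noteq> 0" "z' = (u * v, 1 / u)"
    | "u \<noteq> 0" "v \<noteq> 0" "z' = (1 / (u * v), u) \<or> z' = (1 / u, 1 / v) \<or> z' = (v, 1 / (u * v))"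
    using assms(2) unfolding rel_def z by auto
  then show ?thesis
  proof cases
    case 1 then show ?thesis by (simp add: z)
  next
    case 2 then show ?thesis using assms(1)[of v u] by (simp add: z)
  next
    case 3 then show ?thesis using assms(1)[of "1 / u" "u * v"] by (simp add: z)
  next
    case 4
    then show ?thesis
      using assms(1)[of v u] assms(1)[of "u * v" "1 / v"] assms(1)[of u "1 / (u * v)"]
        assms(1)[of "1 / v" "1 / u"] by (auto simp: z)
  qed
qed

lemma step_scale:
  assumes "v \<noteq> 0"
  shows "s0 (1 / v, u * v) = 1 / v * s0 (u, v)" "s1 (1 / v, u * v) = 1 / v * \<zeta> * s1 (u, v)"
    "s2 (1 / v, u * v) = 1 / v * \<zeta>\<^sup>2 * s2 (u, v)" "s3 (1 / v, u * v) = 1 / v * \<zeta> ^ 3 * s3 (u, v)"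
    "dd (1 / v, u * v) = 1 / v * dd (u, v)"
proof -
  define b where "b = 1 / v"
  have i: "v * b = 1" using assms by (simp add: b_def)
  show "s0 (1 / v, u * v) = 1 / v * s0 (u, v)" using i zeta_sq unfolding b_def[symmetric] s_defs prod.case by algebra
  show "s1 (1 / v, u * v) = 1 / v * \<zeta> * s1 (u, v)" using i zeta_sq unfolding b_def[symmetric] s_defs prod.case by algebra
  show "s2 (1 / v, u * v) = 1 / v * \<zeta>\<^sup>2 * s2 (u, v)" using i zeta_sq unfolding b_def[symmetric] s_defs prod.case by algebra
  show "s3 (1 / v, u * v) = 1 / v * \<zeta> ^ 3 * s3 (u, v)" using i zeta_sq unfolding b_def[symmetric] s_defs prod.case by algebra
  show "dd (1 / v, u * v) = 1 / v * dd (u, v)" using i zeta_sq unfolding b_def[symmetric] s_defs prod.case by algebra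
qed

lemma open_tau_vimage:
  assumes "open S" shows "open {z. tau z \<in> tau ` S}"
  unfolding open_subopen[of "{z. tau z \<in> tau ` S}"]
proof (intro ballI)
  fix z' assume "z' \<in> {z. tau z \<in> tau ` S}"
  then obtain z where z: "z \<in> S" "tau z' = tau z" by blast
  obtain \<theta> N where N: "open N" "z' \<in> N" "\<theta> z' = z" "\<And>x. x \<in> N \<Longrightarrow> tau (\<theta> x) = tau x"
    "\<And>x. x \<in> N \<Longrightarrow> hol2 (\<lambda>x. fst (\<theta> x)) x" "\<And>x. x \<in> N \<Longrightarrow> hol2 (\<lambda>x. snd (\<theta> x)) x"
    using tau_transition[OF z(2)] by metis
  have "open {x \<in> N. \<theta> x \<in> S}" using open_preimage_pair[OF N(1,5,6) assms] .
  moreover have "z' \<in> {x \<in> N. \<theta> x \<in> S}" using N z by simp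
  moreover have "{x \<in> N. \<theta> x \<in> S} \<subseteq> {z. tau z \<in> tau ` S}"
  proof
    fix x assume "x \<in> {x \<in> N. \<theta> x \<in> S}"
    then have "tau x = tau (\<theta> x)" "\<theta> x \<in> S" using N(4) by auto
    then show "x \<in> {z. tau z \<in> tau ` S}" by simp
  qed
  ultimately show "\<exists>T. open T \<and> z' \<in> T \<and> T \<subseteq> {z. tau z \<in> tau ` S}" by blast
qed

lemma openin_tau_image: "open S \<Longrightarrow> openin (tp Bl3_mod_T6) (tau ` S)"
  unfolding openin_Y using open_tau_vimage by blast

text \<open>Where \<open>tau\<close> is injective, its inverse becomes after composition with
  \<open>tau\<close> a local deck transformation into S, which is holomorphic by
  \<open>tau_transition\<close>.\<close>

lemma tau_chart:
  assumes S: "open S" and inj: "inj_on tau S"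
  shows "chart Bl3_mod_T6 tau S"
proof -
  define g where "g = inv_into S tau"
  have g: "g (tau z) = z" if "z \<in> S" for z unfolding g_def using inv_into_f_f[OF inj that] .
  have oS: "openin (tp C2) S" "openin (tp Bl3_mod_T6) (tau ` S)"
    using S openin_tau_image by (simp_all add: tp_C2)
  have "morphism (restrict_space C2 S) (restrict_space Bl3_mod_T6 (tau ` S)) tau"
    unfolding morphism_restrict[OF oS] 
  proof (intro conjI allI impI)
    fix T assume "openin (tp Bl3_mod_T6) T \<and> T \<subseteq> tau ` S"
    then have "open {z. tau z \<in> T}" by (simp add: openin_Y)
    from open_Int[OF S this] show "openin (tp C2) {x \<in> S. tau x \<in> T}"
      by (simp add: tp_C2 Int_def)
  next
    fix T h assume "openin (tp Bl3_mod_T6) T \<and> T \<subseteq> tau ` S \<and> holo Bl3_mod_T6 T h"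
    then show "holo C2 {x \<in> S. tau x \<in> T} (h \<circ> tau)" by (simp add: holo_Y holo_C2)
  qed simp
  moreover have "morphism (restrict_space Bl3_mod_T6 (tau ` S)) (restrict_space C2 S) g"
    unfolding morphism_restrict[OF oS(2,1)]
  proof (intro conjI allI impI)
    show "g ` tau ` S \<subseteq> S" using g by auto
  next
    fix T assume "openin (tp C2) T \<and> T \<subseteq> S"
    then have T: "open T" "T \<subseteq> S" by (simp_all add: tp_C2)
    have "{y \<in> tau ` S. g y \<in> T} = tau ` T" using T(2) g by auto
    then show "openin (tp Bl3_mod_T6) {y \<in> tau ` S. g y \<in> T}" using openin_tau_image[OF T(1)] by simp
  next
    fix T h assume "openin (tp C2) T \<and> T \<subseteq> S \<and> holo C2 T h"
    then have T: "open T" "T \<subseteq> S" "\<And>z. z \<in> T \<Longrightarrow> hol2 h z" by (simp_all add: tp_C2 holo_C2)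
    have e: "{y \<in> tau ` S. g y \<in> T} = tau ` T" using T(2) g by auto
    have "hol2 (h \<circ> g \<circ> tau) z'" if z': "tau z' \<in> tau ` T" for z'
    proof -
      obtain z where z: "z \<in> T" "tau z' = tau z" using z' by blast
      obtain \<theta> N where N: "open N" "z' \<in> N" "\<theta> z' = z" "\<And>x. x \<in> N \<Longrightarrow> tau (\<theta> x) = tau x"
        "\<And>x. x \<in> N \<Longrightarrow> hol2 (\<lambda>x. fst (\<theta> x)) x" "\<And>x. x \<in> N \<Longrightarrow> hol2 (\<lambda>x. snd (\<theta> x)) x"
        using tau_transition[OF z(2)] by metis
      have o: "open {x \<in> N. \<theta> x \<in> T}" using open_preimage_pair[OF N(1,5,6) T(1)] .
      have "hol2 (\<lambda>x. h (fst (\<theta> x), snd (\<theta> x))) z'"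
        by (rule hol2_compose) (use N z T in simp_all)
      then show ?thesis
      proof (rule hol2_transform[OF _ o])
        show "z' \<in> {x \<in> N. \<theta> x \<in> T}" using N z by simp
        show "h (fst (\<theta> x), snd (\<theta> x)) = (h \<circ> g \<circ> tau) x" if x: "x \<in> {x \<in> N. \<theta> x \<in> T}" for x
        proof -
          have "g (tau x) = \<theta> x" using x N(4)[of x] g[of "\<theta> x"] T(2) by auto
          then show ?thesis by simp
        qed
      qed
    qed
    then show "holo Bl3_mod_T6 {y \<in> tau ` S. g y \<in> T} (h \<circ> g)"
      unfolding e holo_Y holo_C2 by simp
  qed
  ultimately have "isomorphism (restrict_space C2 S) (restrict_space Bl3_mod_T6 (tau ` S)) tau"
    by (rule isomorphismI[OF oS presheaf_Y]) (use g in auto)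
  then show ?thesis unfolding chart_def using S oS(2) by simp
qed

lemma chart_smooth: "chart X p W \<Longrightarrow> p ` W \<subseteq> smooth_locus X"
  unfolding smooth_locus_def by blast

lemma openin_smooth_locus: "openin (tp X) (smooth_locus X)"
  unfolding smooth_locus_def chart_def by (rule openin_Union) blast

definition O0 :: "c2 set" where "O0 = {z. s1 z \<noteq> 0 \<and> dd z \<noteq> 0}"
definition W0 :: "c2 set" where "W0 = {b. cubic2 (1, b) \<noteq> 0}"
text \<open>\<open>R\<close> descended to the quotient and, below, its inverse over
  \<open>W0\<close>. The choice of representatives is harmless: \<open>R\<close> is constant on
  orbits (\<open>rel_R\<close>) and separates those in \<open>O0\<close>
  (\<open>R_inj\<close>).\<close>

definition kY :: "(c3 set \<times> c3 set) set \<Rightarrow> c2" where "kY y = R (SOME z. tau z = y)"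
definition psi :: "c2 \<Rightarrow> (c3 set \<times> c3 set) set" where "psi b = tau (SOME z. z \<in> O0 \<and> R z = b)"

lemma local_section_W0:
  assumes "b0 \<in> W0"
  shows "\<exists>W \<phi>. open W \<and> b0 \<in> W \<and> (\<forall>b\<in>W. \<phi> b \<in> O0 \<and> R (\<phi> b) = b \<and>
    hol2 (\<lambda>b. fst (\<phi> b)) b \<and> hol2 (\<lambda>b. snd (\<phi> b)) b)"
proof -
  have c: "cubic2 (1, b0) \<noteq> 0" using assms by (simp add: W0_def)
  show ?thesis
  proof (rule local_section[OF c])
    fix W \<phi> assume "open W" "b0 \<in> W" "\<And>b. b \<in> W \<Longrightarrow> s1 (\<phi> b) \<noteq> 0 \<and> dd (\<phi> b) \<noteq> 0 \<and> R (\<phi> b) = b"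
      "\<And>b. b \<in> W \<Longrightarrow> hol2 (\<lambda>b. fst (\<phi> b)) b" "\<And>b. b \<in> W \<Longrightarrow> hol2 (\<lambda>b. snd (\<phi> b)) b"
    then show ?thesis unfolding O0_def by (intro exI[of _ W] exI[of _ \<phi>]) simp
  qed
qed

lemma some_rel: "rel z (SOME z'. tau z' = tau z)"
proof -
  have "tau (SOME z'. tau z' = tau z) = tau z" by (rule someI) (rule refl)
  then show ?thesis using tau_eq by metis
qed

lemma kY_tau: "kY (tau z) = R z"
  unfolding kY_def using rel_R[OF some_rel] by simp

lemma open_O0: "open O0"
proof -
  have "open {z \<in> UNIV. s1 z * dd z \<noteq> 0}" by (rule open_hol2_neq) (simp_all add: hol2)
  then show ?thesis by (simp add: O0_def)
qed

lemma tau_O0: "tau z \<in> tau ` O0 \<longleftrightarrow> z \<in> O0"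
proof
  assume "tau z \<in> tau ` O0"
  then obtain z' where "z' \<in> O0" "tau z' = tau z" by force
  then show "z \<in> O0" unfolding O0_def using rel_R[of z' z] tau_eq by auto
qed blast

lemma openin_Y0: "openin (tp Bl3_mod_T6) (tau ` O0)" by (rule openin_tau_image[OF open_O0])

lemma hol2_cubic: "hol2 (\<lambda>b. cubic2 (1, b)) b" "hol2 (\<lambda>b. cubic1 (1, b)) b"
  unfolding cubic2_def cubic1_def case_prod_unfold fst_conv snd_conv by (rule hol2)+

lemma open_W0: "open W0"
  using open_hol2_neq[OF open_UNIV hol2_cubic(1)] by (simp add: W0_def)

lemma R_W0: "z \<in> O0 \<Longrightarrow> R z \<in> W0"
  unfolding O0_def W0_def using cubic2_R[of z] by simp

lemma psi:
  assumes "b \<in> W0" shows "psi b \<in> tau ` O0 \<and> kY (psi b) = b"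
proof -
  obtain W \<phi> where "b \<in> W" "\<forall>b\<in>W. \<phi> b \<in> O0 \<and> R (\<phi> b) = b"
    using local_section_W0[OF assms] by metis
  then have "\<phi> b \<in> O0 \<and> R (\<phi> b) = b" by simp
  then have "\<exists>z. z \<in> O0 \<and> R z = b" by (rule exI)
  from someI_ex[OF this] show ?thesis unfolding psi_def by (simp add: kY_tau)
qed

lemma psi_R:
  assumes "z \<in> O0" "R z = b" shows "psi b = tau z"
proof -
  have "\<exists>z. z \<in> O0 \<and> R z = b" using assms by blast
  from someI_ex[OF this] have *: "(SOME z. z \<in> O0 \<and> R z = b) \<in> O0" "R (SOME z. z \<in> O0 \<and> R z = b) = b" by auto
  then have "rel z (SOME z. z \<in> O0 \<and> R z = b)" using R_inj assms unfolding O0_def by auto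
  then show ?thesis unfolding psi_def using tau_eq by metis
qed

text \<open>\<open>kY\<close> is holomorphic because \<open>R\<close> is so on \<open>O0\<close>.
  Its inverse \<open>psi\<close> is locally \<open>tau\<close> composed with a holomorphic section
  of \<open>R\<close>.\<close>

lemma iso_Y0:
  "isomorphism (restrict_space Bl3_mod_T6 (tau ` O0)) (restrict_space C2 W0) kY"
  "isomorphism (restrict_space C2 W0) (restrict_space Bl3_mod_T6 (tau ` O0)) psi"
proof -
  have oS: "openin (tp Bl3_mod_T6) (tau ` O0)" "openin (tp C2) W0"
    using openin_Y0 open_W0 by (simp_all add: tp_C2)
  have e: "{z. tau z \<in> {y \<in> tau ` O0. kY y \<in> S}} = {z \<in> O0. R z \<in> S}" for S
    using tau_O0 kY_tau by auto
  have hR: "z \<in> O0 \<Longrightarrow> hol2 (\<lambda>z. fst (R z)) z" "z \<in> O0 \<Longrightarrow> hol2 (\<lambda>z. snd (R z)) z" for z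
    by (simp_all add: O0_def hol2_R)
  have m1: "morphism (restrict_space Bl3_mod_T6 (tau ` O0)) (restrict_space C2 W0) kY"
    unfolding morphism_restrict[OF oS]
  proof (intro conjI allI impI)
    show "kY ` tau ` O0 \<subseteq> W0" using R_W0 kY_tau by auto
  next
    fix S assume "openin (tp C2) S \<and> S \<subseteq> W0"
    then have "open {z \<in> O0. R z \<in> S}" by (intro open_preimage_pair open_O0 hR) (simp_all add: tp_C2)
    then show "openin (tp Bl3_mod_T6) {y \<in> tau ` O0. kY y \<in> S}" unfolding openin_Y e by blast
  next
    fix S h assume "openin (tp C2) S \<and> S \<subseteq> W0 \<and> holo C2 S h"
    then have h: "\<And>z. z \<in> S \<Longrightarrow> hol2 h z" by (simp add: holo_C2)
    have k: "h \<circ> kY \<circ> tau = (\<lambda>z. h (fst (R z), snd (R z)))" by (auto simp: kY_tau)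
    show "holo Bl3_mod_T6 {y \<in> tau ` O0. kY y \<in> S} (h \<circ> kY)"
      unfolding holo_Y e holo_C2 k by (intro ballI hol2_compose hR) (simp_all add: h)
  qed
  have m2: "morphism (restrict_space C2 W0) (restrict_space Bl3_mod_T6 (tau ` O0)) psi"
    unfolding morphism_restrict[OF oS(2,1)]
  proof (intro conjI allI impI)
    show "psi ` W0 \<subseteq> tau ` O0" using psi by blast
  next
    fix S assume S: "openin (tp Bl3_mod_T6) S \<and> S \<subseteq> tau ` O0"
    have "open {b \<in> W0. psi b \<in> S}"
      unfolding open_subopen[of "{b \<in> W0. psi b \<in> S}"]
    proof
      fix b assume b: "b \<in> {b \<in> W0. psi b \<in> S}"
      then have "b \<in> W0" by simp
      then obtain W \<phi> where W: "open W" "b \<in> W" and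
        \<phi>: "\<And>b. b \<in> W \<Longrightarrow> \<phi> b \<in> O0" "\<And>b. b \<in> W \<Longrightarrow> R (\<phi> b) = b"
        "\<And>b. b \<in> W \<Longrightarrow> hol2 (\<lambda>b. fst (\<phi> b)) b" "\<And>b. b \<in> W \<Longrightarrow> hol2 (\<lambda>b. snd (\<phi> b)) b"
        using local_section_W0 by metis
      have p: "psi b = tau (\<phi> b)" if "b \<in> W" for b using psi_R[OF \<phi>(1,2)[OF that]] by simp
      have "open {z. tau z \<in> S}" using S by (simp add: openin_Y)
      then have "open {b \<in> W. \<phi> b \<in> {z. tau z \<in> S}}" by (intro open_preimage_pair W \<phi>)
      moreover have "{b \<in> W. \<phi> b \<in> {z. tau z \<in> S}} \<subseteq> {b \<in> W0. psi b \<in> S}"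
      proof
        fix c assume c: "c \<in> {b \<in> W. \<phi> b \<in> {z. tau z \<in> S}}"
        then have "R (\<phi> c) \<in> W0" "R (\<phi> c) = c" using \<phi>(2)[of c] R_W0[OF \<phi>(1)[of c]] by auto
        then show "c \<in> {b \<in> W0. psi b \<in> S}" using c p by simp
      qed
      ultimately show "\<exists>T. open T \<and> b \<in> T \<and> T \<subseteq> {b \<in> W0. psi b \<in> S}"
        using b W(2) p by (intro exI[of _ "{b \<in> W. \<phi> b \<in> {z. tau z \<in> S}}"]) simp
    qed
    then show "openin (tp C2) {b \<in> W0. psi b \<in> S}" by (simp add: tp_C2)
  next
    fix S h assume S: "openin (tp Bl3_mod_T6) S \<and> S \<subseteq> tau ` O0 \<and> holo Bl3_mod_T6 S h"
    show "holo C2 {b \<in> W0. psi b \<in> S} (h \<circ> psi)"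
      unfolding holo_C2
    proof
      fix b assume b: "b \<in> {b \<in> W0. psi b \<in> S}"
      then have "b \<in> W0" by simp
      then obtain W \<phi> where W: "open W" "b \<in> W" and
        \<phi>: "\<And>b. b \<in> W \<Longrightarrow> \<phi> b \<in> O0" "\<And>b. b \<in> W \<Longrightarrow> R (\<phi> b) = b"
        "\<And>b. b \<in> W \<Longrightarrow> hol2 (\<lambda>b. fst (\<phi> b)) b" "\<And>b. b \<in> W \<Longrightarrow> hol2 (\<lambda>b. snd (\<phi> b)) b"
        using local_section_W0 by metis
      have p: "psi b = tau (\<phi> b)" if "b \<in> W" for b using psi_R[OF \<phi>(1,2)[OF that]] by simp
      have "\<forall>z\<in>{z. tau z \<in> S}. hol2 (h \<circ> tau) z" using S unfolding holo_Y holo_C2 by blast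
      moreover have "\<phi> b \<in> {z. tau z \<in> S}" using b p[OF W(2)] by simp
      ultimately have "hol2 (h \<circ> tau) (fst (\<phi> b), snd (\<phi> b))" unfolding prod.collapse by (rule bspec)
      then have "hol2 (\<lambda>b. (h \<circ> tau) (fst (\<phi> b), snd (\<phi> b))) b"
        by (rule hol2_compose[OF _ \<phi>(3,4)[OF W(2)]])
      then show "hol2 (h \<circ> psi) b"
        by (rule hol2_transform[OF _ W(1,2)]) (simp add: p)
    qed
  qed
  have k: "kY (psi b) = b" if "b \<in> W0" for b using psi[OF that] by simp
  have p: "psi (kY y) = y" if "y \<in> tau ` O0" for y
  proof -
    from that obtain z where "z \<in> O0" "y = tau z" by blast
    then show ?thesis using psi_R[OF _ refl] by (simp add: kY_tau)
  qed
  show "isomorphism (restrict_space Bl3_mod_T6 (tau ` O0)) (restrict_space C2 W0) kY"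
    by (rule isomorphismI[OF oS presheaf_C2 m1 m2]) (simp_all add: k p)
  show "isomorphism (restrict_space C2 W0) (restrict_space Bl3_mod_T6 (tau ` O0)) psi"
    by (rule isomorphismI[OF oS(2,1) presheaf_Y m2 m1]) (simp_all add: k p)
qed

lemma Y0_smooth: "tau ` O0 \<subseteq> smooth_locus Bl3_mod_T6"
proof -
  have "psi ` W0 = tau ` O0"
  proof (intro equalityI image_subsetI)
    fix z assume z: "z \<in> O0"
    show "tau z \<in> psi ` W0" using psi_R[OF z refl] R_W0[OF z] by (metis image_eqI)
  qed (use psi in blast)
  then have "chart Bl3_mod_T6 psi W0"
    unfolding chart_def using open_W0 openin_Y0 iso_Y0(2) by simp
  from chart_smooth[OF this] \<open>psi ` W0 = tau ` O0\<close> show ?thesis by simp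
qed

lemma Y0_dense:
  assumes "openin (tp Bl3_mod_T6) S" "y \<in> S"
  obtains z where "z \<in> O0" "tau z \<in> S"
proof -
  obtain z0 where z0: "tau z0 \<in> S" using assms unfolding openin_Y by blast
  have o: "open {z. tau z \<in> S}" using assms unfolding openin_Y by blast
  have "s1 (0, 0) * dd (0, 0) \<noteq> 0" by (simp add: s_defs)
  then obtain z where "z \<in> {z. tau z \<in> S}" "s1 z * dd z \<noteq> 0"
    by (rule dense_nonzero[OF hol2_mult[OF hol2_s1 hol2_dd] _ o, of _ z0]) (simp_all add: z0)
  then show thesis using that unfolding O0_def by simp
qed

text \<open>\<open>T6\<close> moves an edge of the cycle to the next one, so near a point of the
  open edge u = 0 it should identify no two points. The inequalities on the absolute values of u and
  v define an open set containing that edge and at most one point of each orbit, on which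
  \<open>tau\<close> is therefore a chart.\<close>

lemma edge_smooth:
  assumes "v \<noteq> 0" shows "tau (0, v) \<in> smooth_locus Bl3_mod_T6"
proof -
  define a b where "a z = norm (fst z)" "b z = norm (snd z)" for z :: c2
  define S where "S = {z. a z * (b z)\<^sup>2 < 1 \<and> a z * (b z)\<^sup>2 * (1 + a z) < 1 + b z \<and> (a z)\<^sup>2 * b z < 1 \<and>
    a z * (a z * b z + 1) < 1 + b z \<and> a z < b z}"
  have "open S" unfolding S_def a_b_def
    by (intro open_Collect_conj open_Collect_less continuous_intros)
  moreover have "inj_on tau S"
  proof
    fix z z' assume z: "z \<in> S" "z' \<in> S" "tau z = tau z'"
    obtain u v where uv: "z = (u, v)" by fastforce
    have r: "rel z z'" using z(3) tau_eq by simp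
    have p: "u \<noteq> 0 \<Longrightarrow> norm u > 0" "v \<noteq> 0 \<Longrightarrow> norm v > 0" by simp_all
    show "z = z'"
      using r z(1,2) p unfolding rel_def uv S_def a_b_def
      by (auto simp: norm_mult norm_divide power_divide power_mult_distrib field_simps power2_eq_square)
  qed
  ultimately have "tau ` S \<subseteq> smooth_locus Bl3_mod_T6"
    by (intro chart_smooth tau_chart)
  moreover have "(0, v) \<in> S" using assms by (simp add: S_def a_b_def add_pos_nonneg)
  ultimately show ?thesis by blast
qed

end

section \<open>The projective plane and the complement of x = 0 and the second cubic\<close>

lemma openin_P2: "openin (tp P2) U \<longleftrightarrow> U \<subseteq> range aff1 \<union> (range aff2 \<union> range aff3) \<and>
    open {z. aff1 z \<in> U} \<and> open {z. aff2 z \<in> U} \<and> open {z. aff3 z \<in> U}"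
  unfolding P2_def openin_coinduced by (simp add: tp_C2)

lemma holo_P2: "holo P2 U g \<longleftrightarrow> (\<forall>z. aff1 z \<in> U \<longrightarrow> hol2 (g \<circ> aff1) z) \<and>
    (\<forall>z. aff2 z \<in> U \<longrightarrow> hol2 (g \<circ> aff2) z) \<and> (\<forall>z. aff3 z \<in> U \<longrightarrow> hol2 (g \<circ> aff3) z)"
  unfolding P2_def holo_coinduced holo_C2 tp_C2 by simp

lemma presheaf_P2: "presheaf P2"
  unfolding P2_def by (intro presheaf_coinduced presheaf_C2)

lemma aff_hpt: "aff1 z = hpt (1, fst z, snd z)" "aff2 z = hpt (fst z, 1, snd z)" "aff3 z = hpt (fst z, snd z, 1)"
  by (simp_all add: aff1_def aff2_def aff3_def case_prod_unfold)

lemma aff1_eq: "aff1 z = hpt (x, y, w) \<longleftrightarrow> x \<noteq> 0 \<and> z = (y / x, w / x)"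
proof
  assume "aff1 z = hpt (x, y, w)"
  then obtain k where k: "k \<noteq> 0" "1 = k * x" "fst z = k * y" "snd z = k * w" unfolding aff_hpt hpt_eq by blast
  from k have "x \<noteq> 0" "k = 1 / x" by (auto simp: eq_divide_eq)
  then show "x \<noteq> 0 \<and> z = (y / x, w / x)" using k by (simp add: prod_eq_iff)
next
  assume "x \<noteq> 0 \<and> z = (y / x, w / x)"
  then show "aff1 z = hpt (x, y, w)" unfolding aff_hpt hpt_eq by (intro exI[of _ "1 / x"]) simp
qed

lemma aff2_eq: "aff2 z = hpt (x, y, w) \<longleftrightarrow> y \<noteq> 0 \<and> z = (x / y, w / y)"
proof
  assume "aff2 z = hpt (x, y, w)"
  then obtain k where k: "k \<noteq> 0" "fst z = k * x" "1 = k * y" "snd z = k * w" unfolding aff_hpt hpt_eq by blast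
  from k have "y \<noteq> 0" "k = 1 / y" by (auto simp: eq_divide_eq)
  then show "y \<noteq> 0 \<and> z = (x / y, w / y)" using k by (simp add: prod_eq_iff)
next
  assume "y \<noteq> 0 \<and> z = (x / y, w / y)"
  then show "aff2 z = hpt (x, y, w)" unfolding aff_hpt hpt_eq by (intro exI[of _ "1 / y"]) simp
qed

lemma aff3_eq: "aff3 z = hpt (x, y, w) \<longleftrightarrow> w \<noteq> 0 \<and> z = (x / w, y / w)"
proof
  assume "aff3 z = hpt (x, y, w)"
  then obtain k where k: "k \<noteq> 0" "fst z = k * x" "snd z = k * y" "1 = k * w" unfolding aff_hpt hpt_eq by blast
  from k have "w \<noteq> 0" "k = 1 / w" by (auto simp: eq_divide_eq)
  then show "w \<noteq> 0 \<and> z = (x / w, y / w)" using k by (simp add: prod_eq_iff)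
next
  assume "w \<noteq> 0 \<and> z = (x / w, y / w)"
  then show "aff3 z = hpt (x, y, w)" unfolding aff_hpt hpt_eq by (intro exI[of _ "1 / w"]) simp
qed

lemma inj_aff: "inj aff1" "inj aff2" "inj aff3"
proof -
  show "inj aff1"
  proof
    fix x y assume "aff1 x = aff1 y" then show "x = y" unfolding aff_hpt(1)[of y] aff1_eq by simp
  qed
  show "inj aff2"
  proof
    fix x y assume "aff2 x = aff2 y" then show "x = y" unfolding aff_hpt(2)[of y] aff2_eq by simp
  qed
  show "inj aff3"
  proof
    fix x y assume "aff3 x = aff3 y" then show "x = y" unfolding aff_hpt(3)[of y] aff3_eq by simp
  qed
qed

lemma aff1_image: "aff1 z \<in> aff1 ` W \<longleftrightarrow> z \<in> W"
  "aff2 z \<in> aff1 ` W \<longleftrightarrow> fst z \<noteq> 0 \<and> (1 / fst z, snd z / fst z) \<in> W"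
  "aff3 z \<in> aff1 ` W \<longleftrightarrow> fst z \<noteq> 0 \<and> (snd z / fst z, 1 / fst z) \<in> W"
proof -
  have img: "p \<in> aff1 ` W \<longleftrightarrow> (\<exists>x\<in>W. aff1 x = p)" for p by auto
  show "aff1 z \<in> aff1 ` W \<longleftrightarrow> z \<in> W" using inj_aff(1) by (rule inj_image_mem_iff)
  show "aff2 z \<in> aff1 ` W \<longleftrightarrow> fst z \<noteq> 0 \<and> (1 / fst z, snd z / fst z) \<in> W"
    unfolding img aff_hpt(2)[of z] aff1_eq by auto
  show "aff3 z \<in> aff1 ` W \<longleftrightarrow> fst z \<noteq> 0 \<and> (snd z / fst z, 1 / fst z) \<in> W"
    unfolding img aff_hpt(3)[of z] aff1_eq by auto
qed

lemma open_fst_neq: "open {z :: c2. fst z \<noteq> 0}" "open {z :: c2. snd z \<noteq> 0}"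
  using open_hol2_neq[OF open_UNIV hol2_fst'] open_hol2_neq[OF open_UNIV hol2_snd'] by simp_all

lemma openin_aff1:
  assumes "open W" shows "openin (tp P2) (aff1 ` W)"
proof -
  have "open {z \<in> {z. fst z \<noteq> 0}. (1 / fst z, snd z / fst z) \<in> W}"
    "open {z \<in> {z. fst z \<noteq> 0}. (snd z / fst z, 1 / fst z) \<in> W}"
    by (rule open_preimage_pair[OF open_fst_neq(1)]; simp add: hol2_divide hol2_const hol2_fst' hol2_snd' assms)+
  then show ?thesis unfolding openin_P2 aff1_image using assms by auto
qed

lemma iso_aff1:
  assumes W: "open W"
  shows "isomorphism (restrict_space C2 W) (restrict_space P2 (aff1 ` W)) aff1"
proof -
  define g where "g = inv_into UNIV aff1"
  have g: "g (aff1 z) = z" for z unfolding g_def using inj_aff(1) by (rule inv_f_f)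
  have g2: "fst z \<noteq> 0 \<Longrightarrow> g (aff2 z) = (1 / fst z, snd z / fst z)" for z
    using aff1_eq[of "(1 / fst z, snd z / fst z)" "fst z" 1 "snd z"] g aff_hpt(2)[of z] by metis
  have g3: "fst z \<noteq> 0 \<Longrightarrow> g (aff3 z) = (snd z / fst z, 1 / fst z)" for z
    using aff1_eq[of "(snd z / fst z, 1 / fst z)" "fst z" "snd z" 1] g aff_hpt(3)[of z] by metis
  have oS: "openin (tp C2) W" "openin (tp P2) (aff1 ` W)" using W openin_aff1 by (simp_all add: tp_C2)
  have m1: "morphism (restrict_space C2 W) (restrict_space P2 (aff1 ` W)) aff1"
    unfolding morphism_restrict[OF oS]
  proof (intro conjI allI impI)
    fix T assume "openin (tp P2) T \<and> T \<subseteq> aff1 ` W"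
    then have "open {z. aff1 z \<in> T}" by (simp add: openin_P2)
    from open_Int[OF W this] show "openin (tp C2) {x \<in> W. aff1 x \<in> T}" by (simp add: tp_C2 Int_def)
  next
    fix T h assume "openin (tp P2) T \<and> T \<subseteq> aff1 ` W \<and> holo P2 T h"
    then show "holo C2 {x \<in> W. aff1 x \<in> T} (h \<circ> aff1)" unfolding holo_P2 holo_C2 by blast
  qed simp
  have m2: "morphism (restrict_space P2 (aff1 ` W)) (restrict_space C2 W) g"
    unfolding morphism_restrict[OF oS(2,1)]
  proof (intro conjI allI impI)
    show "g ` aff1 ` W \<subseteq> W" using g by auto
  next
    fix T assume "openin (tp C2) T \<and> T \<subseteq> W"
    then have T: "open T" "T \<subseteq> W" by (simp_all add: tp_C2)
    have "{y \<in> aff1 ` W. g y \<in> T} = aff1 ` T" using T(2) g by auto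
    then show "openin (tp P2) {y \<in> aff1 ` W. g y \<in> T}" using openin_aff1[OF T(1)] by simp
  next
    fix T h assume "openin (tp C2) T \<and> T \<subseteq> W \<and> holo C2 T h"
    then have T: "open T" "T \<subseteq> W" "\<And>z. z \<in> T \<Longrightarrow> hol2 h z" by (simp_all add: tp_C2 holo_C2)
    have e: "{y \<in> aff1 ` W. g y \<in> T} = aff1 ` T" using T(2) g by auto
    show "holo P2 {y \<in> aff1 ` W. g y \<in> T} (h \<circ> g)"
      unfolding e holo_P2 aff1_image
    proof (intro conjI allI impI)
      fix z assume "z \<in> T"
      then show "hol2 (h \<circ> g \<circ> aff1) z" using T(3) g by (simp add: comp_def)
    next
      fix z assume z: "fst z \<noteq> 0 \<and> (1 / fst z, snd z / fst z) \<in> T"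
      have "hol2 (\<lambda>z. h (1 / fst z, snd z / fst z)) z"
        by (rule hol2_compose) (use z T(3) in \<open>simp_all add: hol2_divide hol2_const hol2_fst' hol2_snd'\<close>)
      then show "hol2 (h \<circ> g \<circ> aff2) z"
        by (rule hol2_transform[OF _ open_fst_neq(1)]) (use z in \<open>simp_all add: g2\<close>)
    next
      fix z assume z: "fst z \<noteq> 0 \<and> (snd z / fst z, 1 / fst z) \<in> T"
      have "hol2 (\<lambda>z. h (snd z / fst z, 1 / fst z)) z"
        by (rule hol2_compose) (use z T(3) in \<open>simp_all add: hol2_divide hol2_const hol2_fst' hol2_snd'\<close>)
      then show "hol2 (h \<circ> g \<circ> aff3) z"
        by (rule hol2_transform[OF _ open_fst_neq(1)]) (use z in \<open>simp_all add: g3\<close>)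
    qed
  qed
  show ?thesis by (rule isomorphismI[OF oS presheaf_P2 m1 m2]) (auto simp: g)
qed

lemma points_P2_aff: "points P2 = range aff1 \<union> (range aff2 \<union> range aff3)"
  unfolding P2_def points_coinduced by (simp add: tp_C2)

lemma hpt_mem: "w \<in> hpt v \<longleftrightarrow> (\<exists>c. c \<noteq> 0 \<and> w = csc c v)"
  unfolding hpt_def by blast

text \<open>The function on the plane given by a quotient of two forms of the same degree.\<close>

definition quot :: "(c3 \<Rightarrow> complex) \<Rightarrow> (c3 \<Rightarrow> complex) \<Rightarrow> c3 set \<Rightarrow> complex" where
  "quot F G p = (let v = SOME v. v \<in> p in F v / G v)"

lemma quot_hpt:
  assumes "\<And>c v. F (csc c v) = c ^ n * F v" "\<And>c v. G (csc c v) = c ^ n * G v"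
  shows "quot F G (hpt v) = F v / G v"
proof -
  have "v \<in> hpt v" unfolding hpt_mem by (intro exI[of _ 1]) (simp add: csc_def split: prod.splits)
  then have "(SOME w. w \<in> hpt v) \<in> hpt v" by (rule someI)
  then obtain c where "c \<noteq> 0" "(SOME w. w \<in> hpt v) = csc c v" unfolding hpt_mem by blast
  then show ?thesis unfolding quot_def Let_def using assms by simp
qed


lemma in_closureI:
  assumes "x \<in> topspace T" "\<And>S. openin T S \<Longrightarrow> x \<in> S \<Longrightarrow> \<exists>y\<in>U. y \<in> S"
  shows "x \<in> T closure_of U"
  using assms unfolding in_closure_of by blast

text \<open>The quartic form whose zeros make up the complement of the open set
  \<open>V0\<close>.\<close>

definition xcub :: "c3 \<Rightarrow> complex" where "xcub = (\<lambda>(x, y, z). x * cubic2 (x, y, z))"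

lemma xcub_scale: "xcub (csc c v) = c ^ 4 * xcub v"
  by (cases v) (simp add: xcub_def cubic2_def csc_def algebra_simps eval_nat_numeral)

lemma coord_scale:
  "(fst (csc c v)) ^ n = c ^ n * (fst v) ^ n" "(fst (snd (csc c v))) ^ n = c ^ n * (fst (snd v)) ^ n"
  "(snd (snd (csc c v))) ^ n = c ^ n * (snd (snd v)) ^ n"
  by (cases v; simp add: csc_def power_mult_distrib)+

lemma hol2_xcub:
  "hol2 (\<lambda>b. xcub (1, fst b, snd b)) z" "hol2 (\<lambda>b. xcub (fst b, 1, snd b)) z" "hol2 (\<lambda>b. xcub (fst b, snd b, 1)) z"
  unfolding xcub_def cubic2_def prod.case by (rule hol2)+

lemma aff_range_iff:
  "aff1 z \<in> range aff2 \<longleftrightarrow> fst z \<noteq> 0" "aff1 z \<in> range aff3 \<longleftrightarrow> snd z \<noteq> 0"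
  "aff2 z \<in> range aff1 \<longleftrightarrow> fst z \<noteq> 0" "aff2 z \<in> range aff3 \<longleftrightarrow> snd z \<noteq> 0"
  "aff3 z \<in> range aff1 \<longleftrightarrow> fst z \<noteq> 0" "aff3 z \<in> range aff2 \<longleftrightarrow> snd z \<noteq> 0"
proof -
  have img: "p \<in> range F \<longleftrightarrow> (\<exists>x. F x = p)" for p and F :: "c2 \<Rightarrow> c3 set" by auto
  show "aff1 z \<in> range aff2 \<longleftrightarrow> fst z \<noteq> 0" "aff1 z \<in> range aff3 \<longleftrightarrow> snd z \<noteq> 0"
    unfolding img aff_hpt(1)[of z] aff2_eq aff3_eq by simp_all
  show "aff2 z \<in> range aff1 \<longleftrightarrow> fst z \<noteq> 0" "aff2 z \<in> range aff3 \<longleftrightarrow> snd z \<noteq> 0"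
    unfolding img aff_hpt(2)[of z] aff1_eq aff3_eq by simp_all
  show "aff3 z \<in> range aff1 \<longleftrightarrow> fst z \<noteq> 0" "aff3 z \<in> range aff2 \<longleftrightarrow> snd z \<noteq> 0"
    unfolding img aff_hpt(3)[of z] aff1_eq aff2_eq by simp_all
qed

lemma openin_aff_range: "openin (tp P2) (range aff1)" "openin (tp P2) (range aff2)" "openin (tp P2) (range aff3)"
  unfolding openin_P2 aff_range_iff using open_fst_neq by auto

lemma quot_aff:
  assumes "\<And>c v. F (csc c v) = c ^ n * F v" "\<And>c v. G (csc c v) = c ^ n * G v"
  shows "quot F G (aff1 z) = F (1, fst z, snd z) / G (1, fst z, snd z)"
    "quot F G (aff2 z) = F (fst z, 1, snd z) / G (fst z, 1, snd z)"
    "quot F G (aff3 z) = F (fst z, snd z, 1) / G (fst z, snd z, 1)"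
  unfolding aff_hpt by (rule quot_hpt[OF assms])+

context sixth_root
begin

definition V0 :: "c3 set set" where "V0 = aff1 ` W0"

lemma V0_iff:
  "aff1 z \<in> V0 \<longleftrightarrow> xcub (1, fst z, snd z) \<noteq> 0"
  "aff2 z \<in> V0 \<longleftrightarrow> xcub (fst z, 1, snd z) \<noteq> 0"
  "aff3 z \<in> V0 \<longleftrightarrow> xcub (fst z, snd z, 1) \<noteq> 0"
proof -
  have s: "xcub (1, b, c) \<noteq> 0 \<longleftrightarrow> xcub (a, a * b, a * c) \<noteq> 0" if "a \<noteq> 0" for a b c
    using xcub_scale[of a "(1, b, c)"] that by (simp add: csc_def)
  have w: "(b, c) \<in> W0 \<longleftrightarrow> xcub (1, b, c) \<noteq> 0" for b c by (simp add: W0_def xcub_def)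
  have z: "xcub (0, b, c) = 0" for b c by (simp add: xcub_def)
  show "aff1 z \<in> V0 \<longleftrightarrow> xcub (1, fst z, snd z) \<noteq> 0"
    unfolding V0_def aff1_image by (cases z) (simp add: w)
  show "aff2 z \<in> V0 \<longleftrightarrow> xcub (fst z, 1, snd z) \<noteq> 0"
    unfolding V0_def aff1_image w using s[of "fst z" "1 / fst z" "snd z / fst z"] z by (cases "fst z = 0") simp_all
  show "aff3 z \<in> V0 \<longleftrightarrow> xcub (fst z, snd z, 1) \<noteq> 0"
    unfolding V0_def aff1_image w using s[of "fst z" "snd z / fst z" "1 / fst z"] z by (cases "fst z = 0") simp_all
qed

lemma openin_V0: "openin (tp P2) V0" unfolding V0_def by (rule openin_aff1[OF open_W0])

lemma V0_zariski: "zariski_dense_open P2 V0"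
  unfolding zariski_dense_open_def
proof (intro conjI)
  show "openin (tp P2) V0" by (rule openin_V0)
  show "tp P2 closure_of V0 = points P2"
  proof (intro equalityI closure_of_subset_topspace subsetI in_closureI)
    fix p S assume "p \<in> points P2" and S: "openin (tp P2) S" "p \<in> S"
    then consider z where "p = aff1 z" | z where "p = aff2 z" | z where "p = aff3 z"
      unfolding points_P2_aff by blast
    then show "\<exists>y\<in>V0. y \<in> S"
    proof cases
      case (1 z)
      have o: "open {z. aff1 z \<in> S}" using S(1) by (simp add: openin_P2)
      have "xcub (1, fst (0, 0), snd (0, 0)) \<noteq> 0" by (simp add: xcub_def cubic2_def)
      then obtain w where w: "w \<in> {z. aff1 z \<in> S}" "xcub (1, fst w, snd w) \<noteq> 0"
        by (rule dense_nonzero[OF hol2_xcub(1) _ o, of _ z]) (use S(2) 1 in simp_all)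
      then have "aff1 w \<in> V0" "aff1 w \<in> S" using V0_iff(1)[of w] by simp_all
      then show ?thesis by blast
    next
      case (2 z)
      have o: "open {z. aff2 z \<in> S}" using S(1) by (simp add: openin_P2)
      have "xcub (fst (1, 0), 1, snd (1, 0)) \<noteq> 0" by (simp add: xcub_def cubic2_def)
      then obtain w where w: "w \<in> {z. aff2 z \<in> S}" "xcub (fst w, 1, snd w) \<noteq> 0"
        by (rule dense_nonzero[OF hol2_xcub(2) _ o, of _ z]) (use S(2) 2 in simp_all)
      then have "aff2 w \<in> V0" "aff2 w \<in> S" using V0_iff(2)[of w] by simp_all
      then show ?thesis by blast
    next
      case (3 z)
      have o: "open {z. aff3 z \<in> S}" using S(1) by (simp add: openin_P2)
      have "xcub (fst (1, 0), snd (1, 0), 1) \<noteq> 0" by (simp add: xcub_def cubic2_def)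
      then obtain w where w: "w \<in> {z. aff3 z \<in> S}" "xcub (fst w, snd w, 1) \<noteq> 0"
        by (rule dense_nonzero[OF hol2_xcub(3) _ o, of _ z]) (use S(2) 3 in simp_all)
      then have "aff3 w \<in> V0" "aff3 w \<in> S" using V0_iff(3)[of w] by simp_all
      then show ?thesis by blast
    qed
  qed
  \<comment> \<open>A common argument for the three affine charts: G is the fourth power of the
    coordinate that does not vanish on the chart N, and xcub/G is the local equation of the
    complement.\<close>
  have an: "\<exists>N H. openin (tp P2) N \<and> p \<in> N \<and> finite H \<and> (\<forall>g\<in>H. holo P2 N g) \<and>
      (points P2 - V0) \<inter> N = {y \<in> N. \<forall>g\<in>H. g y = 0}"
    if N: "p \<in> N" "openin (tp P2) N" and G: "\<And>c v. G (csc c v) = c ^ 4 * G v"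
      and hG: "\<And>z. hol2 (\<lambda>b. G (1, fst b, snd b)) z" "\<And>z. hol2 (\<lambda>b. G (fst b, 1, snd b)) z" "\<And>z. hol2 (\<lambda>b. G (fst b, snd b, 1)) z"
      and nz: "\<And>z. aff1 z \<in> N \<Longrightarrow> G (1, fst z, snd z) \<noteq> 0" "\<And>z. aff2 z \<in> N \<Longrightarrow> G (fst z, 1, snd z) \<noteq> 0"
      "\<And>z. aff3 z \<in> N \<Longrightarrow> G (fst z, snd z, 1) \<noteq> 0" for p N G
  proof (intro exI conjI)
    note q = quot_aff[of xcub 4 G, OF xcub_scale G]
    show "openin (tp P2) N" "p \<in> N" "finite {quot xcub G}" using N by simp_all
    show "\<forall>g\<in>{quot xcub G}. holo P2 N g"
    proof -
      have "hol2 (\<lambda>x. quot xcub G (aff1 x)) z" if "aff1 z \<in> N" for z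
        unfolding q by (rule hol2_divide[OF hol2_xcub(1) hG(1) nz(1)[OF that]])
      moreover have "hol2 (\<lambda>x. quot xcub G (aff2 x)) z" if "aff2 z \<in> N" for z
        unfolding q by (rule hol2_divide[OF hol2_xcub(2) hG(2) nz(2)[OF that]])
      moreover have "hol2 (\<lambda>x. quot xcub G (aff3 x)) z" if "aff3 z \<in> N" for z
        unfolding q by (rule hol2_divide[OF hol2_xcub(3) hG(3) nz(3)[OF that]])
      ultimately show ?thesis unfolding holo_P2 comp_def by blast
    qed
    have "y \<notin> V0 \<longleftrightarrow> quot xcub G y = 0" if y: "y \<in> N" for y
    proof -
      have "y \<in> points P2" using y openin_subset[OF N(2)] by blast
      then consider z where "y = aff1 z" | z where "y = aff2 z" | z where "y = aff3 z"
        unfolding points_P2_aff by blast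
      then show ?thesis using y nz by cases (simp_all add: q V0_iff)
    qed
    then show "(points P2 - V0) \<inter> N = {y \<in> N. \<forall>g\<in>{quot xcub G}. g y = 0}"
      using openin_subset[OF N(2)] by auto
  qed
  show "analytic_subset P2 (points P2 - V0)"
    unfolding analytic_subset_def
  proof (intro conjI ballI)
    fix p assume "p \<in> points P2"
    then consider "p \<in> range aff1" | "p \<in> range aff2" | "p \<in> range aff3"
      unfolding points_P2_aff by blast
    then show "\<exists>N H. openin (tp P2) N \<and> p \<in> N \<and> finite H \<and> (\<forall>g\<in>H. holo P2 N g) \<and>
      (points P2 - V0) \<inter> N = {y \<in> N. \<forall>g\<in>H. g y = 0}"
    proof cases
      case 1
      show ?thesis
        by (rule an[OF 1 openin_aff_range(1), of "\<lambda>v. fst v ^ 4"])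
          (auto intro: coord_scale simp: hol2_const hol2_power hol2_fst hol2_snd aff_range_iff)
    next
      case 2
      show ?thesis
        by (rule an[OF 2 openin_aff_range(2), of "\<lambda>v. fst (snd v) ^ 4"])
          (auto intro: coord_scale simp: hol2_const hol2_power hol2_fst hol2_snd aff_range_iff)
    next
      case 3
      show ?thesis
        by (rule an[OF 3 openin_aff_range(3), of "\<lambda>v. snd (snd v) ^ 4"])
          (auto intro: coord_scale simp: hol2_const hol2_power hol2_fst hol2_snd aff_range_iff)
    qed
  qed blast
qed

end

section \<open>Functions on the quotient and the image of the cycle\<close>

context sixth_root
begin

definition desc :: "(c2 \<Rightarrow> complex) \<Rightarrow> (c3 set \<times> c3 set) set \<Rightarrow> complex" where
  "desc F y = F (SOME z. tau z = y)"

lemma desc_tau: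
  assumes "\<And>u v. v \<noteq> 0 \<Longrightarrow> F (1 / v, u * v) = F (u, v)"
  shows "desc F (tau z) = F z"
  unfolding desc_def by (rule rel_invariant[OF assms some_rel])

text \<open>Homogeneous coordinates of the point given by \<open>R\<close>, with denominators
  cleared by s1^6. All terms have degree six and character \<zeta>^6 = 1.\<close>

definition num1 :: "c2 \<Rightarrow> complex" where "num1 z = (s1 z) ^ 6"
definition num2 :: "c2 \<Rightarrow> complex" where "num2 z = (s1 z) ^ 6 - s2 z * dd z * (s1 z) ^ 4"
definition num3 :: "c2 \<Rightarrow> complex" where
  "num3 z = s3 z * (dd z)\<^sup>2 * (s1 z) ^ 3 + 2 * (s1 z) ^ 6 - 3 * s2 z * dd z * (s1 z) ^ 4"

lemma num_step:
  assumes "v \<noteq> 0"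
  shows "num1 (1 / v, u * v) = (1 / v) ^ 6 * num1 (u, v)" "num2 (1 / v, u * v) = (1 / v) ^ 6 * num2 (u, v)"
    "num3 (1 / v, u * v) = (1 / v) ^ 6 * num3 (u, v)"
proof -
  have "num1 (1 / v, u * v) = (1 / v) ^ 6 * num1 (u, v) * \<zeta> ^ 6"
    unfolding num1_def step_scale[OF assms] by (simp add: power_mult_distrib mult_ac power_divide)
  then show "num1 (1 / v, u * v) = (1 / v) ^ 6 * num1 (u, v)" by (simp add: zeta_6)
  have "num2 (1 / v, u * v) = (1 / v) ^ 6 * num2 (u, v) * \<zeta> ^ 6"
    unfolding num2_def step_scale[OF assms] by (simp add: algebra_simps eval_nat_numeral)
  then show "num2 (1 / v, u * v) = (1 / v) ^ 6 * num2 (u, v)" by (simp add: zeta_6)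
  have "num3 (1 / v, u * v) = (1 / v) ^ 6 * num3 (u, v) * \<zeta> ^ 6"
    unfolding num3_def step_scale[OF assms] by (simp add: algebra_simps eval_nat_numeral)
  then show "num3 (1 / v, u * v) = (1 / v) ^ 6 * num3 (u, v)" by (simp add: zeta_6)
qed

lemma hol2_num: "hol2 num1 z" "hol2 num2 z" "hol2 num3 z"
  unfolding num1_def num2_def num3_def by (rule hol2)+

lemma num_R:
  assumes "z \<in> O0"
  shows "num1 z \<noteq> 0" "d \<noteq> 0 \<Longrightarrow> hpt (num1 z / d, num2 z / d, num3 z / d) = aff1 (R z)"
proof -
  have s: "s1 z \<noteq> 0" using assms by (simp add: O0_def)
  then show "num1 z \<noteq> 0" by (simp add: num1_def)
  have n: "num2 z = num1 z * fst (R z)" "num3 z = num1 z * snd (R z)"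
    unfolding num1_def num2_def num3_def R_def yy_def zz_def using s
    by (simp_all add: field_simps eval_nat_numeral)
  assume "d \<noteq> 0"
  then show "hpt (num1 z / d, num2 z / d, num3 z / d) = aff1 (R z)"
    unfolding aff_hpt hpt_eq n using \<open>num1 z \<noteq> 0\<close> by (intro exI[of _ "num1 z / d"]) simp
qed

text \<open>A quotient of equivariant functions with the same factor of automorphy is invariant. So
  num_i/d^3 and (s1 dd)^6/d^6 descend to the quotient, and they are holomorphic where d does not
  vanish.\<close>

lemma Y_local_aux:
  assumes d: "\<And>z. hol2 d z" "\<And>u v. v \<noteq> 0 \<Longrightarrow> d (1 / v, u * v) = (1 / v)\<^sup>2 * d (u, v)" and z0: "d z0 \<noteq> 0"
  shows "\<exists>N G g1 g2 g3. openin (tp Bl3_mod_T6) N \<and> tau z0 \<in> N \<and>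
    holo Bl3_mod_T6 N G \<and> holo Bl3_mod_T6 N g1 \<and> holo Bl3_mod_T6 N g2 \<and> holo Bl3_mod_T6 N g3 \<and>
    (\<forall>z. tau z \<in> N \<longrightarrow> (G (tau z) = 0 \<longleftrightarrow> z \<notin> O0)) \<and>
    (\<forall>z\<in>O0. tau z \<in> N \<longrightarrow> g1 (tau z) \<noteq> 0 \<and> hpt (g1 (tau z), g2 (tau z), g3 (tau z)) = aff1 (R z))"
proof -
  define N where "N = tau ` {z. d z \<noteq> 0}"
  have "open {z. d z \<noteq> 0}" using open_hol2_neq[of UNIV d] d(1) by simp
  then have N: "openin (tp Bl3_mod_T6) N" unfolding N_def by (rule openin_tau_image)
  have d0: "d (1 / v, u * v) = 0 \<longleftrightarrow> d (u, v) = 0" if "v \<noteq> 0" for u v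
    using d(2)[OF that] that by simp
  have dN: "tau z \<in> N \<longleftrightarrow> d z \<noteq> 0" for z
  proof
    assume "tau z \<in> N"
    then obtain z' where z': "d z' \<noteq> 0" "tau z' = tau z" unfolding N_def by force
    have "rel z' z" using z'(2) tau_eq by simp
    from rel_invariant[of "\<lambda>z. d z = 0", OF d0 this] show "d z \<noteq> 0" using z'(1) by simp
  qed (simp add: N_def)
  have inv: "num1 (1 / v, u * v) / (d (1 / v, u * v)) ^ 3 = num1 (u, v) / (d (u, v)) ^ 3"
    "num2 (1 / v, u * v) / (d (1 / v, u * v)) ^ 3 = num2 (u, v) / (d (u, v)) ^ 3"
    "num3 (1 / v, u * v) / (d (1 / v, u * v)) ^ 3 = num3 (u, v) / (d (u, v)) ^ 3"
    "(s1 (1 / v, u * v) * dd (1 / v, u * v)) ^ 6 / (d (1 / v, u * v)) ^ 6 = (s1 (u, v) * dd (u, v)) ^ 6 / (d (u, v)) ^ 6"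
    if "v \<noteq> 0" for u v
    unfolding num_step[OF that] step_scale[OF that] d(2)[OF that] using that zeta_6
    by (simp_all add: power_mult_distrib power_divide mult_ac flip: power_mult)
  define g1 where "g1 = desc (\<lambda>z. num1 z / (d z) ^ 3)"
  define g2 where "g2 = desc (\<lambda>z. num2 z / (d z) ^ 3)"
  define g3 where "g3 = desc (\<lambda>z. num3 z / (d z) ^ 3)"
  define G where "G = desc (\<lambda>z. (s1 z * dd z) ^ 6 / (d z) ^ 6)"
  have g: "g1 (tau z) = num1 z / (d z) ^ 3" "g2 (tau z) = num2 z / (d z) ^ 3" "g3 (tau z) = num3 z / (d z) ^ 3"
    "G (tau z) = (s1 z * dd z) ^ 6 / (d z) ^ 6" for z
    unfolding g1_def g2_def g3_def G_def
    by (rule desc_tau[where z = z, of "\<lambda>z. num1 z / (d z) ^ 3", OF inv(1)]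
        desc_tau[where z = z, of "\<lambda>z. num2 z / (d z) ^ 3", OF inv(2)]
        desc_tau[where z = z, of "\<lambda>z. num3 z / (d z) ^ 3", OF inv(3)]
        desc_tau[where z = z, of "\<lambda>z. (s1 z * dd z) ^ 6 / (d z) ^ 6", OF inv(4)]; assumption)+
  show ?thesis
  proof (intro exI conjI allI impI ballI)
    show "openin (tp Bl3_mod_T6) N" by fact
    show "tau z0 \<in> N" unfolding dN by fact
    show "holo Bl3_mod_T6 N G" "holo Bl3_mod_T6 N g1" "holo Bl3_mod_T6 N g2" "holo Bl3_mod_T6 N g3"
      unfolding holo_Y holo_C2 comp_def g dN
      by (auto intro!: hol2_divide hol2_power hol2_num hol2_mult hol2_s1 hol2_dd d(1))
    show "G (tau z) = 0 \<longleftrightarrow> z \<notin> O0" if "tau z \<in> N" for z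
      using that unfolding dN g O0_def by auto
    show "g1 (tau z) \<noteq> 0" if "z \<in> O0" "tau z \<in> N" for z
      using that num_R(1)[OF that(1)] unfolding dN g by simp
    show "hpt (g1 (tau z), g2 (tau z), g3 (tau z)) = aff1 (R z)" if "z \<in> O0" "tau z \<in> N" for z
      using that num_R(2)[OF that(1)] unfolding dN g by simp
  qed
qed

text \<open>It remains to find at every point a non-vanishing d of weight two: (uv)^2, s0^2, or the
  sum q of the squares of the boundary monomials.\<close>

lemma Y_local:
  assumes "y \<in> points Bl3_mod_T6"
  shows "\<exists>N G g1 g2 g3. openin (tp Bl3_mod_T6) N \<and> y \<in> N \<and>
    holo Bl3_mod_T6 N G \<and> holo Bl3_mod_T6 N g1 \<and> holo Bl3_mod_T6 N g2 \<and> holo Bl3_mod_T6 N g3 \<and>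
    (\<forall>z. tau z \<in> N \<longrightarrow> (G (tau z) = 0 \<longleftrightarrow> z \<notin> O0)) \<and>
    (\<forall>z\<in>O0. tau z \<in> N \<longrightarrow> g1 (tau z) \<noteq> 0 \<and> hpt (g1 (tau z), g2 (tau z), g3 (tau z)) = aff1 (R z))"
proof -
  obtain u v where y: "y = tau (u, v)" using assms unfolding points_Y by auto
  define q where "q z = 1 + (snd z)\<^sup>2 + (fst z)\<^sup>2 * (snd z) ^ 4 + (fst z) ^ 4 * (snd z) ^ 4 + (fst z) ^ 4 * (snd z)\<^sup>2 + (fst z)\<^sup>2"
    for z :: c2
  consider "u * v \<noteq> 0" | "s0 (u, v) \<noteq> 0" | "u * v = 0" "s0 (u, v) = 0" by blast
  then show ?thesis
  proof cases
    case 1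
    show ?thesis unfolding y
      by (rule Y_local_aux[of "\<lambda>z. (fst z * snd z)\<^sup>2"]) (use 1 in \<open>auto intro!: hol2 simp: power2_eq_square\<close>)
  next
    case 2
    show ?thesis unfolding y
      by (rule Y_local_aux[of "\<lambda>z. (s0 z)\<^sup>2"]) (use 2 in \<open>auto intro!: hol2 simp: step_scale(1) power_divide\<close>)
  next
    case 3
    \<comment> \<open>If v = 0 then s0 = 1 + u = 0, so u = -1 and q = 2; the case u = 0 is
      symmetric.\<close>
    then have "q (u, v) \<noteq> 0" by (auto simp: q_def s0_def add_eq_0_iff)
    show ?thesis unfolding y
    proof (rule Y_local_aux[of q])
      show "hol2 q z" for z unfolding q_def by (rule hol2)+
      show "q (1 / v, u * v) = (1 / v)\<^sup>2 * q (u, v)" if "v \<noteq> 0" for u v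
        unfolding q_def fst_conv snd_conv using that by (simp add: field_simps eval_nat_numeral)
    qed fact
  qed
qed

lemma tau_Delta6: "tau z \<in> T6_orbit ` Delta6 \<longleftrightarrow> fst z * snd z = 0"
proof -
  have c: "hpt (X, Y, Z) \<in> curve (\<lambda>(X, Y, Z). X * Y * Z) \<longleftrightarrow> (X, Y, Z) \<noteq> 0 \<and> X * Y * Z = 0" for X Y Z
  proof
    assume "hpt (X, Y, Z) \<in> curve (\<lambda>(X, Y, Z). X * Y * Z)"
    then obtain x y z where "(x, y, z) \<noteq> 0" "x * y * z = 0" "hpt (X, Y, Z) = hpt (x, y, z)"
      unfolding curve_def by auto
    moreover from this(3) obtain k where "k \<noteq> 0" "X = k * x" "Y = k * y" "Z = k * z"
      unfolding hpt_eq by blast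
    ultimately show "(X, Y, Z) \<noteq> 0 \<and> X * Y * Z = 0" by (simp add: zero_prod_def)
  next
    assume "(X, Y, Z) \<noteq> 0 \<and> X * Y * Z = 0"
    then show "hpt (X, Y, Z) \<in> curve (\<lambda>(X, Y, Z). X * Y * Z)"
      unfolding curve_def mem_Collect_eq by (intro exI[of _ "(X, Y, Z)"]) simp
  qed
  have D: "p (u, v) \<in> Delta6 \<longleftrightarrow> u * v = 0" if p: "p \<in> bl_charts" for p u v
  proof -
    have pt: "p (u, v) \<in> points Bl3" using p points_Bl3_charts by blast
    have "fst (p (u, v)) \<in> curve (\<lambda>(X, Y, Z). X * Y * Z) \<longleftrightarrow> u * v = 0"
      using p unfolding bl_charts_def
      by (elim insertE emptyE) (simp_all only: prod.case fst_conv c, auto simp: zero_prod_def)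
    then show ?thesis unfolding Delta6_def using pt by simp
  qed
  show ?thesis
  proof
    assume "tau z \<in> T6_orbit ` Delta6"
    then obtain x where x: "x \<in> Delta6" "T6_orbit x = tau z" by force
    then obtain p u v where p: "p \<in> bl_charts" "x = p (u, v)"
      unfolding Delta6_def points_Bl3_charts by auto
    have "tau (u, v) = tau z" using T6_orbit_chart[OF p(1)] x(2) p(2) by simp
    then have "rel (u, v) z" using tau_eq by simp
    moreover have "u * v = 0" using D[OF p(1)] x(1) p(2) by simp
    moreover have "(fst z * snd z = 0) = (fst (u, v) * snd (u, v) = 0)"
      by (rule rel_invariant[of "\<lambda>z. fst z * snd z = 0", OF _ \<open>rel (u, v) z\<close>]) auto
    ultimately show "fst z * snd z = 0" by simp
  next
    assume "fst z * snd z = 0"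
    then have "cc z \<in> Delta6" using D[OF cc_bl_charts, of "fst z" "snd z"] by simp
    then show "tau z \<in> T6_orbit ` Delta6" unfolding tau_def by blast
  qed
qed

lemma Delta6_closed: "openin (tp Bl3_mod_T6) (points Bl3_mod_T6 - T6_orbit ` Delta6)"
proof -
  have "{z. tau z \<in> points Bl3_mod_T6 - T6_orbit ` Delta6} = {z. fst z * snd z \<noteq> 0}"
    using tau_Delta6 points_Y by auto
  moreover have "open {z :: c2. fst z * snd z \<noteq> 0}"
    using open_hol2_neq[OF open_UNIV, of "\<lambda>z. fst z * snd z"] by (simp add: hol2_mult hol2_fst' hol2_snd')
  ultimately show ?thesis unfolding openin_Y by (simp add: points_Y)
qed

lemma R_curve:
  assumes "z \<in> O0" shows "aff1 (R z) \<in> curve cubic1 \<longleftrightarrow> fst z * snd z = 0"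
proof -
  have c: "cubic1 (csc k v) = k ^ 3 * cubic1 v" for k v
    by (cases v) (simp add: cubic1_def csc_def algebra_simps eval_nat_numeral)
  have "aff1 (R z) \<in> curve cubic1 \<longleftrightarrow> cubic1 (1, R z) = 0"
  proof
    assume "aff1 (R z) \<in> curve cubic1"
    then obtain v where v: "hpt (1, fst (R z), snd (R z)) = hpt v" "cubic1 v = 0" unfolding curve_def aff_hpt by auto
    from v(1) obtain k where "(1, fst (R z), snd (R z)) = csc k v" unfolding hpt_eq_iff by blast
    then show "cubic1 (1, R z) = 0" using c[of k v] v(2) by (metis mult_zero_right prod.collapse)
  next
    assume "cubic1 (1, R z) = 0"
    then show "aff1 (R z) \<in> curve cubic1" unfolding curve_def aff_hpt mem_Collect_eq
      by (intro exI[of _ "(1, fst (R z), snd (R z))"]) (simp add: zero_prod_def)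
  qed
  then show ?thesis using cubic1_R[of z] assms by (auto simp: O0_def)
qed

end

section \<open>The birational map from a desingularization\<close>

lemma morphism_open_vimage:
  assumes "morphism X Y f" "openin (tp Y) S"
  shows "openin (tp X) {x \<in> points X. f x \<in> S}"
  using assms(1)[unfolded morphism_def, THEN conjunct1] assms(2) by (rule openin_continuous_map_preimage)

lemma morphism_holo_vimage:
  assumes "morphism X Y f" "openin (tp Y) S" "holo Y S g"
  shows "holo X {x \<in> points X. f x \<in> S} (g \<circ> f)"
  using assms(1)[unfolded morphism_def, THEN conjunct2] assms(2,3) by simp

lemma morphism_points: "morphism X Y f \<Longrightarrow> x \<in> points X \<Longrightarrow> f x \<in> points Y"
  using continuous_map_image_subset_topspace[of "tp X" "tp Y" f] unfolding morphism_def by auto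

locale desing = sixth_root +
  fixes M :: "'m cspace" and \<pi> :: "'m \<Rightarrow> (c3 set \<times> c3 set) set"
  assumes desing: "desingularization Bl3_mod_T6 M \<pi>"
begin

definition Ms :: "'m set" where "Ms = {x \<in> points M. \<pi> x \<in> smooth_locus Bl3_mod_T6}"
definition UM :: "'m set" where "UM = {x \<in> points M. \<pi> x \<in> tau ` O0}"
definition fM :: "'m \<Rightarrow> c3 set" where "fM = aff1 \<circ> (kY \<circ> \<pi>)"

lemma presheaf_M: "presheaf M"
  using desing unfolding desingularization_def complex_surface_def by (intro function_sheaf_presheaf) simp

lemma pi: "morphism M Bl3_mod_T6 \<pi>" and closure_Ms: "tp M closure_of Ms = points M"
  and iso_Ms: "isomorphism (restrict_space M Ms) (restrict_space Bl3_mod_T6 (smooth_locus Bl3_mod_T6)) \<pi>"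
  using desing unfolding desingularization_def Let_def Ms_def by simp_all

lemma openin_Ms: "openin (tp M) Ms"
  unfolding Ms_def by (rule morphism_open_vimage[OF pi openin_smooth_locus])

lemma UM_Ms: "UM = {x \<in> Ms. \<pi> x \<in> tau ` O0}"
  unfolding UM_def Ms_def using Y0_smooth by auto

lemma iso_UM: "openin (tp M) UM" "isomorphism (restrict_space M UM) (restrict_space C2 W0) (kY \<circ> \<pi>)"
proof -
  note sub = isomorphism_sub[OF iso_Ms openin_Ms openin_smooth_locus presheaf_M presheaf_Y openin_Y0 Y0_smooth, folded UM_Ms]
  show "openin (tp M) UM" by (rule sub(1))
  show "isomorphism (restrict_space M UM) (restrict_space C2 W0) (kY \<circ> \<pi>)"
    by (rule isomorphism_compose[OF sub(2) iso_Y0(1) sub(1) openin_Y0 _ presheaf_C2])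
      (simp add: tp_C2 open_W0)
qed

lemma iso_fM: "isomorphism (restrict_space M UM) (restrict_space P2 V0) fM"
  unfolding fM_def V0_def
  by (rule isomorphism_compose[OF iso_UM(2) iso_aff1[OF open_W0] iso_UM(1) _ openin_aff1[OF open_W0] presheaf_P2])
    (simp add: tp_C2 open_W0)

lemma image_open:
  assumes "openin (tp M) S" "x \<in> S" "x \<in> Ms"
  shows "openin (tp Bl3_mod_T6) (\<pi> ` (S \<inter> Ms))"
  by (rule isomorphism_open_image[OF iso_Ms openin_Ms openin_smooth_locus openin_Int[OF assms(1) openin_Ms]]) simp

text \<open>The part over the smooth locus is dense and maps isomorphically to the quotient, where
  the image of \<open>O0\<close> is dense.\<close>

lemma UM_dense:
  assumes "openin (tp M) S" "x \<in> S"
  shows "\<exists>y\<in>UM. y \<in> S"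
proof -
  have "x \<in> tp M closure_of Ms" using assms openin_subset closure_Ms by blast
  then obtain y where y: "y \<in> Ms" "y \<in> S" using assms unfolding in_closure_of by blast
  obtain z where "z \<in> O0" "tau z \<in> \<pi> ` (S \<inter> Ms)"
    by (rule Y0_dense[OF image_open[OF assms(1) y(2,1)], of "\<pi> y"]) (use y in auto)
  then show ?thesis unfolding UM_Ms by force
qed

lemma UM_zariski: "zariski_dense_open M UM"
  unfolding zariski_dense_open_def analytic_subset_def
proof (intro conjI ballI)
  show "openin (tp M) UM" by (rule iso_UM(1))
  show "tp M closure_of UM = points M"
    by (intro equalityI closure_of_subset_topspace subsetI in_closureI UM_dense)
  fix x assume x: "x \<in> points M"
  obtain N G g1 g2 g3 where N: "openin (tp Bl3_mod_T6) N" "\<pi> x \<in> N" "holo Bl3_mod_T6 N G"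
    "\<forall>z. tau z \<in> N \<longrightarrow> (G (tau z) = 0 \<longleftrightarrow> z \<notin> O0)"
    using Y_local[OF morphism_points[OF pi x]] by metis
  have G: "G (\<pi> y) = 0 \<longleftrightarrow> \<pi> y \<notin> tau ` O0" if y: "y \<in> points M" "\<pi> y \<in> N" for y
  proof -
    obtain z where "\<pi> y = tau z" using morphism_points[OF pi y(1)] points_Y by auto
    then show ?thesis using N(4)[rule_format, of z] y(2) tau_O0[of z] by simp
  qed
  show "\<exists>N H. openin (tp M) N \<and> x \<in> N \<and> finite H \<and> (\<forall>g\<in>H. holo M N g) \<and>
      (points M - UM) \<inter> N = {y \<in> N. \<forall>g\<in>H. g y = 0}"
  proof (intro exI conjI)
    show "openin (tp M) {y \<in> points M. \<pi> y \<in> N}" by (rule morphism_open_vimage[OF pi N(1)])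
    show "x \<in> {y \<in> points M. \<pi> y \<in> N}" using x N by simp
    show "finite {G \<circ> \<pi>}" by simp
    show "\<forall>g\<in>{G \<circ> \<pi>}. holo M {y \<in> points M. \<pi> y \<in> N} g"
      using morphism_holo_vimage[OF pi N(1,3)] by simp
    show "(points M - UM) \<inter> {y \<in> points M. \<pi> y \<in> N} = {y \<in> {y \<in> points M. \<pi> y \<in> N}. \<forall>g\<in>{G \<circ> \<pi>}. g y = 0}"
      using G unfolding UM_def by auto
  qed
qed blast

text \<open>The local homogeneous coordinates from \<open>Y_local\<close>, pulled back by \<pi>,
  describe the map near every point; they do not all vanish on \<open>UM\<close>, which is
  dense.\<close>

lemma birational: "birational_to_P2 M fM UM V0"
  unfolding birational_to_P2_def
proof (intro conjI ballI UM_zariski V0_zariski iso_fM)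
  fix x assume x: "x \<in> points M"
  obtain N G g1 g2 g3 where N: "openin (tp Bl3_mod_T6) N" "\<pi> x \<in> N"
    "holo Bl3_mod_T6 N g1" "holo Bl3_mod_T6 N g2" "holo Bl3_mod_T6 N g3"
    and g: "\<forall>z\<in>O0. tau z \<in> N \<longrightarrow> g1 (tau z) \<noteq> 0 \<and> hpt (g1 (tau z), g2 (tau z), g3 (tau z)) = aff1 (R z)"
    using Y_local[OF morphism_points[OF pi x]] by metis
  have gU: "g1 (\<pi> y) \<noteq> 0 \<and> fM y = hpt (g1 (\<pi> y), g2 (\<pi> y), g3 (\<pi> y))" if y: "y \<in> UM" "\<pi> y \<in> N" for y
  proof -
    obtain z where "z \<in> O0" "\<pi> y = tau z" using y(1) unfolding UM_def by auto
    then show ?thesis using g[rule_format, of z] y(2) by (simp add: fM_def kY_tau)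
  qed
  have o: "openin (tp M) {y \<in> points M. \<pi> y \<in> N}" by (rule morphism_open_vimage[OF pi N(1)])
  show "\<exists>N g1 g2 g3. openin (tp M) N \<and> x \<in> N \<and> holo M N g1 \<and> holo M N g2 \<and> holo M N g3 \<and>
        N \<subseteq> tp M closure_of {y \<in> N. (g1 y, g2 y, g3 y) \<noteq> 0} \<and>
        (\<forall>y\<in>N \<inter> UM. (g1 y, g2 y, g3 y) \<noteq> 0 \<longrightarrow> fM y = hpt (g1 y, g2 y, g3 y))"
  proof (intro exI conjI)
    show "openin (tp M) {y \<in> points M. \<pi> y \<in> N}" by (rule o)
    show "x \<in> {y \<in> points M. \<pi> y \<in> N}" using x N by simp
    show "holo M {y \<in> points M. \<pi> y \<in> N} (g1 \<circ> \<pi>)" "holo M {y \<in> points M. \<pi> y \<in> N} (g2 \<circ> \<pi>)"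
      "holo M {y \<in> points M. \<pi> y \<in> N} (g3 \<circ> \<pi>)"
      by (rule morphism_holo_vimage[OF pi N(1)], rule N)+
    show "{y \<in> points M. \<pi> y \<in> N} \<subseteq> tp M closure_of
      {y \<in> {y \<in> points M. \<pi> y \<in> N}. ((g1 \<circ> \<pi>) y, (g2 \<circ> \<pi>) y, (g3 \<circ> \<pi>) y) \<noteq> 0}"
    proof (intro subsetI in_closureI)
      fix y S assume y: "y \<in> {y \<in> points M. \<pi> y \<in> N}" and S: "openin (tp M) S" "y \<in> S"
      obtain y' where "y' \<in> UM" "y' \<in> S \<inter> {y \<in> points M. \<pi> y \<in> N}"
        using UM_dense[OF openin_Int[OF S(1) o], of y] S(2) y by blast
      then show "\<exists>y\<in>{y \<in> {y \<in> points M. \<pi> y \<in> N}. ((g1 \<circ> \<pi>) y, (g2 \<circ> \<pi>) y, (g3 \<circ> \<pi>) y) \<noteq> 0}. y \<in> S"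
        using gU[of y'] by (intro bexI[of _ y']) (simp_all add: zero_prod_def)
    qed simp
    show "\<forall>y\<in>{y \<in> points M. \<pi> y \<in> N} \<inter> UM. ((g1 \<circ> \<pi>) y, (g2 \<circ> \<pi>) y, (g3 \<circ> \<pi>) y) \<noteq> 0 \<longrightarrow>
        fM y = hpt ((g1 \<circ> \<pi>) y, (g2 \<circ> \<pi>) y, (g3 \<circ> \<pi>) y)"
      using gU by simp
  qed
qed

text \<open>By \<open>R_curve\<close> the two sets agree on \<open>UM\<close>, and the link is
  closed, so it remains to approximate its points from \<open>UM\<close>. The node u = v = 0 is
  already there. Elsewhere on the cycle the quotient is smooth, hence \<pi> is a local isomorphism,
  and nearby points of the same edge lie in \<open>O0\<close>.\<close>

lemma link: "strict_transform M fM UM (curve cubic1) = santos_link M \<pi>"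
proof -
  have e: "fM x \<in> curve cubic1 \<longleftrightarrow> \<pi> x \<in> T6_orbit ` Delta6" if "x \<in> UM" for x
  proof -
    obtain z where "z \<in> O0" "\<pi> x = tau z" using \<open>x \<in> UM\<close> unfolding UM_def by auto
    then show ?thesis using R_curve tau_Delta6 by (simp add: fM_def kY_tau)
  qed
  define L where "L = {x \<in> UM. fM x \<in> curve cubic1}"
  have L: "L = {x \<in> UM. \<pi> x \<in> T6_orbit ` Delta6}" unfolding L_def using e by blast
  have "closedin (tp M) (santos_link M \<pi>)"
  proof -
    have "points M - santos_link M \<pi> = {x \<in> points M. \<pi> x \<in> points Bl3_mod_T6 - T6_orbit ` Delta6}"
      unfolding santos_link_def using morphism_points[OF pi] by auto
    then have "openin (tp M) (points M - santos_link M \<pi>)"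
      using morphism_open_vimage[OF pi Delta6_closed] by simp
    moreover have "santos_link M \<pi> \<subseteq> points M" unfolding santos_link_def by simp
    ultimately show ?thesis unfolding closedin_def by simp
  qed
  moreover have "L \<subseteq> santos_link M \<pi>" unfolding L santos_link_def UM_def by auto
  ultimately have 1: "tp M closure_of L \<subseteq> santos_link M \<pi>" by (intro closure_of_minimal)
  have "x \<in> tp M closure_of L" if x: "x \<in> santos_link M \<pi>" for x
  proof (rule in_closureI)
    show xM: "x \<in> points M" using x unfolding santos_link_def by simp
    fix S assume S: "openin (tp M) S" "x \<in> S"
    obtain a b where ab: "\<pi> x = tau (a, b)" using morphism_points[OF pi xM] points_Y by auto
    then have "a * b = 0" using x tau_Delta6 unfolding santos_link_def by simp
    \<comment> \<open>A point of the edge v = 0 other than the node is rotated to the edge u =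
      0.\<close>
    then have "\<exists>v. \<pi> x = tau (0, v)"
    proof (cases "a = 0")
      case False
      then have "rel (a, b) (0, 1 / a)" using \<open>a * b = 0\<close> by (simp add: rel_def)
      then show ?thesis using ab tau_eq by metis
    qed (use ab in blast)
    then obtain v where v: "\<pi> x = tau (0, v)" by blast
    show "\<exists>y\<in>L. y \<in> S"
    proof (cases "v = 0")
      case True
      have "(0, 0) \<in> O0" by (simp add: O0_def s_defs)
      then have "x \<in> L" using x v True xM unfolding L santos_link_def UM_def by auto
      then show ?thesis using S by blast
    next
      case False
      have xs: "x \<in> Ms" unfolding Ms_def using xM v edge_smooth[OF False] by simp
      have o: "openin (tp Bl3_mod_T6) (\<pi> ` (S \<inter> Ms))" by (rule image_open[OF S xs])
      have "open {z. tau z \<in> \<pi> ` (S \<inter> Ms)}" using o openin_Y by blast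
      from open_preimage_pair[OF open_UNIV _ _ this, of "\<lambda>z. (0, snd z)"]
      have o': "open {z :: c2. tau (0, snd z) \<in> \<pi> ` (S \<inter> Ms)}"
        by (simp add: hol2_const hol2_snd')
      \<comment> \<open>Density is applied to a function of the second coordinate alone, so that the
        perturbed point stays on the edge.\<close>
      have P: "hol2 (\<lambda>z. s1 (0, snd z) * dd (0, snd z)) z" for z
        by (intro hol2_mult hol2_compose[of s1 "\<lambda>_. 0"] hol2_compose[of dd "\<lambda>_. 0"] hol2_s1 hol2_dd hol2_const hol2_snd')
      have P0: "s1 (0, snd (0, 0)) * dd (0, snd (0, 0)) \<noteq> 0" by (simp add: s_defs)
      have xv: "(0, v) \<in> {z :: c2. tau (0, snd z) \<in> \<pi> ` (S \<inter> Ms)}" using imageI[of x "S \<inter> Ms" \<pi>] v S(2) xs by simp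
      obtain t :: c2 where t: "t \<in> {z. tau (0, snd z) \<in> \<pi> ` (S \<inter> Ms)}" "s1 (0, snd t) * dd (0, snd t) \<noteq> 0"
        by (rule dense_nonzero[OF P P0 o' xv])
      then obtain y where y: "y \<in> S" "y \<in> Ms" "\<pi> y = tau (0, snd t)" by force
      have "(0, snd t) \<in> O0" using t(2) by (simp add: O0_def)
      then have "y \<in> L" using y tau_Delta6[of "(0, snd t)"] unfolding L UM_Ms by simp
      then show ?thesis using y by blast
    qed
  qed
  then show ?thesis using 1 unfolding strict_transform_def L_def[symmetric] by blast
qed

end

section \<open>Partial derivatives, their continuity and the chain rule\<close>

lemma has_derivative_pd:
  assumes "(f has_derivative (\<lambda>h. a * fst h + b * snd h)) (at z)"
  shows "pd1 f z = a" "pd2 f z = b"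
proof -
  obtain u v where z: "z = (u, v)" by fastforce
  have "((\<lambda>t. (t, v)) has_derivative (\<lambda>h. (h, 0))) (at u)"
    by (auto intro!: derivative_eq_intros)
  from has_derivative_compose[OF this assms[unfolded z]]
  have "((\<lambda>t. f (t, v)) has_field_derivative a) (at u)"
    unfolding has_field_derivative_def by (rule has_derivative_eq_rhs) auto
  then show "pd1 f z = a" unfolding pd1_def z by (simp add: DERIV_imp_deriv)
  have "((\<lambda>t. (u, t)) has_derivative (\<lambda>h. (0, h))) (at v)"
    by (auto intro!: derivative_eq_intros)
  from has_derivative_compose[OF this assms[unfolded z]]
  have "((\<lambda>t. f (u, t)) has_field_derivative b) (at v)"
    unfolding has_field_derivative_def by (rule has_derivative_eq_rhs) auto
  then show "pd2 f z = b" unfolding pd2_def z by (simp add: DERIV_imp_deriv)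
qed

lemma hol2_has_derivative:
  assumes "hol2 f z" shows "(f has_derivative (\<lambda>h. pd1 f z * fst h + pd2 f z * snd h)) (at z)"
proof -
  obtain a b where d: "(f has_derivative (\<lambda>h. a * fst h + b * snd h)) (at z)"
    using assms by (rule hol2E)
  show ?thesis unfolding has_derivative_pd[OF d] by (rule d)
qed

lemma pd_cong:
  assumes "hol2 f z" "open S" "z \<in> S" "\<And>x. x \<in> S \<Longrightarrow> f x = g x"
  shows "pd1 g z = pd1 f z" "pd2 g z = pd2 f z"
  using has_derivative_pd[OF has_derivative_transform_within_open[OF hol2_has_derivative[OF assms(1)] assms(2-4)]]
  by simp_all

lemma pd_compose:
  assumes "hol2 f (g1 z, g2 z)" "hol2 g1 z" "hol2 g2 z"
  shows "pd1 (\<lambda>z. f (g1 z, g2 z)) z = pd1 f (g1 z, g2 z) * pd1 g1 z + pd2 f (g1 z, g2 z) * pd1 g2 z"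
    "pd2 (\<lambda>z. f (g1 z, g2 z)) z = pd1 f (g1 z, g2 z) * pd2 g1 z + pd2 f (g1 z, g2 z) * pd2 g2 z"
proof -
  note d = hol2_has_derivative[OF assms(1)] hol2_has_derivative[OF assms(2)] hol2_has_derivative[OF assms(3)]
  have "((\<lambda>z. f (g1 z, g2 z)) has_derivative
    (\<lambda>h. (pd1 f (g1 z, g2 z) * pd1 g1 z + pd2 f (g1 z, g2 z) * pd1 g2 z) * fst h +
      (pd1 f (g1 z, g2 z) * pd2 g1 z + pd2 f (g1 z, g2 z) * pd2 g2 z) * snd h)) (at z)"
    by (rule has_derivative_eq_rhs[OF has_derivative_compose[OF has_derivative_Pair[OF d(2,3)] d(1)]])
      (auto simp: algebra_simps)
  from has_derivative_pd[OF this]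
  show "pd1 (\<lambda>z. f (g1 z, g2 z)) z = pd1 f (g1 z, g2 z) * pd1 g1 z + pd2 f (g1 z, g2 z) * pd1 g2 z"
    "pd2 (\<lambda>z. f (g1 z, g2 z)) z = pd1 f (g1 z, g2 z) * pd2 g1 z + pd2 f (g1 z, g2 z) * pd2 g2 z" .
qed

text \<open>When the base point moves, the restrictions of f to parallel discs converge uniformly,
  because f is uniformly continuous on a compact ball; by the Weierstrass theorem in one variable
  their derivatives at the centre converge as well. The bound on (c, d) keeps the discs inside that
  ball.\<close>

lemma continuous_on_directional_deriv:
  assumes S: "open S" and f: "\<And>z. z \<in> S \<Longrightarrow> hol2 f z" and cd: "norm (c, d) \<le> 1"
  shows "continuous_on S (\<lambda>z. deriv (\<lambda>t. f (fst z + t * c, snd z + t * d)) 0)"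
proof (rule continuous_at_imp_continuous_on, rule ballI)
  fix z assume "z \<in> S"
  then obtain r' where "r' > 0" "cball z r' \<subseteq> S" using S open_contains_cball_eq by blast
  then obtain r where r: "r > 0" "cball z (2 * r) \<subseteq> S" using that[of "r' / 2"] by simp
  have cf: "continuous_on (cball z (2 * r)) f" using r f by (intro hol2_continuous_on) blast
  then have uc: "uniformly_continuous_on (cball z (2 * r)) f" by (rule compact_uniformly_continuous) simp
  define g where "g w t = f (fst w + t * c, snd w + t * d)" for w t
  have tn: "norm (t * c, t * d) \<le> norm t" for t
  proof -
    have "norm (t * c, t * d) = norm t * norm (c, d)"
      by (simp add: norm_Pair norm_mult power_mult_distrib real_sqrt_mult flip: distrib_left)
    then show ?thesis using cd by (simp add: mult_left_le)
  qed
  have in_ball: "(fst w + t * c, snd w + t * d) \<in> cball z (2 * r)" if "dist w z < r" "t \<in> ball 0 r" for w t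
  proof -
    have "(fst w + t * c, snd w + t * d) = w + (t * c, t * d)" by (cases w) simp
    then have "dist (fst w + t * c, snd w + t * d) w = norm (t * c, t * d)" by (simp add: dist_norm)
    then show ?thesis using dist_triangle[of "(fst w + t * c, snd w + t * d)" z w] tn[of t] that
      by (simp add: dist_commute)
  qed
  have ul: "uniform_limit (ball 0 r) g (g z) (at z)"
    unfolding uniform_limit_iff
  proof (intro allI impI)
    fix e :: real assume "e > 0"
    have "\<exists>\<delta>>0. \<forall>x\<in>cball z (2 * r). \<forall>y\<in>cball z (2 * r). dist y x < \<delta> \<longrightarrow> dist (f y) (f x) < e"
      using uc \<open>e > 0\<close> unfolding uniformly_continuous_on_def by simp
    then obtain \<delta> where \<delta>: "\<delta> > 0"
      "\<forall>x\<in>cball z (2 * r). \<forall>y\<in>cball z (2 * r). dist y x < \<delta> \<longrightarrow> dist (f y) (f x) < e"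
      by (elim exE conjE)
    have "\<forall>\<^sub>F w in at z. dist w z < min \<delta> r"
      using \<delta>(1) r(1) by (auto simp: eventually_at intro!: exI[of _ "min \<delta> r"])
    then show "\<forall>\<^sub>F w in at z. \<forall>t\<in>ball 0 r. dist (g w t) (g z t) < e"
    proof eventually_elim
      case (elim w)
      show ?case
      proof
        fix t assume t: "t \<in> ball (0::complex) r"
        have "dist (fst w + t * c, snd w + t * d) (fst z + t * c, snd z + t * d) = dist w z"
          by (cases w; cases z) (simp add: dist_Pair_Pair)
        then show "dist (g w t) (g z t) < e"
          unfolding g_def using elim t r(1) by (intro \<delta>(2)[rule_format] in_ball) simp_all
      qed
    qed
  qed
  have gh: "g w holomorphic_on ball 0 r" if "dist w z < r" for w
    unfolding holomorphic_on_def
  proof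
    fix t assume "t \<in> ball (0::complex) r"
    then have "hol2 f (fst w + t * c, snd w + t * d)"
      by (intro f subsetD[OF r(2)] in_ball[OF that])
    from hol2_line[OF this] have "g w field_differentiable at t" unfolding g_def .
    then show "g w field_differentiable at t within ball 0 r" by (rule field_differentiable_at_within)
  qed
  have ev: "\<forall>\<^sub>F w in at z. g w holomorphic_on ball 0 r"
    unfolding eventually_at using r(1) gh by (intro exI[of _ r]) simp
  have "((\<lambda>w. (deriv ^^ 1) (g w) 0) \<longlongrightarrow> (deriv ^^ 1) (g z) 0) (at z)"
    by (rule higher_deriv_complex_uniform_limit[OF ul ev]) (use r(1) in auto)
  then show "isCont (\<lambda>z. deriv (\<lambda>t. f (fst z + t * c, snd z + t * d)) 0) z"
    unfolding isCont_def g_def by simp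
qed

lemma continuous_on_pd:
  assumes S: "open S" and f: "\<And>z. z \<in> S \<Longrightarrow> hol2 f z"
  shows "continuous_on S (pd1 f)" "continuous_on S (pd2 f)"
proof -
  have d: "((\<lambda>t. f (fst z + t * c, snd z + t * d)) has_field_derivative (pd1 f z * c + pd2 f z * d)) (at 0)"
    if "z \<in> S" for z c d
  proof -
    have h: "((\<lambda>t. (fst z + t * c, snd z + t * d)) has_derivative (\<lambda>h. (h * c, h * d))) (at 0)"
      by (auto intro!: derivative_eq_intros)
    have "(f has_derivative (\<lambda>h. pd1 f z * fst h + pd2 f z * snd h)) (at (fst z + 0 * c, snd z + 0 * d))"
      using hol2_has_derivative[OF f[OF that]] by simp
    from has_derivative_compose[OF h this] show ?thesis
      unfolding has_field_derivative_def by (rule has_derivative_eq_rhs) (auto simp: algebra_simps)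
  qed
  have 1: "deriv (\<lambda>t. f (fst z + t * 1, snd z + t * 0)) 0 = pd1 f z"
    and 2: "deriv (\<lambda>t. f (fst z + t * 0, snd z + t * 1)) 0 = pd2 f z" if "z \<in> S" for z
    using DERIV_imp_deriv[OF d[OF that, of 1 0]] DERIV_imp_deriv[OF d[OF that, of 0 1]] by simp_all
  show "continuous_on S (pd1 f)"
    using continuous_on_directional_deriv[OF S f, of 1 0] by (simp add: norm_Pair 1[simplified] cong: continuous_on_cong)
  show "continuous_on S (pd2 f)"
    using continuous_on_directional_deriv[OF S f, of 0 1] by (simp add: norm_Pair 2[simplified] cong: continuous_on_cong)
qed

section \<open>Coordinates on the blow-up and lifts of the projection\<close>

lemma presheaf_Bl3: "presheaf Bl3"
  unfolding Bl3_def by (intro presheaf_coinduced presheaf_C2)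

lemma morphism_cc: "morphism C2 Bl3 cc"
  unfolding morphism_def
proof (intro conjI allI impI)
  have "cc z \<in> points Bl3" for z unfolding points_Bl3_charts using cc_bl_charts by blast
  moreover have "open {z. cc z \<in> S}" if "openin (tp Bl3) S" for S
    using that cc_bl_charts unfolding openin_Bl3 by blast
  ultimately show "continuous_map (tp C2) (tp Bl3) cc"
    unfolding continuous_map_def by (simp add: tp_C2)
next
  fix V g assume "openin (tp Bl3) V \<and> holo Bl3 V g"
  then have "holo C2 {x. cc x \<in> V} (g \<circ> cc)" using cc_bl_charts unfolding holo_Bl3 by blast
  then show "holo C2 {x \<in> points C2. cc x \<in> V} (g \<circ> cc)" by (simp add: tp_C2)
qed

lemma cc_inj: "cc z = cc z' \<Longrightarrow> z = z'"
proof -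
  assume e: "cc z = cc z'"
  obtain u v where z: "z = (u, v)" by fastforce
  obtain u' v' where z': "z' = (u', v')" by fastforce
  have "hpt (1, u * v, u) = hpt (1, u' * v', u')" "hpt (u * v, 1, v) = hpt (u' * v', 1, v')"
    using e unfolding z z' cc_def prod.case prod.inject by blast+
  then have "u = u'" "v = v'" unfolding hpt_eq by auto
  then show ?thesis by (simp add: z z')
qed

text \<open>The coordinates (X/Z, Y/Z) of the blown-down point. On the chart \<open>cc\<close> they
  are (1/u, v) where u is non-zero.\<close>

definition aff3_coord :: "c3 set \<times> c3 set \<Rightarrow> c2" where
  "aff3_coord x = inv_into UNIV aff3 (fst x)"

lemma aff3_coord: "w \<noteq> 0 \<Longrightarrow> aff3_coord (hpt (x, y, w), q) = (x / w, y / w)"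
  unfolding aff3_coord_def fst_conv
  using aff3_eq[of "(x / w, y / w)" x y w] inv_f_f[OF inj_aff(3), of "(x / w, y / w)"] by simp

lemma range_aff3: "hpt (x, y, w) \<in> range aff3 \<longleftrightarrow> w \<noteq> 0"
proof -
  have "hpt (x, y, w) \<in> range aff3 \<longleftrightarrow> (\<exists>z. aff3 z = hpt (x, y, w))" by auto
  then show ?thesis unfolding aff3_eq by simp
qed

lemma hol2_aff3_coord_aux:
  assumes p: "\<And>z. p z = (hpt (X z, Y z, Z z), q z)" and h: "\<And>z. hol2 X z" "\<And>z. hol2 Y z" "\<And>z. hol2 Z z"
    and z: "fst (p z) \<in> range aff3"
  shows "hol2 (\<lambda>z. fst (aff3_coord (p z))) z" "hol2 (\<lambda>z. snd (aff3_coord (p z))) z"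
proof -
  have Z: "Z z \<noteq> 0" using z unfolding p fst_conv range_aff3 .
  have o: "open {z. Z z \<noteq> 0}" using open_hol2_neq[OF open_UNIV h(3)] by simp
  have q: "hol2 (\<lambda>z. X z / Z z) z" "hol2 (\<lambda>z. Y z / Z z) z" by (intro hol2_divide h Z)+
  show "hol2 (\<lambda>z. fst (aff3_coord (p z))) z"
    by (rule hol2_transform[OF q(1) o]) (simp_all add: p aff3_coord Z)
  show "hol2 (\<lambda>z. snd (aff3_coord (p z))) z"
    by (rule hol2_transform[OF q(2) o]) (simp_all add: p aff3_coord Z)
qed

lemma hol2_aff3_coord:
  assumes "p \<in> bl_charts" "fst (p z) \<in> range aff3"
  shows "hol2 (\<lambda>z. fst (aff3_coord (p z))) z \<and> hol2 (\<lambda>z. snd (aff3_coord (p z))) z"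
proof -
  have h: "hol2 (\<lambda>z. fst z * snd z) z" for z by (intro hol2_mult hol2_fst hol2_snd)
  note a = hol2_aff3_coord_aux[of p, OF _ _ _ _ assms(2)]
  from assms(1) consider
    "p = (\<lambda>z. (hpt (1, fst z * snd z, fst z), hpt (fst z * snd z, 1, snd z)))"
    | "p = (\<lambda>z. (hpt (fst z * snd z, 1, snd z), hpt (1, fst z * snd z, fst z)))"
    | "p = (\<lambda>z. (hpt (fst z, 1, fst z * snd z), hpt (snd z, fst z * snd z, 1)))"
    | "p = (\<lambda>z. (hpt (snd z, fst z * snd z, 1), hpt (fst z, 1, fst z * snd z)))"
    | "p = (\<lambda>z. (hpt (fst z * snd z, fst z, 1), hpt (1, snd z, fst z * snd z)))"
    | "p = (\<lambda>z. (hpt (1, snd z, fst z * snd z), hpt (fst z * snd z, fst z, 1)))"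
    unfolding bl_charts_def case_prod_unfold by blast
  then show ?thesis
  proof cases
    case 1 show ?thesis by (intro conjI a[of "\<lambda>_. 1" "\<lambda>z. fst z * snd z" fst]) (simp_all add: 1 h hol2_const hol2_fst' hol2_snd')
  next
    case 2 show ?thesis by (intro conjI a[of "\<lambda>z. fst z * snd z" "\<lambda>_. 1" snd]) (simp_all add: 2 h hol2_const hol2_fst' hol2_snd')
  next
    case 3 show ?thesis by (intro conjI a[of fst "\<lambda>_. 1" "\<lambda>z. fst z * snd z"]) (simp_all add: 3 h hol2_const hol2_fst' hol2_snd')
  next
    case 4 show ?thesis by (intro conjI a[of snd "\<lambda>z. fst z * snd z" "\<lambda>_. 1"]) (simp_all add: 4 h hol2_const hol2_fst' hol2_snd')
  next
    case 5 show ?thesis by (intro conjI a[of "\<lambda>z. fst z * snd z" fst "\<lambda>_. 1"]) (simp_all add: 5 h hol2_const hol2_fst' hol2_snd')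
  next
    case 6 show ?thesis by (intro conjI a[of "\<lambda>_. 1" snd "\<lambda>z. fst z * snd z"]) (simp_all add: 6 h hol2_const hol2_fst' hol2_snd')
  qed
qed

definition aff3_domain :: "(c3 set \<times> c3 set) set" where
  "aff3_domain = {x \<in> points Bl3. fst x \<in> range aff3}"

lemma aff3_domain:
  "openin (tp Bl3) aff3_domain" "holo Bl3 aff3_domain (fst \<circ> aff3_coord)" "holo Bl3 aff3_domain (snd \<circ> aff3_coord)"
proof -
  have "open {z. p z \<in> aff3_domain}" if p: "p \<in> bl_charts" for p
  proof -
    have "p z \<in> points Bl3" for z unfolding points_Bl3_charts using p by blast
    then have e: "{z. p z \<in> aff3_domain} = {z. fst (p z) \<in> range aff3}" unfolding aff3_domain_def by simp
    have "open {z::c2. fst z * snd z \<noteq> 0}"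
      using open_hol2_neq[OF open_UNIV, of "\<lambda>z. fst z * snd z"] by (simp add: hol2_mult hol2_fst' hol2_snd')
    then show ?thesis
      unfolding e using p unfolding bl_charts_def case_prod_unfold
      by (elim insertE emptyE) (simp_all add: range_aff3 open_fst_neq del: mult_eq_0_iff)
  qed
  moreover have "aff3_domain \<subseteq> (\<Union>p\<in>bl_charts. range p)"
    unfolding aff3_domain_def points_Bl3_charts by blast
  ultimately show "openin (tp Bl3) aff3_domain" unfolding openin_Bl3 by blast
  show "holo Bl3 aff3_domain (fst \<circ> aff3_coord)" "holo Bl3 aff3_domain (snd \<circ> aff3_coord)"
    unfolding holo_Bl3 holo_C2 comp_def using hol2_aff3_coord by (simp_all add: aff3_domain_def)
qed

lemma chart_coords:
  assumes c: "chart X p W" and X: "presheaf X" and S: "openin (tp X) S" "holo X S (fst \<circ> k)" "holo X S (snd \<circ> k)"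
  shows "open {z \<in> W. p z \<in> S}" "\<And>z. z \<in> W \<Longrightarrow> p z \<in> S \<Longrightarrow> hol2 (\<lambda>z. fst (k (p z))) z"
    "\<And>z. z \<in> W \<Longrightarrow> p z \<in> S \<Longrightarrow> hol2 (\<lambda>z. snd (k (p z))) z"
proof -
  have W: "open W" and oW: "openin (tp C2) W" and oi: "openin (tp X) (p ` W)"
    and iso: "isomorphism (restrict_space C2 W) (restrict_space X (p ` W)) p"
    using c unfolding chart_def by (simp_all add: tp_C2)
  have m: "morphism (restrict_space C2 W) (restrict_space X (p ` W)) p"
    using isomorphismE[OF iso oW oi] by metis
  have o: "openin (tp X) (S \<inter> p ` W)" "S \<inter> p ` W \<subseteq> p ` W" using S oi by blast+
  have e: "{z \<in> W. p z \<in> S \<inter> p ` W} = {z \<in> W. p z \<in> S}" by blast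
  show "open {z \<in> W. p z \<in> S}" using morphismD(2)[OF m oW oi o] unfolding e by (simp add: tp_C2)
  have "holo X (S \<inter> p ` W) (fst \<circ> k)" "holo X (S \<inter> p ` W) (snd \<circ> k)"
    by (rule presheaf_sub[OF X _ S(1) o(1)], rule S, simp)+
  note h = this[THEN morphismD(3)[OF m oW oi o], unfolded e holo_C2 comp_def]
  show "\<And>z. z \<in> W \<Longrightarrow> p z \<in> S \<Longrightarrow> hol2 (\<lambda>z. fst (k (p z))) z"
    "\<And>z. z \<in> W \<Longrightarrow> p z \<in> S \<Longrightarrow> hol2 (\<lambda>z. snd (k (p z))) z"
    by (rule bspec[OF h(1)], blast) (rule bspec[OF h(2)], blast)
qed

lemma chart_inverse:
  assumes c: "chart X p W"
  shows "openin (tp X) (p ` W)" "holo X (p ` W) (fst \<circ> inv_into W p)" "holo X (p ` W) (snd \<circ> inv_into W p)" "inj_on p W"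
proof -
  have W: "open W" and oW: "openin (tp C2) W" and oi: "openin (tp X) (p ` W)"
    and iso: "isomorphism (restrict_space C2 W) (restrict_space X (p ` W)) p"
    using c unfolding chart_def by (simp_all add: tp_C2)
  have m: "morphism (restrict_space X (p ` W)) (restrict_space C2 W) (inv_into W p)"
    using isomorphismE[OF iso oW oi] by metis
  show "openin (tp X) (p ` W)" by fact
  show "holo X (p ` W) (fst \<circ> inv_into W p)" "holo X (p ` W) (snd \<circ> inv_into W p)"
    using morphism_to_C2[OF oi W m] by simp_all
  show "inj_on p W" using iso unfolding isomorphism_def points_restrict[OF oW] by (simp add: bij_betw_def)
qed


context sixth_root
begin

lemma psi_kY: "y \<in> tau ` O0 \<Longrightarrow> psi (kY y) = y"
  using psi_R[OF _ refl] by (auto simp: kY_tau)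

end

context desing
begin

lemma theta_coords:
  "holo M UM (fst \<circ> (kY \<circ> \<pi>))" "holo M UM (snd \<circ> (kY \<circ> \<pi>))"
  "inj_on (kY \<circ> \<pi>) UM" "\<And>x. x \<in> UM \<Longrightarrow> kY (\<pi> x) \<in> W0"
  "\<And>S. openin (tp M) S \<Longrightarrow> S \<subseteq> UM \<Longrightarrow> open ((kY \<circ> \<pi>) ` S)"
  "\<And>S. open S \<Longrightarrow> S \<subseteq> W0 \<Longrightarrow> openin (tp M) {x \<in> UM. kY (\<pi> x) \<in> S}"
proof -
  have oW: "openin (tp C2) W0" by (simp add: tp_C2 open_W0)
  obtain g where g: "morphism (restrict_space M UM) (restrict_space C2 W0) (kY \<circ> \<pi>)"
    "\<And>x. x \<in> UM \<Longrightarrow> (kY \<circ> \<pi>) x \<in> W0" "\<And>x. x \<in> UM \<Longrightarrow> g ((kY \<circ> \<pi>) x) = x"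
    using isomorphismE[OF iso_UM(2,1) oW] by metis
  show "holo M UM (fst \<circ> (kY \<circ> \<pi>))" "holo M UM (snd \<circ> (kY \<circ> \<pi>))"
    by (rule morphism_to_C2[OF iso_UM(1) open_W0 g(1)])+
  show "inj_on (kY \<circ> \<pi>) UM" using g(3) by (rule inj_on_inverseI)
  show "\<And>x. x \<in> UM \<Longrightarrow> kY (\<pi> x) \<in> W0" using g(2) by simp
  show "open ((kY \<circ> \<pi>) ` S)" if "openin (tp M) S" "S \<subseteq> UM" for S
    using isomorphism_open_image[OF iso_UM(2,1) oW that] by (simp add: tp_C2)
  show "openin (tp M) {x \<in> UM. kY (\<pi> x) \<in> S}" if "open S" "S \<subseteq> W0" for S
    using morphismD(2)[OF g(1) iso_UM(1) oW, of S] that by (simp add: tp_C2)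
qed

text \<open>When \<phi> is a section of \<open>R\<close>, this map is a local lift of \<pi> to the
  blow-up, of the kind quantified over in \<open>induced_foliation\<close>.\<close>

lemma lift_morphism:
  assumes W: "open W" "W \<subseteq> W0" and h: "\<And>b. b \<in> W \<Longrightarrow> hol2 (\<lambda>b. fst (\<phi> b)) b" "\<And>b. b \<in> W \<Longrightarrow> hol2 (\<lambda>b. snd (\<phi> b)) b"
  shows "morphism (restrict_space M {x \<in> UM. kY (\<pi> x) \<in> W}) Bl3 (\<lambda>x. cc (\<phi> (kY (\<pi> x))))"
proof -
  have oW: "openin (tp C2) W0" "openin (tp C2) W" by (simp_all add: tp_C2 open_W0 W)
  have iso: "isomorphism (restrict_space M {x \<in> UM. (kY \<circ> \<pi>) x \<in> W}) (restrict_space C2 W) (kY \<circ> \<pi>)"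
    by (rule isomorphism_sub(2)[OF iso_UM(2,1) oW(1) presheaf_M presheaf_C2 oW(2) W(2)])
  then have 1: "morphism (restrict_space M {x \<in> UM. (kY \<circ> \<pi>) x \<in> W}) (restrict_space C2 W) (kY \<circ> \<pi>)"
    unfolding isomorphism_def by simp
  have "morphism (restrict_space C2 W) (restrict_space C2 UNIV) \<phi>"
    unfolding morphism_C2_C2[OF W(1) open_UNIV] using h by (simp add: comp_def)
  moreover have "restrict_space C2 UNIV = C2" using restrict_points[of C2] by (simp add: tp_C2)
  ultimately have "morphism (restrict_space C2 W) C2 \<phi>" by simp
  from morphism_compose[OF morphism_compose[OF 1 this] morphism_cc]
  show ?thesis by (simp add: comp_def)
qed

end

section \<open>The pull-back of \<open>H6\<close> is Santos's foliation\<close>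

lemma pulls_backD:
  assumes "pulls_back f U \<G> \<F>" "(p, W, a, b) \<in> \<F>" "(q, W', a', b') \<in> \<G>" "z \<in> W" "p z \<in> U" "f (p z) \<in> q ` W'"
    "h = inv_into W' q \<circ> f \<circ> p"
  shows "a z * (a' (h z) * pd2 (fst \<circ> h) z + b' (h z) * pd2 (snd \<circ> h) z) =
    b z * (a' (h z) * pd1 (fst \<circ> h) z + b' (h z) * pd1 (snd \<circ> h) z)"
  using assms(1)[unfolded pulls_back_def Let_def, rule_format, OF assms(2), unfolded prod.case, rule_format, OF assms(3), unfolded prod.case,
      rule_format, OF assms(4) conjI[OF assms(5,6)]] unfolding assms(7) .

locale santos = desing \<zeta> M \<pi> for \<zeta> and M :: "'m cspace" and \<pi> +
  fixes \<omega> :: complex and \<E> :: "(c3 set \<times> c3 set) local_form set" and \<F> :: "'m local_form set"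
  assumes omega: "\<omega> = \<zeta> - 1"
    and E: "transform_on_Bl3 (E3 \<omega>) \<E>" and F: "induced_foliation M \<pi> \<E> \<F>"
begin

text \<open>At a general point, compose three comparisons: a local lift s pulls \<E> back to \<F>,
  the blow-down pulls \<open>E3\<close> back to \<E>, and \<open>foliation_identity\<close> relates
  \<open>E3\<close> to \<open>H6\<close> through \<open>R\<close>. The determinant \<Delta> of the
  two forms is continuous, so if it were non-zero at z0 it would be non-zero at general points
  nearby.\<close>

lemma pull_back_affine:
  assumes f: "(p, W, a, b) \<in> \<F>" and z0: "z0 \<in> W" "p z0 \<in> UM"
  defines "G \<equiv> \<lambda>z. kY (\<pi> (p z))"
  defines "B \<equiv> \<lambda>z. fst (snd (H6 (1, G z)))" and "C \<equiv> \<lambda>z. snd (snd (H6 (1, G z)))"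
  shows "hol2 (\<lambda>z. fst (G z)) z0" "hol2 (\<lambda>z. snd (G z)) z0" "open {z \<in> W. p z \<in> UM}"
    "a z0 * (B z0 * pd2 (\<lambda>z. fst (G z)) z0 + C z0 * pd2 (\<lambda>z. snd (G z)) z0) =
     b z0 * (B z0 * pd1 (\<lambda>z. fst (G z)) z0 + C z0 * pd1 (\<lambda>z. snd (G z)) z0)"
proof -
  have fol: "foliation M \<F>" using F unfolding induced_foliation_def by simp
  have ch: "chart M p W" and ha: "\<And>z. z \<in> W \<Longrightarrow> hol2 a z" "\<And>z. z \<in> W \<Longrightarrow> hol2 b z"
    using fol f unfolding foliation_def holo_C2 by (auto split: prod.splits)
  define W1 where "W1 = {z \<in> W. p z \<in> UM}"
  note cc1 = chart_coords[OF ch presheaf_M iso_UM(1) theta_coords(1,2), unfolded comp_def]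
  show oW1: "open {z \<in> W. p z \<in> UM}" by (rule cc1(1))
  have hG: "hol2 (\<lambda>z. fst (G z)) z" "hol2 (\<lambda>z. snd (G z)) z" if "z \<in> W1" for z
  proof -
    have z: "z \<in> W" "p z \<in> UM" using that by (simp_all add: W1_def)
    show "hol2 (\<lambda>z. fst (G z)) z" unfolding G_def by (rule cc1(2)[OF z])
    show "hol2 (\<lambda>z. snd (G z)) z" unfolding G_def by (rule cc1(3)[OF z])
  qed
  have z0W: "z0 \<in> W1" using z0 by (simp add: W1_def)
  show "hol2 (\<lambda>z. fst (G z)) z0" "hol2 (\<lambda>z. snd (G z)) z0" by (rule hG[OF z0W])+
  have hBC: "hol2 B z" "hol2 C z" if "z \<in> W1" for z
  proof -
    have "B = (\<lambda>z. 5 * (fst (G z))\<^sup>2 - 3 * fst (G z) * snd (G z) - fst (G z) + snd (G z))"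
      "C = (\<lambda>z. 2 * (fst (G z))\<^sup>2 - snd (G z))"
      unfolding B_def C_def H6_def by (auto simp: case_prod_unfold)
    then show "hol2 B z" "hol2 C z" by (simp_all only:) (intro hol2 hG[OF that])+
  qed
  define \<Delta> where "\<Delta> z = a z * (B z * pd2 (\<lambda>z. fst (G z)) z + C z * pd2 (\<lambda>z. snd (G z)) z) -
     b z * (B z * pd1 (\<lambda>z. fst (G z)) z + C z * pd1 (\<lambda>z. snd (G z)) z)" for z
  have oW: "open W1" using oW1 by (simp add: W1_def)
  have c\<Delta>: "continuous_on W1 \<Delta>"
    unfolding \<Delta>_def
    by (intro continuous_intros continuous_on_pd[OF oW] hol2_continuous_on hG hBC ha) (simp_all add: W1_def)
  have injG: "inj_on G W1"
  proof (rule inj_onI)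
    fix x y assume "x \<in> W1" "y \<in> W1" "G x = G y"
    then have "p x = p y" using inj_onD[OF theta_coords(3), of "p x" "p y"] unfolding W1_def G_def by simp
    then show "x = y" using inj_onD[OF chart_inverse(4)[OF ch]] \<open>x \<in> W1\<close> \<open>y \<in> W1\<close> unfolding W1_def by simp
  qed
  have openG: "open (G ` S)" if S: "open S" "S \<subseteq> W1" for S
  proof -
    have iso: "isomorphism (restrict_space C2 W) (restrict_space M (p ` W)) p" and "open W" "openin (tp M) (p ` W)"
      using ch unfolding chart_def by simp_all
    then have o: "openin (tp C2) W" "openin (tp M) (p ` W)" "openin (tp C2) S" using S by (simp_all add: tp_C2)
    have "S \<subseteq> W" using S(2) by (auto simp: W1_def)
    then have "openin (tp M) (p ` S)" by (rule isomorphism_open_image[OF iso o])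
    moreover have "p ` S \<subseteq> UM" using S unfolding W1_def by blast
    ultimately have "open ((kY \<circ> \<pi>) ` p ` S)" by (rule theta_coords(5))
    then show ?thesis by (simp add: image_comp comp_def G_def)
  qed
  have GW0: "G z \<in> W0" if "z \<in> W1" for z using that theta_coords(4) unfolding G_def W1_def by simp
  have "\<Delta> z0 = 0"
  proof (rule ccontr)
    assume \<Delta>0: "\<Delta> z0 \<noteq> 0"
    obtain W2 \<phi> where W2: "open W2" "G z0 \<in> W2" and
      \<phi>: "\<And>b. b \<in> W2 \<Longrightarrow> \<phi> b \<in> O0" "\<And>b. b \<in> W2 \<Longrightarrow> R (\<phi> b) = b"
        "\<And>b. b \<in> W2 \<Longrightarrow> hol2 (\<lambda>b. fst (\<phi> b)) b" "\<And>b. b \<in> W2 \<Longrightarrow> hol2 (\<lambda>b. snd (\<phi> b)) b"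
      using local_section_W0[OF GW0[OF z0W]] by metis
    have W2W0: "W2 \<subseteq> W0" using R_W0[OF \<phi>(1)] \<phi>(2) by force
    \<comment> \<open>The section \<phi> of \<open>R\<close> over W2 lifts \<pi> on NM to the
      blow-up, through the chart \<open>cc\<close>.\<close>
    define NM where "NM = {x \<in> UM. kY (\<pi> x) \<in> W2}"
    define s where "s x = cc (\<phi> (kY (\<pi> x)))" for x
    have sorb: "T6_orbit (s x) = \<pi> x" if "x \<in> NM" for x
    proof -
      have "T6_orbit (s x) = tau (\<phi> (kY (\<pi> x)))" by (simp add: s_def tau_def)
      also have "\<dots> = psi (kY (\<pi> x))" using psi_R[OF \<phi>(1,2)] that by (simp add: NM_def)
      also have "\<dots> = \<pi> x" using psi_kY that by (simp add: NM_def UM_def)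
      finally show ?thesis .
    qed
    have pb_s: "pulls_back s NM \<E> \<F>"
    proof -
      have "openin (tp M) NM" unfolding NM_def by (rule theta_coords(6)[OF W2(1) W2W0])
      moreover have "morphism (restrict_space M NM) Bl3 s"
        unfolding NM_def s_def by (rule lift_morphism[OF W2(1) W2W0 \<phi>(3,4)])
      ultimately show ?thesis using F sorb unfolding induced_foliation_def by blast
    qed
    define \<psi> where "\<psi> z = \<phi> (G z)" for z
    have sp: "s (p z) = cc (\<psi> z)" for z by (simp add: s_def \<psi>_def G_def)
    define W3 where "W3 = {z \<in> W1. G z \<in> W2}"
    have oW3: "open W3" unfolding W3_def by (rule open_preimage_pair[OF oW hG W2(1)])
    have h\<psi>: "hol2 (\<lambda>z. fst (\<psi> z)) z" "hol2 (\<lambda>z. snd (\<psi> z)) z" if "z \<in> W3" for z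
    proof -
      have z: "z \<in> W1" "G z \<in> W2" using that by (simp_all add: W3_def)
      have "hol2 (\<lambda>z. fst (\<phi> (fst (G z), snd (G z)))) z" "hol2 (\<lambda>z. snd (\<phi> (fst (G z), snd (G z)))) z"
        by (rule hol2_compose[OF _ hG[OF z(1)]]; simp add: \<phi> z)+
      then show "hol2 (\<lambda>z. fst (\<psi> z)) z" "hol2 (\<lambda>z. snd (\<psi> z)) z" by (simp_all add: \<psi>_def)
    qed
    have R\<psi>: "R (\<psi> z) = G z" "\<psi> z \<in> O0" if "z \<in> W3" for z using that \<phi>(1,2) by (simp_all add: W3_def \<psi>_def)
    have folE: "foliation Bl3 \<E>" and pb_fst: "pulls_back fst {x \<in> points Bl3. fst x \<notin> coord_points} (plane_foliation (E3 \<omega>)) \<E>"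
      using E unfolding transform_on_Bl3_def by simp_all
    have ccB: "cc z \<in> points Bl3" for z unfolding points_Bl3_charts using cc_bl_charts by blast
    obtain p6 W6 a6 b6 where e6: "(p6, W6, a6, b6) \<in> \<E>" "cc (\<psi> z0) \<in> p6 ` W6"
    proof -
      have "cc (\<psi> z0) \<in> (\<Union>(p, W, a, b)\<in>\<E>. p ` W)" using folE ccB unfolding foliation_def by simp
      then show thesis using that by auto
    qed
    have ch6: "chart Bl3 p6 W6" and nz6: "\<And>z. z \<in> W6 \<Longrightarrow> \<forall>\<^sub>F w in at z. a6 w \<noteq> 0 \<or> b6 w \<noteq> 0"
      using folE e6(1) unfolding foliation_def by (auto split: prod.splits)
    define q6 where "q6 = inv_into W6 p6"
    note q6 = chart_inverse[OF ch6, folded q6_def]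
    have p6q6: "p6 (q6 x) = x" "q6 x \<in> W6" if "x \<in> p6 ` W6" for x
      using that by (simp_all add: q6_def f_inv_into_f inv_into_into)
    define Tc where "Tc = {w. cc w \<in> p6 ` W6}"
    have oTc: "open Tc" using q6(1) cc_bl_charts unfolding Tc_def openin_Bl3 by blast
    have hq: "hol2 (\<lambda>w. fst (q6 (cc w))) w" "hol2 (\<lambda>w. snd (q6 (cc w))) w" if "w \<in> Tc" for w
      using q6(2,3) cc_bl_charts that unfolding Tc_def holo_Bl3 holo_C2 comp_def by blast+
    define k6 where "k6 = inv_into W6 p6 \<circ> s \<circ> p"
    have k6: "k6 z = q6 (cc (\<psi> z))" for z by (simp add: k6_def q6_def sp)
    define O2 where "O2 = {z \<in> W3. \<psi> z \<in> Tc}"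
    have oO2: "open O2" unfolding O2_def by (rule open_preimage_pair[OF oW3 h\<psi> oTc])
    have hk: "hol2 (\<lambda>z. fst (k6 z)) z" "hol2 (\<lambda>z. snd (k6 z)) z" if "z \<in> O2" for z
    proof -
      have z: "z \<in> W3" "\<psi> z \<in> Tc" using that by (simp_all add: O2_def)
      have "hol2 (\<lambda>z. fst (q6 (cc (fst (\<psi> z), snd (\<psi> z))))) z" "hol2 (\<lambda>z. snd (q6 (cc (fst (\<psi> z), snd (\<psi> z))))) z"
        by (rule hol2_compose[OF _ h\<psi>[OF z(1)]]; simp add: hq z)+
      then show "hol2 (\<lambda>z. fst (k6 z)) z" "hol2 (\<lambda>z. snd (k6 z)) z" by (simp_all add: k6)
    qed
    have z0O2: "z0 \<in> O2" using z0W W2(2) e6(2) by (simp add: O2_def W3_def Tc_def)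
    have k6W: "k6 z \<in> W6" "p6 (k6 z) = cc (\<psi> z)" if "z \<in> O2" for z
      using that p6q6 by (simp_all add: O2_def Tc_def k6)
    have injk: "z = z0" if "z \<in> O2" "k6 z = k6 z0" for z
    proof -
      have "cc (\<psi> z) = cc (\<psi> z0)" using k6W(2)[OF that(1)] k6W(2)[OF z0O2] that(2) by simp
      then have "\<psi> z = \<psi> z0" by (rule cc_inj)
      then have "G z = G z0" using R\<psi>(1)[of z] R\<psi>(1)[of z0] that z0O2 by (simp add: O2_def)
      then show ?thesis using inj_onD[OF injG] that(1) z0W by (simp add: O2_def W3_def)
    qed
    obtain A where A: "open A" "k6 z0 \<in> A" "\<And>w. w \<in> A \<Longrightarrow> w \<noteq> k6 z0 \<Longrightarrow> a6 w \<noteq> 0 \<or> b6 w \<noteq> 0"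
      using nz6[OF k6W(1)[OF z0O2]] unfolding eventually_at_topological by blast
    define O3 where "O3 = {z \<in> O2. k6 z \<in> A}"
    have oO3: "open O3" unfolding O3_def by (rule open_preimage_pair[OF oO2 hk A(1)])
    define O4 where "O4 = O3 \<inter> {z \<in> W1. \<Delta> z \<noteq> 0}"
    have "open {z \<in> W1. \<Delta> z \<noteq> 0}"
    proof -
      have "open (W1 \<inter> \<Delta> -` (- {0}))" by (rule continuous_open_preimage[OF c\<Delta> oW]) (simp add: open_Compl)
      moreover have "W1 \<inter> \<Delta> -` (- {0}) = {z \<in> W1. \<Delta> z \<noteq> 0}" by auto
      ultimately show ?thesis by simp
    qed
    then have oO4: "open O4" unfolding O4_def using oO3 by (intro open_Int)
    have z0O4: "z0 \<in> O4" using z0O2 A(2) \<Delta>0 z0W by (simp add: O4_def O3_def)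
    have "O4 \<subseteq> W1" by (auto simp: O4_def)
    from openG[OF oO4 this] have oG4: "open (G ` O4)" .
    \<comment> \<open>P b is non-zero when b lies off the first cubic, so that its lift has uv
      non-zero, and the first coordinate of b differs from that of G z0, which excludes the point z0
      where the local form of \<E> might vanish.\<close>
    define P where "P b = cubic1 (1, b) * (fst b - fst (G z0))" for b
    have hP: "hol2 P b" for b unfolding P_def by (intro hol2_mult hol2_cubic hol2_diff hol2_fst hol2_const)
    obtain c where "P c \<noteq> 0"
    proof -
      define y where "y = fst (G z0) + 1"
      \<comment> \<open>With y fixed, the values at z = 1 and z = -1 differ from that at z = 0 by y
        - 1 and -y - 1, which cannot both be zero.\<close>
      have "cubic1 (1, y, 0) \<noteq> 0 \<or> cubic1 (1, y, 1) \<noteq> 0 \<or> cubic1 (1, y, -1) \<noteq> 0"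
      proof (rule ccontr)
        assume "\<not> ?thesis"
        then have c: "cubic1 (1, y, 0) = 0" "cubic1 (1, y, 1) = 0" "cubic1 (1, y, -1) = 0" by blast+
        have "cubic1 (1, y, 1) - cubic1 (1, y, 0) = y - 1" "cubic1 (1, y, -1) - cubic1 (1, y, 0) = - y - 1"
          by (simp_all add: cubic1_def)
        then have "0 = y - 1" "0 = - y - 1" unfolding c by simp_all
        then show False by simp
      qed
      then show thesis using that[of "(y, 0)"] that[of "(y, 1)"] that[of "(y, -1)"] by (auto simp: P_def y_def)
    qed
    then obtain b1 where "b1 \<in> G ` O4" "P b1 \<noteq> 0"
      by (rule dense_nonzero[OF hP _ oG4, of c "G z0"]) (use z0O4 in blast)
    then obtain z1 where z1: "z1 \<in> O4" and P1: "P (G z1) \<noteq> 0" by blast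
    have z1': "z1 \<in> O2" "z1 \<in> W3" "z1 \<in> W1" "z1 \<in> W" "p z1 \<in> UM" "G z1 \<in> W2" "\<Delta> z1 \<noteq> 0" "k6 z1 \<in> A"
      using z1 by (simp_all add: O4_def O3_def O2_def W3_def W1_def)
    have "z1 \<noteq> z0" using P1 by (auto simp: P_def)
    then have nz: "a6 (k6 z1) \<noteq> 0 \<or> b6 (k6 z1) \<noteq> 0" using A(3)[OF z1'(8)] injk[OF z1'(1)] by blast
    obtain u v where uv: "\<psi> z1 = (u, v)" by fastforce
    have s10: "s1 (u, v) \<noteq> 0" "dd (u, v) \<noteq> 0" using R\<psi>(2)[OF z1'(2)] unfolding uv O0_def by simp_all
    have "cubic1 (1, R (u, v)) \<noteq> 0" using P1 R\<psi>(1)[OF z1'(2)] unfolding uv by (simp add: P_def)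
    then have uv0: "u \<noteq> 0" "v \<noteq> 0" unfolding cubic1_R[OF s10(1)] by auto
    have pNM: "p z1 \<in> NM" using z1' by (simp add: NM_def G_def)
    have cuv: "fst (p6 (k6 z1)) = hpt (1, u * v, u)" using k6W(2)[OF z1'(1)] by (simp add: uv cc_def)
    have eq1: "a z1 * (a6 (k6 z1) * pd2 (\<lambda>z. fst (k6 z)) z1 + b6 (k6 z1) * pd2 (\<lambda>z. snd (k6 z)) z1) =
      b z1 * (a6 (k6 z1) * pd1 (\<lambda>z. fst (k6 z)) z1 + b6 (k6 z1) * pd1 (\<lambda>z. snd (k6 z)) z1)"
      by (rule pulls_backD[OF pb_s f e6(1) z1'(4) pNM _ k6_def, unfolded comp_def])
        (use k6W[OF z1'(1)] in \<open>simp add: sp image_iff\<close>, metis)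
    \<comment> \<open>The blow-down in the local coordinates of \<E> and the affine coordinates X/Z,
      Y/Z, which are defined at the chosen point because u is non-zero.\<close>
    define h3 where "h3 = inv_into UNIV aff3 \<circ> fst \<circ> p6"
    have h3: "h3 w = aff3_coord (p6 w)" for w by (simp add: h3_def aff3_coord_def)
    define A3 where "A3 w = fst (E3 \<omega> (fst (h3 w), snd (h3 w), 1))" for w
    define B3 where "B3 w = fst (snd (E3 \<omega> (fst (h3 w), snd (h3 w), 1)))" for w
    have eq2: "a6 (k6 z1) * (A3 (k6 z1) * pd2 (\<lambda>w. fst (h3 w)) (k6 z1) + B3 (k6 z1) * pd2 (\<lambda>w. snd (h3 w)) (k6 z1)) =
      b6 (k6 z1) * (A3 (k6 z1) * pd1 (\<lambda>w. fst (h3 w)) (k6 z1) + B3 (k6 z1) * pd1 (\<lambda>w. snd (h3 w)) (k6 z1))"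
    proof -
      have m: "(aff3, UNIV, \<lambda>(u, v). fst (E3 \<omega> (u, v, 1)), \<lambda>(u, v). fst (snd (E3 \<omega> (u, v, 1)))) \<in> plane_foliation (E3 \<omega>)"
        unfolding plane_foliation_def by (simp add: Let_def)
      have pt: "p6 (k6 z1) \<in> {x \<in> points Bl3. fst x \<notin> coord_points}"
      proof -
        have "fst (p6 (k6 z1)) \<notin> coord_points" unfolding cuv coord_points_def using uv0 by (simp add: hpt_eq)
        then show ?thesis using k6W(2)[OF z1'(1)] ccB by simp
      qed
      have r: "fst (p6 (k6 z1)) \<in> aff3 ` UNIV" unfolding cuv range_aff3 by (rule uv0)
      show ?thesis
        using pulls_backD[OF pb_fst e6(1) m k6W(1)[OF z1'(1)] pt r h3_def]
        unfolding comp_def A3_def B3_def by (simp add: case_prod_unfold)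
    qed
    have hh3: "hol2 (\<lambda>w. fst (h3 w)) (k6 z1)" "hol2 (\<lambda>w. snd (h3 w)) (k6 z1)"
    proof -
      have d: "p6 (k6 z1) \<in> aff3_domain"
        unfolding aff3_domain_def using cuv uv0 k6W(2)[OF z1'(1)] ccB by (simp add: range_aff3)
      show "hol2 (\<lambda>w. fst (h3 w)) (k6 z1)" "hol2 (\<lambda>w. snd (h3 w)) (k6 z1)"
        unfolding h3
        by (rule chart_coords(2,3)[OF ch6 presheaf_Bl3 aff3_domain k6W(1)[OF z1'(1)] d])+
    qed
    define O5 where "O5 = {z \<in> O2. fst (\<psi> z) \<noteq> 0}"
    have oO5: "open O5" unfolding O5_def by (rule open_hol2_neq[OF oO2]) (rule h\<psi>, simp add: O2_def)
    have z1O5: "z1 \<in> O5" using z1' uv uv0 by (simp add: O5_def)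
    have h3k6: "h3 (k6 z) = (1 / fst (\<psi> z), snd (\<psi> z))" if "z \<in> O5" for z
      using that k6W(2)[of z] aff3_coord[of "fst (\<psi> z)"] by (simp add: O5_def h3 cc_def case_prod_unfold)
    have h31: "h3 (k6 z1) = (1 / u, v)" using h3k6[OF z1O5] uv by simp
    define x1 x2 y1 y2 where "x1 = pd1 (\<lambda>z. fst (\<psi> z)) z1" "x2 = pd1 (\<lambda>z. snd (\<psi> z)) z1"
      "y1 = pd2 (\<lambda>z. fst (\<psi> z)) z1" "y2 = pd2 (\<lambda>z. snd (\<psi> z)) z1"
    note hk1 = hk[OF z1'(1)]
    note h\<psi>1 = h\<psi>[OF z1'(2)]
    define k11 k12 k21 k22 where "k11 = pd1 (\<lambda>z. fst (k6 z)) z1" "k12 = pd2 (\<lambda>z. fst (k6 z)) z1"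
      "k21 = pd1 (\<lambda>z. snd (k6 z)) z1" "k22 = pd2 (\<lambda>z. snd (k6 z)) z1"
    define l11 l12 l21 l22 where "l11 = pd1 (\<lambda>w. fst (h3 w)) (k6 z1)" "l12 = pd2 (\<lambda>w. fst (h3 w)) (k6 z1)"
      "l21 = pd1 (\<lambda>w. snd (h3 w)) (k6 z1)" "l22 = pd2 (\<lambda>w. snd (h3 w)) (k6 z1)"
    \<comment> \<open>The composite of h3 and k6 is (1/u, v) evaluated along the lift, so the
      products of the two Jacobians are known.\<close>
    have fst1: "l11 * k11 + l12 * k21 = - x1 / u\<^sup>2" "l11 * k12 + l12 * k22 = - y1 / u\<^sup>2"
    proof -
      have inv: "((\<lambda>w. 1 / fst w) has_derivative (\<lambda>h. (- 1 / u\<^sup>2) * fst h + 0 * snd h)) (at (fst (\<psi> z1), snd (\<psi> z1)))"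
        using uv0 uv by (auto intro!: derivative_eq_intros simp: power2_eq_square field_simps)
      have e: "hol2 (\<lambda>z. 1 / fst (\<psi> z)) z1" using hol2_divide[OF hol2_const h\<psi>1(1), of 1] uv uv0 by simp
      have "hol2 (\<lambda>w. 1 / fst w) (fst (\<psi> z1), snd (\<psi> z1))" by (rule hol2I[OF inv])
      note c = pd_compose[OF this h\<psi>1, unfolded has_derivative_pd[OF inv] fst_conv]
      note d = pd_compose[of "\<lambda>w. fst (h3 w)" "\<lambda>z. fst (k6 z)" z1 "\<lambda>z. snd (k6 z)", unfolded prod.collapse, OF hh3(1) hk1]
      note g = pd_cong[OF e oO5 z1O5, of "\<lambda>z. fst (h3 (k6 z))"]
      show "l11 * k11 + l12 * k21 = - x1 / u\<^sup>2" "l11 * k12 + l12 * k22 = - y1 / u\<^sup>2"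
        using c d g h3k6 unfolding l11_l12_l21_l22_def k11_k12_k21_k22_def x1_x2_y1_y2_def by simp_all
    qed
    have snd1: "l21 * k11 + l22 * k21 = x2" "l21 * k12 + l22 * k22 = y2"
    proof -
      note d = pd_compose[of "\<lambda>w. snd (h3 w)" "\<lambda>z. fst (k6 z)" z1 "\<lambda>z. snd (k6 z)", unfolded prod.collapse, OF hh3(2) hk1]
      note g = pd_cong[OF h\<psi>1(2) oO5 z1O5, of "\<lambda>z. snd (h3 (k6 z))"]
      show "l21 * k11 + l22 * k21 = x2" "l21 * k12 + l22 * k22 = y2"
        using d g h3k6 unfolding l11_l12_l21_l22_def k11_k12_k21_k22_def x1_x2_y1_y2_def by simp_all
    qed
    define r11 r12 r21 r22 where "r11 = pd1 (\<lambda>z. fst (R z)) (u, v)" "r12 = pd2 (\<lambda>z. fst (R z)) (u, v)"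
      "r21 = pd1 (\<lambda>z. snd (R z)) (u, v)" "r22 = pd2 (\<lambda>z. snd (R z)) (u, v)"
    have G1: "pd1 (\<lambda>z. fst (G z)) z1 = r11 * x1 + r12 * x2" "pd2 (\<lambda>z. fst (G z)) z1 = r11 * y1 + r12 * y2"
      "pd1 (\<lambda>z. snd (G z)) z1 = r21 * x1 + r22 * x2" "pd2 (\<lambda>z. snd (G z)) z1 = r21 * y1 + r22 * y2"
    proof -
      have hR: "hol2 (\<lambda>z. fst (R z)) (\<psi> z1)" "hol2 (\<lambda>z. snd (R z)) (\<psi> z1)" unfolding uv by (rule hol2_R[OF s10(1)])+
      note d1 = pd_compose[of "\<lambda>z. fst (R z)" "\<lambda>z. fst (\<psi> z)" z1 "\<lambda>z. snd (\<psi> z)", unfolded prod.collapse, OF hR(1) h\<psi>1]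
      note d2 = pd_compose[of "\<lambda>z. snd (R z)" "\<lambda>z. fst (\<psi> z)" z1 "\<lambda>z. snd (\<psi> z)", unfolded prod.collapse, OF hR(2) h\<psi>1]
      have g: "x \<in> W3 \<Longrightarrow> fst (G x) = fst (R (\<psi> x))" "x \<in> W3 \<Longrightarrow> snd (G x) = snd (R (\<psi> x))" for x
        using R\<psi>(1) by simp_all
      note g1 = pd_cong[OF hG(1)[OF z1'(3)] oW3 z1'(2) g(1)]
      note g2 = pd_cong[OF hG(2)[OF z1'(3)] oW3 z1'(2) g(2)]
      show "pd1 (\<lambda>z. fst (G z)) z1 = r11 * x1 + r12 * x2" "pd2 (\<lambda>z. fst (G z)) z1 = r11 * y1 + r12 * y2"
        "pd1 (\<lambda>z. snd (G z)) z1 = r21 * x1 + r22 * x2" "pd2 (\<lambda>z. snd (G z)) z1 = r21 * y1 + r22 * y2"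
        using d1 d2 g1 g2 unfolding r11_r12_r21_r22_def x1_x2_y1_y2_def uv by simp_all
    qed
    obtain A1 where H: "H6 (1, R (u, v)) = (A1, B z1, C z1)"
      using R\<psi>(1)[OF z1'(2)] unfolding uv B_def C_def by (metis prod.collapse)
    have id: "(B z1 * r11 + C z1 * r21) * (\<zeta> - 1) * u = (B z1 * r12 + C z1 * r22) * \<zeta> * v"
      unfolding r11_r12_r21_r22_def
      by (rule foliation_identity[OF s10 hol2_has_derivative[OF hol2_R(1)[OF s10(1)]] hol2_has_derivative[OF hol2_R(2)[OF s10(1)]] H])
    have AB3: "A3 (k6 z1) = \<omega>\<^sup>2 * v" "B3 (k6 z1) = \<omega> / u" unfolding A3_def B3_def h31 E3_def by simp_all
    have "a z1 * ((B z1 * r11 + C z1 * r21) * y1 + (B z1 * r12 + C z1 * r22) * y2) =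
      b z1 * ((B z1 * r11 + C z1 * r21) * x1 + (B z1 * r12 + C z1 * r22) * x2)"
    proof -
      \<comment> \<open>P and Q are the coefficients of the pull-back of \<open>H6\<close> to (u,
        v); a2 and b2 those of \<open>E3\<close> pulled back to the chart of \<E>, a multiple \<mu>
        of its local form since that is non-zero here. The local form of \<F> is thus proportional
        to the pull-back of \<omega> u dv - \<omega>^2 v du, and \<open>id\<close> makes P du + Q dv
        proportional to this form; the factor \<omega> u is cancelled at the end.\<close>
      define P Q where "P = B z1 * r11 + C z1 * r21" "Q = B z1 * r12 + C z1 * r22"
      define a2 b2 where "a2 = A3 (k6 z1) * l11 + B3 (k6 z1) * l21" "b2 = A3 (k6 z1) * l12 + B3 (k6 z1) * l22"
      have "a6 (k6 z1) * b2 = b6 (k6 z1) * a2" using eq2 unfolding a2_b2_def l11_l12_l21_l22_def .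
      then obtain \<mu> where \<mu>: "a2 = \<mu> * a6 (k6 z1)" "b2 = \<mu> * b6 (k6 z1)"
        using nz by (cases "a6 (k6 z1) = 0") (auto simp: field_simps intro: that[of "b2 / b6 (k6 z1)"] that[of "a2 / a6 (k6 z1)"])
      have "a z1 * (b2 * k22 + a2 * k12) = b z1 * (b2 * k21 + a2 * k11)"
        using eq1 unfolding \<mu> k11_k12_k21_k22_def[symmetric] by algebra
      then have "a z1 * (A3 (k6 z1) * (l11 * k12 + l12 * k22) + B3 (k6 z1) * (l21 * k12 + l22 * k22)) =
          b z1 * (A3 (k6 z1) * (l11 * k11 + l12 * k21) + B3 (k6 z1) * (l21 * k11 + l22 * k21))"
        unfolding a2_b2_def by algebra
      then have "a z1 * (\<omega>\<^sup>2 * v * (- y1 / u\<^sup>2) + \<omega> / u * y2) = b z1 * (\<omega>\<^sup>2 * v * (- x1 / u\<^sup>2) + \<omega> / u * x2)"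
        unfolding fst1 snd1 AB3 .
      then have "u\<^sup>2 * (a z1 * (\<omega>\<^sup>2 * v * (- y1 / u\<^sup>2) + \<omega> / u * y2)) = u\<^sup>2 * (b z1 * (\<omega>\<^sup>2 * v * (- x1 / u\<^sup>2) + \<omega> / u * x2))"
        by (rule arg_cong)
      moreover have "u\<^sup>2 * (c * (\<omega>\<^sup>2 * v * (- y / u\<^sup>2) + \<omega> / u * t)) = c * (\<omega> * u * t - \<omega>\<^sup>2 * v * y)" for c y t
        using uv0(1) by (simp add: field_simps power2_eq_square)
      ultimately have e: "a z1 * (\<omega> * u * y2 - \<omega>\<^sup>2 * v * y1) = b z1 * (\<omega> * u * x2 - \<omega>\<^sup>2 * v * x1)"
        by metis
      have o: "\<omega>\<^sup>2 = - \<zeta>" unfolding omega using zeta_sq by algebra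
      have "P * \<omega> * u = Q * \<zeta> * v" using id unfolding P_Q_def omega .
      then have E12: "Q * (a z1 * (\<omega> * u * y2 - \<omega>\<^sup>2 * v * y1)) = \<omega> * u * (a z1 * (P * y1 + Q * y2))"
        "Q * (b z1 * (\<omega> * u * x2 - \<omega>\<^sup>2 * v * x1)) = \<omega> * u * (b z1 * (P * x1 + Q * x2))"
        unfolding o by algebra+
      then have "\<omega> * u * (a z1 * (P * y1 + Q * y2)) = \<omega> * u * (b z1 * (P * x1 + Q * x2))"
        unfolding E12[symmetric] e ..
      moreover have "\<omega> \<noteq> 0" using o zeta_sq by auto
      ultimately show ?thesis using uv0(1) unfolding P_Q_def by simp
    qed
    then have "\<Delta> z1 = 0" unfolding \<Delta>_def G1 by (simp add: algebra_simps)
    then show False using z1' by simp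
  qed
  then show "a z0 * (B z0 * pd2 (\<lambda>z. fst (G z)) z0 + C z0 * pd2 (\<lambda>z. snd (G z)) z0) =
     b z0 * (B z0 * pd1 (\<lambda>z. fst (G z)) z0 + C z0 * pd1 (\<lambda>z. snd (G z)) z0)"
    unfolding \<Delta>_def by simp
qed

end

lemma pd_quotient:
  assumes "hol2 f z" "hol2 g z" "g z \<noteq> 0"
  shows "pd1 (\<lambda>z. f z / g z) z = (pd1 f z * g z - f z * pd1 g z) / (g z)\<^sup>2"
    "pd2 (\<lambda>z. f z / g z) z = (pd2 f z * g z - f z * pd2 g z) / (g z)\<^sup>2"
proof -
  note d = hol2_has_derivative[OF assms(1)] hol2_has_derivative[OF assms(2)]
  have "((\<lambda>z. f z / g z) has_derivative (\<lambda>h. (pd1 f z * g z - f z * pd1 g z) / (g z)\<^sup>2 * fst h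
      + (pd2 f z * g z - f z * pd2 g z) / (g z)\<^sup>2 * snd h)) (at z)"
    by (rule has_derivative_eq_rhs[OF has_derivative_divide'[OF d assms(3)]])
      (auto simp: field_simps power2_eq_square assms(3))
  from has_derivative_pd[OF this]
  show "pd1 (\<lambda>z. f z / g z) z = (pd1 f z * g z - f z * pd1 g z) / (g z)\<^sup>2"
    "pd2 (\<lambda>z. f z / g z) z = (pd2 f z * g z - f z * pd2 g z) / (g z)\<^sup>2" .
qed

lemma aff_inverse:
  "inv_into UNIV aff1 (aff1 z) = z"
  "fst z \<noteq> 0 \<Longrightarrow> inv_into UNIV aff2 (aff1 z) = (1 / fst z, snd z / fst z)"
  "snd z \<noteq> 0 \<Longrightarrow> inv_into UNIV aff3 (aff1 z) = (1 / snd z, fst z / snd z)"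
proof -
  show "inv_into UNIV aff1 (aff1 z) = z" by (rule inv_f_f[OF inj_aff(1)])
  assume "fst z \<noteq> 0"
  then have "aff2 (1 / fst z, snd z / fst z) = aff1 z" unfolding aff_hpt(1)[of z] aff2_eq by simp
  then show "inv_into UNIV aff2 (aff1 z) = (1 / fst z, snd z / fst z)" by (rule inv_f_eq[OF inj_aff(2)])
next
  assume "snd z \<noteq> 0"
  then have "aff3 (1 / snd z, fst z / snd z) = aff1 z" unfolding aff_hpt(1)[of z] aff3_eq by simp
  then show "inv_into UNIV aff3 (aff1 z) = (1 / snd z, fst z / snd z)" by (rule inv_f_eq[OF inj_aff(3)])
qed

lemma H6_scale: "H6 (csc c v) = csc (c ^ 3) (H6 v)"
  by (cases v) (simp add: H6_def csc_def algebra_simps eval_nat_numeral)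

lemma H6_euler: "cdot v (H6 v) = 0"
  by (cases v) (simp add: H6_def cdot_def algebra_simps eval_nat_numeral)

text \<open>A change of affine chart multiplies the form by y^(-4): three factors come from the
  degree of the coefficients and one from the differentials, after the Euler relation has removed A.
  Here y1 and w1 stand for a partial derivative of y and of w.\<close>

lemma H6_chart:
  assumes "y \<noteq> (0::complex)"
  shows "fst (H6 (1 / y, 1, w / y)) * ((0 * y - 1 * y1) / y\<^sup>2) + snd (snd (H6 (1 / y, 1, w / y))) * ((w1 * y - w * y1) / y\<^sup>2) =
      (fst (snd (H6 (1, y, w))) * y1 + snd (snd (H6 (1, y, w))) * w1) / y ^ 4"
    "fst (H6 (1 / y, w / y, 1)) * ((0 * y - 1 * y1) / y\<^sup>2) + fst (snd (H6 (1 / y, w / y, 1))) * ((w1 * y - w * y1) / y\<^sup>2) =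
      (fst (snd (H6 (1, w, y))) * w1 + snd (snd (H6 (1, w, y))) * y1) / y ^ 4"
proof -
  define i where "i = 1 / y"
  have i: "i * y = 1" using assms by (simp add: i_def)
  have d: "x / y\<^sup>2 = x * i\<^sup>2" "x / y ^ 4 = x * i ^ 4" for x by (simp_all add: i_def power_divide)
  have e: "(1 / y, 1, w / y) = csc i (1, y, w)" "(1 / y, w / y, 1) = csc i (1, w, y)"
    using assms by (simp_all add: csc_def i_def)
  obtain A B C where H: "H6 (1, y, w) = (A, B, C)" by (metis prod.collapse)
  have E: "A + y * B + w * C = 0" using H6_euler[of "(1, y, w)"] unfolding H cdot_def by simp
  show "fst (H6 (1 / y, 1, w / y)) * ((0 * y - 1 * y1) / y\<^sup>2) + snd (snd (H6 (1 / y, 1, w / y))) * ((w1 * y - w * y1) / y\<^sup>2) =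
      (fst (snd (H6 (1, y, w))) * y1 + snd (snd (H6 (1, y, w))) * w1) / y ^ 4"
    unfolding e H6_scale H unfolding csc_def prod.case fst_conv snd_conv d using E i by algebra
  obtain A B C where H: "H6 (1, w, y) = (A, B, C)" by (metis prod.collapse)
  have E: "A + w * B + y * C = 0" using H6_euler[of "(1, w, y)"] unfolding H cdot_def by simp
  show "fst (H6 (1 / y, w / y, 1)) * ((0 * y - 1 * y1) / y\<^sup>2) + fst (snd (H6 (1 / y, w / y, 1))) * ((w1 * y - w * y1) / y\<^sup>2) =
      (fst (snd (H6 (1, w, y))) * w1 + snd (snd (H6 (1, w, y))) * y1) / y ^ 4"
    unfolding e H6_scale H unfolding csc_def prod.case fst_conv snd_conv d using E i by algebra
qed

context santos
begin

text \<open>In the chart x = 1 this is \<open>pull_back_affine\<close>; the other two charts of the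
  plane are reduced to it by the quotient rule and \<open>H6_chart\<close>.\<close>

lemma pulls_back_H6: "pulls_back fM UM (plane_foliation H6) \<F>"
proof -
  have main: "a z * (a' (h z) * pd2 (fst \<circ> h) z + b' (h z) * pd2 (snd \<circ> h) z) =
      b z * (a' (h z) * pd1 (fst \<circ> h) z + b' (h z) * pd1 (snd \<circ> h) z)"
    if f: "(p, W, a, b) \<in> \<F>" and q: "(q, W', a', b') \<in> plane_foliation H6"
      and z: "z \<in> W" "p z \<in> UM" "fM (p z) \<in> q ` W'" and h: "h = inv_into W' q \<circ> fM \<circ> p"
    for p W a b q W' a' b' z h
  proof -
    define G where "G z = kY (\<pi> (p z))" for z
    define B where "B = fst (snd (H6 (1, G z)))"
    define C where "C = snd (snd (H6 (1, G z)))"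
    have G: "(\<lambda>z. fst (kY (\<pi> (p z)))) = (\<lambda>z. fst (G z))" "(\<lambda>z. snd (kY (\<pi> (p z)))) = (\<lambda>z. snd (G z))"
      by (simp_all add: G_def)
    note pb = pull_back_affine[OF f z(1,2), unfolded G, folded G_def, folded B_def C_def]
    have fG: "fM (p x) = aff1 (G x)" for x by (simp add: fM_def G_def)
    define S where "S = {z \<in> W. p z \<in> UM}"
    have hG: "hol2 (\<lambda>z. fst (G z)) x" "hol2 (\<lambda>z. snd (G z)) x" if "x \<in> S" for x
      using pull_back_affine(1,2)[OF f, of x] that unfolding G S_def by simp_all
    have zS: "z \<in> S" using z by (simp add: S_def)
    consider "q = aff1" "W' = UNIV" "a' = (\<lambda>(u, v). fst (snd (H6 (1, u, v))))" "b' = (\<lambda>(u, v). snd (snd (H6 (1, u, v))))"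
      | "q = aff2" "W' = UNIV" "a' = (\<lambda>(u, v). fst (H6 (u, 1, v)))" "b' = (\<lambda>(u, v). snd (snd (H6 (u, 1, v))))"
      | "q = aff3" "W' = UNIV" "a' = (\<lambda>(u, v). fst (H6 (u, v, 1)))" "b' = (\<lambda>(u, v). fst (snd (H6 (u, v, 1))))"
      using q unfolding plane_foliation_def Let_def by auto
    then show ?thesis
    proof cases
      case 1
      have hx: "h x = G x" for x unfolding h 1 by (simp add: fG aff_inverse)
      then have "h = G" by auto
      then show ?thesis using pb(4) by (simp add: 1 comp_def case_prod_unfold B_def C_def)
    next
      case 2
      have y0: "fst (G z) \<noteq> 0"
        using z(3) unfolding fG 2 aff_range_iff .
      have o: "open {x \<in> S. fst (G x) \<noteq> 0}" by (rule open_hol2_neq[OF pb(3)[folded S_def] hG(1)])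
      have zT: "z \<in> {x \<in> S. fst (G x) \<noteq> 0}" using zS y0 by simp
      have hx: "h x = (1 / fst (G x), snd (G x) / fst (G x))" if "fst (G x) \<noteq> 0" for x
        unfolding h 2 using that by (simp add: fG aff_inverse)
      have q: "hol2 (\<lambda>x. 1 / fst (G x)) z" "hol2 (\<lambda>x. snd (G x) / fst (G x)) z"
        by (intro hol2_divide hol2_const hG zS y0)+
      note d1 = pd_cong[OF q(1) o zT, of "fst \<circ> h"] pd_cong[OF q(2) o zT, of "snd \<circ> h"]
      have c1: "pd1 (\<lambda>_. 1) z = 0" "pd2 (\<lambda>_. 1) z = 0"
        using has_derivative_pd[of "\<lambda>_. 1" 0 0 z] by simp_all
      note d2 = pd_quotient[OF hol2_const hG(1)[OF zS] y0, of 1, unfolded c1] pd_quotient[OF hG(2,1)[OF zS] y0]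
      have d: "pd1 (fst \<circ> h) z = (0 * fst (G z) - 1 * pd1 (\<lambda>z. fst (G z)) z) / (fst (G z))\<^sup>2"
        "pd2 (fst \<circ> h) z = (0 * fst (G z) - 1 * pd2 (\<lambda>z. fst (G z)) z) / (fst (G z))\<^sup>2"
        "pd1 (snd \<circ> h) z = (pd1 (\<lambda>z. snd (G z)) z * fst (G z) - snd (G z) * pd1 (\<lambda>z. fst (G z)) z) / (fst (G z))\<^sup>2"
        "pd2 (snd \<circ> h) z = (pd2 (\<lambda>z. snd (G z)) z * fst (G z) - snd (G z) * pd2 (\<lambda>z. fst (G z)) z) / (fst (G z))\<^sup>2"
        using d1 d2 hx by simp_all
      have e: "a' (h z) = fst (H6 (1 / fst (G z), 1, snd (G z) / fst (G z)))"
        "b' (h z) = snd (snd (H6 (1 / fst (G z), 1, snd (G z) / fst (G z))))"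
        by (simp_all add: 2 hx y0)
      show ?thesis unfolding e d H6_chart(1)[OF y0] using pb(4) by (simp add: B_def C_def)
    next
      case 3
      have y0: "snd (G z) \<noteq> 0"
        using z(3) unfolding fG 3 aff_range_iff .
      have o: "open {x \<in> S. snd (G x) \<noteq> 0}" by (rule open_hol2_neq[OF pb(3)[folded S_def] hG(2)])
      have zT: "z \<in> {x \<in> S. snd (G x) \<noteq> 0}" using zS y0 by simp
      have hx: "h x = (1 / snd (G x), fst (G x) / snd (G x))" if "snd (G x) \<noteq> 0" for x
        unfolding h 3 using that by (simp add: fG aff_inverse)
      have q: "hol2 (\<lambda>x. 1 / snd (G x)) z" "hol2 (\<lambda>x. fst (G x) / snd (G x)) z"
        by (intro hol2_divide hol2_const hG zS y0)+
      note d1 = pd_cong[OF q(1) o zT, of "fst \<circ> h"] pd_cong[OF q(2) o zT, of "snd \<circ> h"]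
      have c1: "pd1 (\<lambda>_. 1) z = 0" "pd2 (\<lambda>_. 1) z = 0"
        using has_derivative_pd[of "\<lambda>_. 1" 0 0 z] by simp_all
      note d2 = pd_quotient[OF hol2_const hG(2)[OF zS] y0, of 1, unfolded c1] pd_quotient[OF hG(1,2)[OF zS] y0]
      have d: "pd1 (fst \<circ> h) z = (0 * snd (G z) - 1 * pd1 (\<lambda>z. snd (G z)) z) / (snd (G z))\<^sup>2"
        "pd2 (fst \<circ> h) z = (0 * snd (G z) - 1 * pd2 (\<lambda>z. snd (G z)) z) / (snd (G z))\<^sup>2"
        "pd1 (snd \<circ> h) z = (pd1 (\<lambda>z. fst (G z)) z * snd (G z) - fst (G z) * pd1 (\<lambda>z. snd (G z)) z) / (snd (G z))\<^sup>2"
        "pd2 (snd \<circ> h) z = (pd2 (\<lambda>z. fst (G z)) z * snd (G z) - fst (G z) * pd2 (\<lambda>z. snd (G z)) z) / (snd (G z))\<^sup>2"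
        using d1 d2 hx by simp_all
      have e: "a' (h z) = fst (H6 (1 / snd (G z), fst (G z) / snd (G z), 1))"
        "b' (h z) = fst (snd (H6 (1 / snd (G z), fst (G z) / snd (G z), 1)))"
        by (simp_all add: 3 hx y0)
      show ?thesis unfolding e d H6_chart(2)[OF y0] using pb(4) by (simp add: B_def C_def)
    qed
  qed
  show ?thesis
    unfolding pulls_back_def Let_def
  proof (intro ballI, unfold split_paired_all prod.case, intro ballI, unfold split_paired_all prod.case, intro ballI impI, elim conjE)
    fix p W a b q W' a' b' z
    assume "(p, W, a, b) \<in> \<F>" "(q, W', a', b') \<in> plane_foliation H6" "z \<in> W" "p z \<in> UM" "fM (p z) \<in> q ` W'"
    from main[OF this refl] show "a z * (a' ((inv_into W' q \<circ> fM \<circ> p) z) * pd2 (fst \<circ> (inv_into W' q \<circ> fM \<circ> p)) z +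
        b' ((inv_into W' q \<circ> fM \<circ> p) z) * pd2 (snd \<circ> (inv_into W' q \<circ> fM \<circ> p)) z) =
      b z * (a' ((inv_into W' q \<circ> fM \<circ> p) z) * pd1 (fst \<circ> (inv_into W' q \<circ> fM \<circ> p)) z +
        b' ((inv_into W' q \<circ> fM \<circ> p) z) * pd1 (snd \<circ> (inv_into W' q \<circ> fM \<circ> p)) z)" .
  qed
qed

end

lemma santos_birational:
  assumes w: "\<omega> ^ 3 = 1" "\<omega> \<noteq> 1" and S: "santos_foliation \<omega> M \<pi> \<F>"
  shows "\<exists>f U V. birational_to_P2 M f U V \<and> pulls_back f U (plane_foliation H6) \<F> \<and>
    strict_transform M f U (curve cubic1) = santos_link M \<pi>"
proof -
  obtain \<E> where E: "transform_on_Bl3 (E3 \<omega>) \<E>" "induced_foliation M \<pi> \<E> \<F>"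
    using S unfolding santos_foliation_def by blast
  have D: "desingularization Bl3_mod_T6 M \<pi>"
    using S unfolding santos_foliation_def minimal_desingularization_def by blast
  \<comment> \<open>A cube root of unity other than 1 satisfies \<omega>^2 + \<omega> + 1 = 0, so
    \<zeta> = \<omega> + 1 fulfils the equation required by the locale.\<close>
  have "(\<omega> - 1) * (\<omega>\<^sup>2 + \<omega> + 1) = 0" using w(1) by algebra
  then have "\<omega>\<^sup>2 + \<omega> + 1 = 0" using w(2) by simp
  then have "(\<omega> + 1)\<^sup>2 = \<omega> + 1 - 1" by algebra
  then interpret santos "\<omega> + 1" M \<pi> \<omega> \<E> \<F>
    by unfold_locales (use D E in simp_all)
  show ?thesis using birational pulls_back_H6 link by blast
qed

section \<open>Forms of degree at most three, tangency and the nodal cubics\<close>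

lemma form0: "form 0 G \<Longrightarrow> \<exists>a. \<forall>v. G v = a"
  unfolding form_def by (auto simp: numeral_eq_Suc)

lemma form1: "form 1 G \<Longrightarrow> \<exists>a b c. \<forall>x y z. G (x, y, z) = a * x + b * y + c * z"
proof -
  assume "form 1 G"
  then obtain k where k: "\<And>x y z. G (x, y, z) = (\<Sum>i\<le>1. \<Sum>j\<le>1 - i. k i j * x ^ i * y ^ j * z ^ (1 - i - j))"
    unfolding form_def by blast
  have "G (x, y, z) = k 1 0 * x + k 0 1 * y + k 0 0 * z" for x y z
    unfolding k by (simp add: numeral_eq_Suc)
  then show ?thesis by blast
qed

lemma form2: "form 2 G \<Longrightarrow> \<exists>a b c d e f. \<forall>x y z. G (x, y, z) =
    a * x\<^sup>2 + b * x * y + c * x * z + d * y\<^sup>2 + e * y * z + f * z\<^sup>2"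
proof -
  assume "form 2 G"
  then obtain k where k: "\<And>x y z. G (x, y, z) = (\<Sum>i\<le>2. \<Sum>j\<le>2 - i. k i j * x ^ i * y ^ j * z ^ (2 - i - j))"
    unfolding form_def by blast
  have "G (x, y, z) = k 2 0 * x\<^sup>2 + k 1 1 * x * y + k 1 0 * x * z + k 0 2 * y\<^sup>2 + k 0 1 * y * z + k 0 0 * z\<^sup>2" for x y z
    unfolding k by (simp add: numeral_eq_Suc algebra_simps)
  then show ?thesis by blast
qed

lemma form3: "form 3 G \<longleftrightarrow> (\<exists>a b c d e f g h i j. \<forall>x y z. G (x, y, z) =
    a * x ^ 3 + b * x\<^sup>2 * y + c * x\<^sup>2 * z + d * x * y\<^sup>2 + e * x * y * z + f * x * z\<^sup>2
    + g * y ^ 3 + h * y\<^sup>2 * z + i * y * z\<^sup>2 + j * z ^ 3)"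
proof
  assume "form 3 G"
  then obtain k where k: "\<And>x y z. G (x, y, z) = (\<Sum>i\<le>3. \<Sum>j\<le>3 - i. k i j * x ^ i * y ^ j * z ^ (3 - i - j))"
    unfolding form_def by blast
  have "G (x, y, z) = k 3 0 * x ^ 3 + k 2 1 * x\<^sup>2 * y + k 2 0 * x\<^sup>2 * z + k 1 2 * x * y\<^sup>2 + k 1 1 * x * y * z + k 1 0 * x * z\<^sup>2
    + k 0 3 * y ^ 3 + k 0 2 * y\<^sup>2 * z + k 0 1 * y * z\<^sup>2 + k 0 0 * z ^ 3" for x y z
    unfolding k by (simp add: numeral_eq_Suc algebra_simps)
  then show "\<exists>a b c d e f g h i j. \<forall>x y z. G (x, y, z) =
    a * x ^ 3 + b * x\<^sup>2 * y + c * x\<^sup>2 * z + d * x * y\<^sup>2 + e * x * y * z + f * x * z\<^sup>2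
    + g * y ^ 3 + h * y\<^sup>2 * z + i * y * z\<^sup>2 + j * z ^ 3" by blast
next
  assume "\<exists>a b c d e f g h i j. \<forall>x y z. G (x, y, z) =
    a * x ^ 3 + b * x\<^sup>2 * y + c * x\<^sup>2 * z + d * x * y\<^sup>2 + e * x * y * z + f * x * z\<^sup>2
    + g * y ^ 3 + h * y\<^sup>2 * z + i * y * z\<^sup>2 + j * z ^ 3"
  then obtain a b c d e f g h i j where G: "\<And>x y z. G (x, y, z) =
    a * x ^ 3 + b * x\<^sup>2 * y + c * x\<^sup>2 * z + d * x * y\<^sup>2 + e * x * y * z + f * x * z\<^sup>2
    + g * y ^ 3 + h * y\<^sup>2 * z + i * y * z\<^sup>2 + j * z ^ 3" by blast
  define k where "k = (\<lambda>p q. [[j, i, h, g], [f, e, d], [c, b], [a]] ! p ! q)"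
  show "form 3 G"
    unfolding form_def G by (intro exI[of _ k]) (simp add: k_def numeral_eq_Suc algebra_simps)
qed

lemma form3I:
  assumes "\<And>x y z. G (x, y, z) =
    a * x ^ 3 + b * x\<^sup>2 * y + c * x\<^sup>2 * z + d * x * y\<^sup>2 + e * x * y * z + f * x * z\<^sup>2
    + g * y ^ 3 + h * y\<^sup>2 * z + i * y * z\<^sup>2 + j * z ^ 3"
  shows "form 3 G"
  unfolding form3 using assms by blast

lemma grad_cubic1: "grad cubic1 (x, y, z) = (- y\<^sup>2 + y * z - z\<^sup>2, 9 * y\<^sup>2 - 2 * x * y + x * z, x * y - 2 * x * z)"
proof -
  have "((\<lambda>t. cubic1 (t, y, z)) has_field_derivative - y\<^sup>2 + y * z - z\<^sup>2) (at x)"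
    "((\<lambda>t. cubic1 (x, t, z)) has_field_derivative 9 * y\<^sup>2 - 2 * x * y + x * z) (at y)"
    "((\<lambda>t. cubic1 (x, y, t)) has_field_derivative x * y - 2 * x * z) (at z)"
    unfolding cubic1_def prod.case by (auto intro!: derivative_eq_intros)
  then show ?thesis unfolding grad_def prod.case by (simp add: DERIV_imp_deriv)
qed

lemma grad_cubic2: "grad cubic2 (x, y, z) =
    (- 15 * y\<^sup>2 + 6 * y * z - 3 * z\<^sup>2 - 12 * x * y + 12 * x * z + 3 * x\<^sup>2,
     24 * y\<^sup>2 - 30 * x * y + 6 * x * z - 6 * x\<^sup>2, 6 * x * y - 6 * x * z + 6 * x\<^sup>2)"
proof -
  have "((\<lambda>t. cubic2 (t, y, z)) has_field_derivative - 15 * y\<^sup>2 + 6 * y * z - 3 * z\<^sup>2 - 12 * x * y + 12 * x * z + 3 * x\<^sup>2) (at x)"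
    "((\<lambda>t. cubic2 (x, t, z)) has_field_derivative 24 * y\<^sup>2 - 30 * x * y + 6 * x * z - 6 * x\<^sup>2) (at y)"
    "((\<lambda>t. cubic2 (x, y, t)) has_field_derivative 6 * x * y - 6 * x * z + 6 * x\<^sup>2) (at z)"
    unfolding cubic2_def prod.case by (auto intro!: derivative_eq_intros)
  then show ?thesis unfolding grad_def prod.case by (simp add: DERIV_imp_deriv)
qed

lemma grad_line_x: "grad line_x v = (1, 0, 0)"
  unfolding grad_def line_x_def by (cases v) simp

text \<open>Used to see that two forms tangent to the same curve are both multiples of its gradient,
  hence dependent, at smooth points.\<close>

lemma parallel:
  assumes "g \<noteq> 0" "\<And>w. cdot g w = 0 \<Longrightarrow> cdot v w = 0"
  shows "\<exists>k. v = csc k g"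
proof -
  obtain g1 g2 g3 where g: "g = (g1, g2, g3)" by (metis prod.collapse)
  obtain v1 v2 v3 where v: "v = (v1, v2, v3)" by (metis prod.collapse)
  have c: "v1 * g2 = v2 * g1" "v1 * g3 = v3 * g1" "v2 * g3 = v3 * g2"
    using assms(2)[of "(g2, - g1, 0)"] assms(2)[of "(g3, 0, - g1)"] assms(2)[of "(0, g3, - g2)"]
    by (simp_all add: g v cdot_def)
  consider "g1 \<noteq> 0" | "g2 \<noteq> 0" | "g3 \<noteq> 0" using assms(1) by (auto simp: g zero_prod_def)
  then show ?thesis
  proof cases
    case 1 then show ?thesis using c by (intro exI[of _ "v1 / g1"]) (simp add: g v csc_def eq_divide_eq)
  next
    case 2 then show ?thesis using c by (intro exI[of _ "v2 / g2"]) (simp add: g v csc_def eq_divide_eq)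
  next
    case 3 then show ?thesis using c by (intro exI[of _ "v3 / g3"]) (simp add: g v csc_def eq_divide_eq)
  qed
qed

text \<open>Tangency amounts to dependence of the form and the gradient, so the vanishing of the 2
  by 2 minors modulo F suffices.\<close>

lemma tangent_toI:
  assumes "\<And>x y z A B C g1 g2 g3. F (x, y, z) = 0 \<Longrightarrow> \<Omega> (x, y, z) = (A, B, C) \<Longrightarrow> grad F (x, y, z) = (g1, g2, g3) \<Longrightarrow>
    A * g2 = B * g1 \<and> A * g3 = C * g1 \<and> B * g3 = C * g2"
  shows "tangent_to \<Omega> F"
  unfolding tangent_to_def
proof (intro allI impI, elim conjE)
  fix v w assume v: "F v = 0" "grad F v \<noteq> 0" and w: "cdot (grad F v) w = 0"
  obtain x y z where xyz: "v = (x, y, z)" by (metis prod.collapse)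
  obtain A B C where \<Omega>: "\<Omega> v = (A, B, C)" by (metis prod.collapse)
  obtain g1 g2 g3 where g: "grad F v = (g1, g2, g3)" by (metis prod.collapse)
  obtain p q r where w': "w = (p, q, r)" by (metis prod.collapse)
  have c: "A * g2 = B * g1 \<and> A * g3 = C * g1 \<and> B * g3 = C * g2"
    using assms v \<Omega> g unfolding xyz by blast
  have e: "g1 * p + g2 * q + g3 * r = 0" using w by (simp add: g w' cdot_def)
  have "g1 * (A * p + B * q + C * r) = A * (g1 * p + g2 * q + g3 * r)"
    "g2 * (A * p + B * q + C * r) = B * (g1 * p + g2 * q + g3 * r)"
    "g3 * (A * p + B * q + C * r) = C * (g1 * p + g2 * q + g3 * r)"
    using c by algebra+
  then show "cdot (\<Omega> v) w = 0" using e v(2) by (auto simp: \<Omega> w' g cdot_def zero_prod_def)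
qed

lemma tangent_cubic1: "tangent_to H6 cubic1"
proof (rule tangent_toI)
  fix x y z A B C g1 g2 g3
  assume F: "cubic1 (x, y, z) = 0" and H: "H6 (x, y, z) = (A, B, C)" and g: "grad cubic1 (x, y, z) = (g1, g2, g3)"
  have "A = x * y\<^sup>2 - x * y * z + x * z\<^sup>2 - 5 * y ^ 3 + y\<^sup>2 * z" "B = x * (5 * y\<^sup>2 - 3 * y * z - x * y + x * z)" "C = x * (2 * y\<^sup>2 - x * z)"
    using H by (simp_all add: H6_def)
  moreover have "g1 = - y\<^sup>2 + y * z - z\<^sup>2" "g2 = 9 * y\<^sup>2 - 2 * x * y + x * z" "g3 = x * y - 2 * x * z"
    using g by (simp_all add: grad_cubic1)
  moreover have "3 * y ^ 3 - x * y\<^sup>2 + x * y * z - x * z\<^sup>2 = 0" using F by (simp add: cubic1_def)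
  ultimately show "A * g2 = B * g1 \<and> A * g3 = C * g1 \<and> B * g3 = C * g2"
    by (intro conjI; hypsubst; algebra)
qed

lemma tangent_cubic2: "tangent_to H6 cubic2"
proof (rule tangent_toI)
  fix x y z A B C g1 g2 g3
  assume F: "cubic2 (x, y, z) = 0" and H: "H6 (x, y, z) = (A, B, C)" and g: "grad cubic2 (x, y, z) = (g1, g2, g3)"
  have "A = x * y\<^sup>2 - x * y * z + x * z\<^sup>2 - 5 * y ^ 3 + y\<^sup>2 * z" "B = x * (5 * y\<^sup>2 - 3 * y * z - x * y + x * z)" "C = x * (2 * y\<^sup>2 - x * z)"
    using H by (simp_all add: H6_def)
  moreover have "g1 = - 15 * y\<^sup>2 + 6 * y * z - 3 * z\<^sup>2 - 12 * x * y + 12 * x * z + 3 * x\<^sup>2"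
     "g2 = 24 * y\<^sup>2 - 30 * x * y + 6 * x * z - 6 * x\<^sup>2" "g3 = 6 * x * y - 6 * x * z + 6 * x\<^sup>2"
    using g by (simp_all add: grad_cubic2)
  moreover have "8 * y ^ 3 - 15 * x * y\<^sup>2 + 6 * x * y * z - 3 * x * z\<^sup>2 - 6 * x\<^sup>2 * y + 6 * x\<^sup>2 * z + x ^ 3 = 0"
    using F by (simp add: cubic2_def)
  ultimately show "A * g2 = B * g1 \<and> A * g3 = C * g1 \<and> B * g3 = C * g2"
    by (intro conjI; hypsubst; algebra)
qed

lemma tangent_line: "tangent_to H6 line_x"
  by (rule tangent_toI, unfold grad_line_x) (auto simp: line_x_def H6_def)

lemma deriv2_cubic:
  "(deriv ^^ 2) (\<lambda>t. c0 + c1 * t + c2 * t\<^sup>2 + c3 * t ^ 3) 0 = 2 * (c2 :: complex)"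
  "(deriv ^^ 1) (\<lambda>t. c0 + c1 * t + c2 * t\<^sup>2 + c3 * t ^ 3) 0 = (c1 :: complex)"
proof -
  have 1: "deriv (\<lambda>t. c0 + c1 * t + c2 * t\<^sup>2 + c3 * t ^ 3) = (\<lambda>t. c1 + 2 * c2 * t + 3 * c3 * t\<^sup>2)"
    by (intro ext DERIV_imp_deriv) (auto intro!: derivative_eq_intros)
  have 2: "deriv (\<lambda>t. c1 + 2 * c2 * t + 3 * c3 * t\<^sup>2) 0 = 2 * c2"
    by (intro DERIV_imp_deriv) (auto intro!: derivative_eq_intros)
  have 3: "(deriv ^^ 2) f = deriv (deriv f)" for f :: "complex \<Rightarrow> complex" by (simp add: numeral_2_eq_2)
  show "(deriv ^^ 2) (\<lambda>t. c0 + c1 * t + c2 * t\<^sup>2 + c3 * t ^ 3) 0 = 2 * c2"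
    unfolding 3 1 2 ..
  show "(deriv ^^ 1) (\<lambda>t. c0 + c1 * t + c2 * t\<^sup>2 + c3 * t ^ 3) 0 = c1" by (simp add: 1)
qed

text \<open>In a proper factorisation of a cubic one factor is linear, and then the cubic vanishes
  on a line.\<close>

lemma no_linear_factor_irreducible:
  assumes F: "form 3 F" "F w \<noteq> 0"
    and line: "\<And>a b c. (\<And>x y z. a * x + b * y + c * z = 0 \<Longrightarrow> F (x, y, z) = 0) \<Longrightarrow> a = 0 \<and> b = 0 \<and> c = 0"
  shows "irreducible_form 3 F"
proof -
  have no: False if G: "form 1 G" and e: "\<And>v. F v = G v * H v" for G H
  proof -
    obtain a b c where g: "\<And>x y z. G (x, y, z) = a * x + b * y + c * z" using form1[OF G] by blast
    have "a = 0 \<and> b = 0 \<and> c = 0" by (rule line) (simp add: e g)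
    then have "G w = 0" using g by (cases w) simp
    then show False using F(2) e by simp
  qed
  show ?thesis
    unfolding irreducible_form_def
  proof (intro conjI allI impI)
    show "1 \<le> (3::nat)" "form 3 F" "\<exists>v. F v \<noteq> 0" using F by (simp, blast, blast)
    fix i j G H assume ij: "i + j = 3 \<and> form i G \<and> form j H \<and> (\<forall>v. F v = G v * H v)"
    show "i = 0 \<or> j = 0"
    proof (rule ccontr)
      assume "\<not> ?thesis"
      then have "i = 1 \<or> j = 1" using ij by linarith
      then show False using no[of G H] no[of H G] ij by (metis mult.commute)
    qed
  qed
qed

lemma irreducible_cubic1: "irreducible_form 3 cubic1"
proof (rule no_linear_factor_irreducible)
  show "form 3 cubic1"
    by (rule form3I[of _ 0 0 0 "-1" 1 "-1" 3 0 0 0]) (simp add: cubic1_def)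
  show "cubic1 (0, 1, 0) \<noteq> 0" by (simp add: cubic1_def)
  fix a b c assume line: "\<And>x y z. a * x + b * y + c * z = 0 \<Longrightarrow> cubic1 (x, y, z) = 0"
  \<comment> \<open>The point (0, c, -b) lies on the line, and for x = 0 the cubic is 3y^3. Once c =
    0, the line contains all points (b, -a, t).\<close>
  have c: "c = 0" using line[of 0 c "- b"] by (simp add: cubic1_def)
  have "cubic1 (b, - a, t) = 0" for t by (rule line) (simp add: c)
  from this[of 0] this[of 1] this[of "-1"] have e: "- 3 * a ^ 3 - b * a\<^sup>2 = 0"
    "- 3 * a ^ 3 - b * a\<^sup>2 - a * b - b = 0" "- 3 * a ^ 3 - b * a\<^sup>2 + a * b - b = 0"
    by (simp_all add: cubic1_def)
  then have "2 * b = 0" by algebra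
  then have "b = 0" by simp
  then show "a = 0 \<and> b = 0 \<and> c = 0" using e c by simp
qed

lemma irreducible_cubic2: "irreducible_form 3 cubic2"
proof (rule no_linear_factor_irreducible)
  show "form 3 cubic2"
    by (rule form3I[of _ 1 "-6" 6 "-15" 6 "-3" 8 0 0 0]) (simp add: cubic2_def)
  show "cubic2 (0, 1, 0) \<noteq> 0" by (simp add: cubic2_def)
  fix a b c assume line: "\<And>x y z. a * x + b * y + c * z = 0 \<Longrightarrow> cubic2 (x, y, z) = 0"
  have c: "c = 0" using line[of 0 c "- b"] by (simp add: cubic2_def)
  have "cubic2 (b, - a, t) = 0" for t by (rule line) (simp add: c)
  from this[of 0] this[of 1] this[of "-1"]
  have e: "- 8 * a ^ 3 - 15 * b * a\<^sup>2 + 6 * b\<^sup>2 * a + b ^ 3 = 0"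
    "- 8 * a ^ 3 - 15 * b * a\<^sup>2 - 6 * b * a - 3 * b + 6 * b\<^sup>2 * a + 6 * b\<^sup>2 + b ^ 3 = 0"
    "- 8 * a ^ 3 - 15 * b * a\<^sup>2 + 6 * b * a - 3 * b + 6 * b\<^sup>2 * a - 6 * b\<^sup>2 + b ^ 3 = 0"
    by (simp_all add: cubic2_def)
  then have "6 * b = 0" by algebra
  then have "b = 0" by simp
  then show "a = 0 \<and> b = 0 \<and> c = 0" using e c by simp
qed


lemma singular_cubic1:
  assumes "grad cubic1 (x, y, z) = 0" shows "y = 0 \<and> z = 0"
proof -
  have g: "- y\<^sup>2 + y * z - z\<^sup>2 = 0" "9 * y\<^sup>2 - 2 * x * y + x * z = 0" "x * (y - 2 * z) = 0"
    using assms by (simp_all add: grad_cubic1 zero_prod_def algebra_simps)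
  show ?thesis
  proof (cases "x = 0")
    case True
    then have "y = 0" using g(2) by simp
    then show ?thesis using g(1) by simp
  next
    case False
    then have "y - 2 * z = 0" using g(3) by simp
    moreover from this have "3 * z\<^sup>2 = 0" using g(1) by algebra
    ultimately show ?thesis by simp
  qed
qed

lemma singular_cubic2:
  assumes "grad cubic2 (x, y, z) = 0" shows "y = x \<and> z = 2 * x"
proof -
  \<comment> \<open>Coordinates adapted to the node: both vanish exactly when y = x and z =
    2x.\<close>
  define Y Z where "Y = x - y" "Z = z + x - 3 * y"
  have g: "- 15 * y\<^sup>2 + 6 * y * z - 3 * z\<^sup>2 - 12 * x * y + 12 * x * z + 3 * x\<^sup>2 = 0"
     "24 * y\<^sup>2 - 30 * x * y + 6 * x * z - 6 * x\<^sup>2 = 0" "6 * x * y - 6 * x * z + 6 * x\<^sup>2 = 0"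
    using assms by (simp_all add: grad_cubic2 zero_prod_def)
  have yz: "y = x - Y" "z = Z + 2 * x - 3 * Y" by (simp_all add: Y_Z_def)
  have h: "6 * (x * (2 * Y - Z)) = 0" "12 * (x * Z - 2 * Y\<^sup>2) = 0" "3 * (Z * (4 * Y - Z)) = 0"
    using g unfolding yz by algebra+
  have canc: "p = 0" if "k * p = 0" "k \<noteq> 0" for k p :: complex using that by simp
  have g': "x * (2 * Y - Z) = 0" "x * Z - 2 * Y\<^sup>2 = 0" "Z * (4 * Y - Z) = 0"
    by (rule canc[OF h(1)], simp, rule canc[OF h(2)], simp, rule canc[OF h(3)], simp)
  have "Y = 0 \<and> Z = 0"
  proof (cases "x = 0")
    case True
    then have "Y = 0" using g'(2) by simp
    then show ?thesis using g'(3) by simp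
  next
    case False
    then have "Z = 2 * Y" using g'(1) by simp
    moreover from this have "4 * Y\<^sup>2 = 0" using g'(3) by algebra
    ultimately show ?thesis by simp
  qed
  then show ?thesis using yz by simp
qed

lemma nodal_cubic1: "nodal_cubic cubic1"
  unfolding nodal_cubic_def
proof (intro conjI exI[of _ "(1, 0, 0)"] allI impI irreducible_cubic1)
  \<comment> \<open>A root of t^2 - t + 1, over which the tangent cone -q^2 + qr - r^2 at the node
    splits into two lines.\<close>
  define \<zeta> where "\<zeta> = (1 + csqrt (- 3)) / 2"
  have z: "\<zeta> * \<zeta> = \<zeta> - 1"
  proof -
    have "(csqrt (- 3))\<^sup>2 = - 3" by (rule power2_csqrt)
    then show ?thesis unfolding \<zeta>_def by (simp add: field_simps power2_eq_square)
  qed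
  show "node cubic1 (1, 0, 0)"
    unfolding node_def
  proof (intro conjI exI allI)
    show "(1, 0, 0) \<noteq> (0 :: c3)" by (simp add: zero_prod_def)
    show "cubic1 (1, 0, 0) = 0" by (simp add: cubic1_def)
    show "grad cubic1 (1, 0, 0) = 0" by (simp add: grad_cubic1 zero_prod_def)
    show "cindep (0, - 2, 2 * \<zeta>) (0, 1, \<zeta> - 1)"
      unfolding cindep_def
    proof (intro allI impI)
      fix s t assume h: "csc s (0, - 2, 2 * \<zeta>) + csc t (0, 1, \<zeta> - 1) = 0"
      have e: "t = s * 2" using arg_cong[OF h, of "\<lambda>v. fst (snd v)"] by (simp add: csc_def)
      have e2: "s * (2 * \<zeta>) + t * (\<zeta> - 1) = 0" using arg_cong[OF h, of "\<lambda>v. snd (snd v)"] by (simp add: csc_def)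
      have "4 * \<zeta> - 2 = 2 * csqrt (- 3)" unfolding \<zeta>_def by (simp add: field_simps)
      then have nz: "4 * \<zeta> - 2 \<noteq> 0" by simp
      have "s * (4 * \<zeta> - 2) = 0" using e e2 by algebra
      then have "s = 0" using nz by (simp only: mult_eq_0_iff) simp
      then show "s = 0 \<and> t = 0" using e by simp
    qed
    fix w :: c3
    obtain p q r where w: "w = (p, q, r)" by (metis prod.collapse)
    have "cubic1 ((1, 0, 0) + csc t w) = 0 + 0 * t + (- q\<^sup>2 + q * r - r\<^sup>2) * t\<^sup>2 +
        (3 * q ^ 3 - p * q\<^sup>2 + p * q * r - p * r\<^sup>2) * t ^ 3" for t
      by (simp add: w cubic1_def csc_def) algebra
    then have "(deriv ^^ 2) (\<lambda>t. cubic1 ((1, 0, 0) + csc t w)) 0 = 2 * (- q\<^sup>2 + q * r - r\<^sup>2)"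
      by (simp only: deriv2_cubic)
    also have "\<dots> = cdot (0, - 2, 2 * \<zeta>) w * cdot (0, 1, \<zeta> - 1) w"
      unfolding w cdot_def prod.case using z by algebra
    finally show "(deriv ^^ 2) (\<lambda>t. cubic1 ((1, 0, 0) + csc t w)) 0 = cdot (0, - 2, 2 * \<zeta>) w * cdot (0, 1, \<zeta> - 1) w" .
  qed
  fix u :: c3 assume u: "u \<noteq> 0 \<and> cubic1 u = 0 \<and> grad cubic1 u = 0"
  obtain x y z where xyz: "u = (x, y, z)" by (metis prod.collapse)
  have "y = 0 \<and> z = 0" using u singular_cubic1 xyz by metis
  then show "\<exists>c. c \<noteq> 0 \<and> u = csc c (1, 0, 0)"
    using u by (intro exI[of _ x]) (auto simp: xyz csc_def zero_prod_def)
qed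

lemma nodal_cubic2: "nodal_cubic cubic2"
  unfolding nodal_cubic_def
proof (intro conjI exI[of _ "(1, 1, 2)"] allI impI irreducible_cubic2)
  show "node cubic2 (1, 1, 2)"
    unfolding node_def
  proof (intro conjI exI allI)
    show "(1, 1, 2) \<noteq> (0 :: c3)" by (simp add: zero_prod_def)
    show "cubic2 (1, 1, 2) = 0" by (simp add: cubic2_def)
    show "grad cubic2 (1, 1, 2) = 0" by (simp add: grad_cubic2 zero_prod_def)
    show "cindep (6, - 18, 6) (3, - 1, - 1)"
      unfolding cindep_def
    proof (intro allI impI)
      fix s t assume h: "csc s (6, - 18, 6) + csc t (3, - 1, - 1) = 0"
      have e: "s * 6 + t * 3 = 0" using arg_cong[OF h, of fst] by (simp add: csc_def)
      have e2: "- (s * 18) = t" using arg_cong[OF h, of "\<lambda>v. fst (snd v)"] by (simp add: csc_def)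
      have "s * 6 + t * 3 = - 48 * s" unfolding e2[symmetric] by simp
      then have "s = 0" using e by simp
      then show "s = 0 \<and> t = 0" using e2 by simp
    qed
    fix w :: c3
    obtain p q r where w: "w = (p, q, r)" by (metis prod.collapse)
    \<comment> \<open>Taylor expansion at the node: the quadratic term splits into the two tangent
      lines.\<close>
    have "cubic2 ((1, 1, 2) + csc t w) = 0 + 0 * t + 3 * (p - 3 * q + r) * (3 * p - q - r) * t\<^sup>2 +
        cubic2 (p, q, r) * t ^ 3" for t
      by (simp add: w cubic2_def csc_def) algebra
    then have "(deriv ^^ 2) (\<lambda>t. cubic2 ((1, 1, 2) + csc t w)) 0 = 2 * (3 * (p - 3 * q + r) * (3 * p - q - r))"
      by (simp only: deriv2_cubic)
    also have "\<dots> = cdot (6, - 18, 6) w * cdot (3, - 1, - 1) w"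
      unfolding w cdot_def prod.case by algebra
    finally show "(deriv ^^ 2) (\<lambda>t. cubic2 ((1, 1, 2) + csc t w)) 0 = cdot (6, - 18, 6) w * cdot (3, - 1, - 1) w" .
  qed
  fix u :: c3 assume u: "u \<noteq> 0 \<and> cubic2 u = 0 \<and> grad cubic2 u = 0"
  obtain x y z where xyz: "u = (x, y, z)" by (metis prod.collapse)
  have "y = x \<and> z = 2 * x" using u singular_cubic2 xyz by metis
  then show "\<exists>c. c \<noteq> 0 \<and> u = csc c (1, 1, 2)"
    using u by (intro exI[of _ x]) (auto simp: xyz csc_def zero_prod_def)
qed

text \<open>On the line x = 0 the cubic is 3y^3, so all its intersection is concentrated at the
  smooth point (0:0:1).\<close>

lemma inflection: "inflectional_line line_x cubic1"
proof -
  have "form 1 line_x" unfolding form_def line_x_def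
    by (intro exI[of _ "\<lambda>i j. of_nat i"]) (simp add: numeral_eq_Suc)
  moreover have "line_x (1, 0, 0) \<noteq> 0" by (simp add: line_x_def)
  moreover have "(0, 0, 1) \<noteq> (0 :: c3)" "grad cubic1 (0, 0, 1) \<noteq> 0" by (simp_all add: zero_prod_def grad_cubic1)
  moreover have "line_x (0, 0, 1) = 0" "cubic1 (0, 0, 1) = 0" by (simp_all add: line_x_def cubic1_def)
  moreover have "(deriv ^^ k) (\<lambda>t. cubic1 ((0, 0, 1) + csc t w)) 0 = 0" if "line_x w = 0" and k: "k < 3" for w k
  proof -
    from that obtain q r where w: "w = (0, q, r)" by (cases w) (auto simp: line_x_def)
    have e: "(\<lambda>t. cubic1 ((0, 0, 1) + csc t w)) = (\<lambda>t. 0 + 0 * t + 0 * t\<^sup>2 + 3 * q ^ 3 * t ^ 3)"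
      by (auto simp: w cubic1_def csc_def power_mult_distrib)
    from k consider "k = 0" | "k = 1" | "k = 2" by linarith
    then show ?thesis
      unfolding e by cases (simp_all only: deriv2_cubic, simp_all)
  qed
  ultimately show ?thesis unfolding inflectional_line_def by blast
qed

section \<open>\<open>H6\<close> has no common factor\<close>

text \<open>On the line x + y + z = 0 the form becomes a binary form, which has a zero by the linear
  or the quadratic formula. The line is chosen because \<open>H6\<close> has no zero on it
  (\<open>H6_no_zero_on_line\<close>).\<close>

lemma binary_form_zero:
  assumes "form m G" "m = 1 \<or> m = 2"
  obtains x y where "x \<noteq> 0 \<or> y \<noteq> 0" "G (x, y, - x - y) = 0"
proof -
  from assms(2) show thesis
  proof
    assume "m = 1"
    then obtain a b c where g: "\<And>x y z. G (x, y, z) = a * x + b * y + c * z" using form1 assms(1) by blast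
    show thesis
    proof (cases "a = c \<and> b = c")
      case True then show thesis using that[of 1 0] g by simp
    next
      case False
      have "G (b - c, c - a, - (b - c) - (c - a)) = 0" unfolding g by (simp add: algebra_simps)
      then show thesis using that[of "b - c" "c - a"] False by auto
    qed
  next
    assume "m = 2"
    then obtain a' b' c' d' e' f' where "\<And>x y z. G (x, y, z) = a' * x\<^sup>2 + b' * x * y + c' * x * z + d' * y\<^sup>2 + e' * y * z + f' * z\<^sup>2"
      using form2 assms(1) by blast
    then have "G (x, y, - x - y) = (a' - c' + f') * x\<^sup>2 + (b' - c' - e' + 2 * f') * x * y + (d' - e' + f') * y\<^sup>2" for x y
      by (simp add: algebra_simps power2_eq_square)
    then obtain a b c where q: "\<And>x y. G (x, y, - x - y) = a * x\<^sup>2 + b * x * y + c * y\<^sup>2" by blast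
    show thesis
    proof (cases "c = 0")
      case True
      then show thesis using that[of 0 1] q[of 0 1] by simp
    next
      case False
      define s where "s = csqrt (b\<^sup>2 - 4 * a * c)"
      have s: "s\<^sup>2 = b\<^sup>2 - 4 * a * c" unfolding s_def by (rule power2_csqrt)
      define t where "t = (s - b) / (2 * c)"
      have t: "2 * c * t = s - b" using False by (simp add: t_def)
      have "4 * c * (a + b * t + c * t\<^sup>2) = 0" using s t by algebra
      then have "a * 1\<^sup>2 + b * 1 * t + c * t\<^sup>2 = 0" using False by simp
      then show thesis using that[of 1 t] q[of 1 t] by simp
    qed
  qed
qed

lemma H6_no_zero_on_line:
  assumes "H6 (x, y, - x - y) = (0, 0, 0)" shows "x = 0 \<and> y = 0"
proof (cases "x = 0")
  case True
  then show ?thesis using assms by (simp add: H6_def) algebra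
next
  case False
  have "x * (5 * y\<^sup>2 - 3 * y * (- x - y) - x * y + x * (- x - y)) = 0" "x * (2 * y\<^sup>2 - x * (- x - y)) = 0"
    using assms by (simp_all add: H6_def)
  then have e: "5 * y\<^sup>2 - 3 * y * (- x - y) - x * y + x * (- x - y) = 0" "2 * y\<^sup>2 - x * (- x - y) = 0"
    using False by simp_all
  \<comment> \<open>The sum of the two equations.\<close>
  then have "2 * (y * (x + 5 * y)) = 0" by algebra
  then have "y = 0 \<or> x + 5 * y = 0" by simp
  then show ?thesis
  proof
    assume "y = 0" then show ?thesis using e by simp
  next
    assume a: "x + 5 * y = 0"
    then have "22 * y\<^sup>2 = 0" using e(2) by algebra
    then show ?thesis using a by simp
  qed
qed

lemma foliation_form_H6: "foliation_form 2 H6"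
  unfolding foliation_form_def Let_def
proof (intro conjI allI notI)
  show "form (2 + 1) (fst \<circ> H6)"
    by (simp, rule form3I[of _ 0 0 0 1 "-1" 1 "-5" 1 0 0]) (simp add: H6_def)
  show "form (2 + 1) (fst \<circ> snd \<circ> H6)"
    by (simp, rule form3I[of _ 0 "-1" 1 5 "-3" 0 0 0 0 0]) (simp add: H6_def algebra_simps power2_eq_square)
  show "form (2 + 1) (snd \<circ> snd \<circ> H6)"
    by (simp, rule form3I[of _ 0 0 "-1" 2 0 0 0 0 0 0]) (simp add: H6_def algebra_simps power2_eq_square)
  show "cdot v (H6 v) = 0" for v
    by (cases v) (simp add: H6_def cdot_def algebra_simps eval_nat_numeral)
  assume "\<exists>m n G P Q R. m \<ge> 1 \<and> m + n = 2 + 1 \<and> form m G \<and> form n P \<and> form n Q \<and> form n R \<and>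
     (\<forall>v. (fst \<circ> H6) v = G v * P v \<and> (fst \<circ> snd \<circ> H6) v = G v * Q v \<and> (snd \<circ> snd \<circ> H6) v = G v * R v)"
  then obtain m n G P Q R where h: "m \<ge> 1 \<and> m + n = 2 + 1 \<and> form m G \<and> form n P \<and> form n Q \<and> form n R \<and>
     (\<forall>v. (fst \<circ> H6) v = G v * P v \<and> (fst \<circ> snd \<circ> H6) v = G v * Q v \<and> (snd \<circ> snd \<circ> H6) v = G v * R v)"
    by blast
  then have m: "m \<ge> 1" "m + n = 3" and G: "form m G" "form n P" "form n R" by simp_all
  have e: "fst (H6 v) = G v * P v" "fst (snd (H6 v)) = G v * Q v" "snd (snd (H6 v)) = G v * R v" for v
    using h[THEN conjunct2, THEN conjunct2, THEN conjunct2, THEN conjunct2, THEN conjunct2, THEN conjunct2, THEN spec, of v] by simp_all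
  show False
  proof (cases "m = 3")
    case True
    \<comment> \<open>If the factor has degree three, all coefficients are constant multiples of it.
      At (0:1:0) the first is -5 and the third is 0, so the third would vanish identically.\<close>
    then obtain p r where "\<And>v. P v = p" "\<And>v. R v = r" using G m form0 by (metis add_cancel_right_right)
    then have pr: "fst (H6 v) = G v * p" "snd (snd (H6 v)) = G v * r" for v using e by simp_all
    have "G (0, 1, 0) * p = - 5" "G (0, 1, 0) * r = 0" using pr[of "(0, 1, 0)"] by (simp_all add: H6_def)
    then have "r = 0" by auto
    then show False using pr(2)[of "(1, 1, 0)"] by (simp add: H6_def)
  next
    case False
    then have "m = 1 \<or> m = 2" using m by linarith
    then obtain x y where xy: "x \<noteq> 0 \<or> y \<noteq> 0" "G (x, y, - x - y) = 0" by (rule binary_form_zero[OF G(1)])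
    then have "H6 (x, y, - x - y) = (0, 0, 0)" using e[of "(x, y, - x - y)"] by (simp add: prod_eq_iff)
    then show False using H6_no_zero_on_line xy(1) by blast
  qed
qed

section \<open>Uniqueness of the degree-two foliation\<close>

text \<open>Being entire on every complex line suffices for the identity theorem and is closed under
  products and differences, so it replaces computations with coefficients.\<close>

definition polylike :: "(c3 \<Rightarrow> complex) \<Rightarrow> bool" where
  "polylike f \<longleftrightarrow> (\<forall>a b c d e g. (\<lambda>t. f (a + t * d, b + t * e, c + t * g)) holomorphic_on UNIV)"

lemma polylikeD: "polylike f \<Longrightarrow> (\<lambda>t. f (a + t * d, b + t * e, c + t * g)) holomorphic_on UNIV"
  unfolding polylike_def by blast

lemma polylike_mult: "polylike f \<Longrightarrow> polylike g \<Longrightarrow> polylike (\<lambda>v. f v * g v)"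
  unfolding polylike_def by (auto intro!: holomorphic_intros)

lemma polylike_diff: "polylike f \<Longrightarrow> polylike g \<Longrightarrow> polylike (\<lambda>v. f v - g v)"
  unfolding polylike_def by (auto intro!: holomorphic_intros)

lemma polylike_cmult: "polylike f \<Longrightarrow> polylike (\<lambda>v. c * f v)"
  unfolding polylike_def by (auto intro!: holomorphic_intros)

lemma polylike_form3:
  assumes "form 3 f" shows "polylike f"
proof -
  obtain p q r s u v w l m n where f: "\<And>x y z. f (x, y, z) =
    p * x ^ 3 + q * x\<^sup>2 * y + r * x\<^sup>2 * z + s * x * y\<^sup>2 + u * x * y * z + v * x * z\<^sup>2
    + w * y ^ 3 + l * y\<^sup>2 * z + m * y * z\<^sup>2 + n * z ^ 3" using assms unfolding form3 by blast
  show ?thesis unfolding polylike_def f by (intro allI holomorphic_intros)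
qed

text \<open>On the line through v and w, q vanishes on the open set where e does not, and this set
  contains w; the identity theorem gives q v = 0.\<close>

lemma polylike_mult_zero:
  assumes q: "polylike q" and e: "polylike e" and qe: "\<And>v. e v \<noteq> 0 \<Longrightarrow> q v = 0" and w: "e w \<noteq> 0"
  shows "q v = 0"
proof -
  obtain a b c where v: "v = (a, b, c)" by (metis prod.collapse)
  obtain a' b' c' where w': "w = (a', b', c')" by (metis prod.collapse)
  define l where "l t = (a + t * (a' - a), b + t * (b' - b), c + t * (c' - c))" for t
  have hq: "(\<lambda>t. q (l t)) holomorphic_on UNIV" and he: "(\<lambda>t. e (l t)) holomorphic_on UNIV"
    unfolding l_def by (rule polylikeD[OF q], rule polylikeD[OF e])
  have o: "open {t. e (l t) \<noteq> 0}"
  proof -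
    have "open ((\<lambda>t. e (l t)) -` (- {0}))"
      by (rule open_vimage) (auto intro!: holomorphic_on_imp_continuous_on[OF he])
    then show ?thesis by (simp add: vimage_def)
  qed
  have "q (l 0) = 0"
  proof (rule analytic_continuation_open[OF o open_UNIV _ _ _ hq, of "\<lambda>_. 0"])
    have "1 \<in> {t. e (l t) \<noteq> 0}" using w by (simp add: l_def w')
    then show "{t. e (l t) \<noteq> 0} \<noteq> {}" by blast
    show "q (l t) = 0" if "t \<in> {t. e (l t) \<noteq> 0}" for t using that qe by simp
  qed auto
  then show ?thesis by (simp add: l_def v)
qed

text \<open>Restricts to lines z = c x on which y \<open>cubic1\<close> \<open>cubic2\<close> has
  seven distinct roots. The factors c and 1 + 6c - 3c^2 keep y = 0 off the cubics, the first two
  quadratic factors exclude double roots of each cubic, and c = 2 is the line through the node of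
  the second cubic, where the two cubics meet.\<close>

definition generic :: "complex \<Rightarrow> bool" where
  "generic c \<longleftrightarrow> c * (c - 2) * (81 * c\<^sup>2 - 14 * c + 1) * (36 * (5 - c)\<^sup>2 - 286 * (5 - c) + 507) * (1 + 6 * c - 3 * c\<^sup>2) \<noteq> 0"

lemma card_roots_rsquarefree:
  fixes p :: "complex poly"
  assumes "rsquarefree p" shows "card {z. poly p z = 0} = degree p"
proof -
  have "p \<noteq> 0" using assms unfolding rsquarefree_def by simp
  have "degree p = degree (smult (lead_coeff p) (\<Prod>z|poly p z = 0. [:- z, 1:]))"
    using complex_poly_decompose_rsquarefree[OF assms] by simp
  also have "\<dots> = degree (\<Prod>z|poly p z = 0. [:- z, 1:])" using \<open>p \<noteq> 0\<close> by simp
  also have "\<dots> = (\<Sum>z|poly p z = 0. degree [:- z, 1:])"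
    by (rule degree_prod_eq_sum_degree) simp
  finally show ?thesis by simp
qed

text \<open>The product is a polynomial of degree seven in y with no root in common with its
  derivative, hence with seven roots.\<close>

lemma generic_line:
  assumes "generic c"
  shows "\<exists>P :: complex poly. (\<forall>y. poly P y = y * cubic1 (1, y, c) * cubic2 (1, y, c)) \<and> card {y. poly P y = 0} = 7"
proof -
  have c: "c \<noteq> 0" "c \<noteq> 2" "81 * c\<^sup>2 - 14 * c + 1 \<noteq> 0" "36 * (5 - c)\<^sup>2 - 286 * (5 - c) + 507 \<noteq> 0" "1 + 6 * c - 3 * c\<^sup>2 \<noteq> 0"
    using assms unfolding generic_def by auto
  define p q :: "complex poly" where "p = [:- c\<^sup>2, c, - 1, 3:]" "q = [:1 + 6 * c - 3 * c\<^sup>2, 6 * c - 6, - 15, 8:]"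
  have p: "poly p y = cubic1 (1, y, c)" and q: "poly q y = cubic2 (1, y, c)" for y
    by (simp_all add: p_q_def cubic1_def cubic2_def algebra_simps power2_eq_square power3_eq_cube)
  have p': "poly (pderiv p) y = c - 2 * y + 9 * y\<^sup>2" and q': "poly (pderiv q) y = 6 * c - 6 - 30 * y + 24 * y\<^sup>2" for y
    by (simp_all add: p_q_def pderiv_pCons algebra_simps power2_eq_square)
  have pe: "poly p y = 3 * y ^ 3 - y\<^sup>2 + c * y - c\<^sup>2" and qe: "poly q y = 8 * y ^ 3 - 15 * y\<^sup>2 + 6 * c * y - 3 * c\<^sup>2 - 6 * y + 6 * c + 1" for y
    by (simp_all add: p_q_def algebra_simps power2_eq_square power3_eq_cube)
  have pp: False if "poly p y = 0" "poly (pderiv p) y = 0" for y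
  proof -
    have cy: "c = 2 * y - 9 * y\<^sup>2" using that(2) unfolding p' by algebra
    have "- 3 * (y\<^sup>2 * (27 * y\<^sup>2 - 10 * y + 1)) = 0" using that(1) unfolding pe cy by algebra
    then have "y = 0 \<or> 27 * y\<^sup>2 - 10 * y + 1 = 0" by simp
    then show False
    proof
      assume "y = 0" then show False using cy c by simp
    next
      assume y: "27 * y\<^sup>2 - 10 * y + 1 = 0"
      then have "3 * c = 1 - 4 * y" using cy by algebra
      then have "3 * (81 * c\<^sup>2 - 14 * c + 1) = 0" using y by algebra
      then have "81 * c\<^sup>2 - 14 * c + 1 = 0" unfolding mult_eq_0_iff by simp
      then show False using c(3) by contradiction
    qed
  qed
  have qq: False if "poly q y = 0" "poly (pderiv q) y = 0" for y
  proof -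
    have cy: "6 * c = 6 + 30 * y - 24 * y\<^sup>2" using that(2) unfolding q' by algebra
    then have "6 * (c - (1 + 5 * y - 4 * y\<^sup>2)) = 0" by algebra
    then have "c - (1 + 5 * y - 4 * y\<^sup>2) = 0" unfolding mult_eq_0_iff by simp
    then have cy: "c = 1 + 5 * y - 4 * y\<^sup>2" by algebra
    have "- 4 * ((1 - y)\<^sup>2 * (9 - 22 * (1 - y) + 12 * (1 - y)\<^sup>2)) = 0" using that(1) unfolding qe cy by algebra
    then have "1 - y = 0 \<or> 9 - 22 * (1 - y) + 12 * (1 - y)\<^sup>2 = 0" by simp
    then show False
    proof
      assume "1 - y = 0" then show False using cy c by simp
    next
      assume y: "9 - 22 * (1 - y) + 12 * (1 - y)\<^sup>2 = 0"
      then have "3 * (5 - c) = 13 * (1 - y)" using cy by algebra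
      then have "3 * (36 * (5 - c)\<^sup>2 - 286 * (5 - c) + 507) = 0" using y by algebra
      then have "36 * (5 - c)\<^sup>2 - 286 * (5 - c) + 507 = 0" unfolding mult_eq_0_iff by simp
      then show False using c(4) by contradiction
    qed
  qed
  have pq: False if "poly p y = 0" "poly q y = 0" for y
  proof -
    \<comment> \<open>Coordinates centred at (1:1:2). For Y non-zero put Z = s Y; eliminating Y from
      the two cubic equations leaves 3 s^4 = 0, so the cubics have no other common point with x =
      1.\<close>
    define Y Z where "Y = 1 - y" "Z = c + 1 - 3 * y"
    have yc: "y = 1 - Y" "c = Z + 2 - 3 * Y" by (simp_all add: Y_Z_def)
    have e: "6 * Y ^ 3 + 2 * Z\<^sup>2 - 10 * Y * Z - 4 * Y\<^sup>2 + 6 * Z = 0" "12 * Y * Z - 8 * Y ^ 3 - 3 * Z\<^sup>2 = 0"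
      using that unfolding pe qe yc by algebra+
    have "Y = 0"
    proof (rule ccontr)
      assume Y: "Y \<noteq> 0"
      define s where "s = Z / Y"
      have Z: "Z = s * Y" using Y by (simp add: s_def)
      have "Y\<^sup>2 * (12 * s - 8 * Y - 3 * s\<^sup>2) = 0" "Y * (6 * Y\<^sup>2 + 2 * s\<^sup>2 * Y - 10 * s * Y - 4 * Y + 6 * s) = 0"
        using e unfolding Z by algebra+
      then have s: "12 * s - 8 * Y - 3 * s\<^sup>2 = 0" "6 * Y\<^sup>2 + 2 * s\<^sup>2 * Y - 10 * s * Y - 4 * Y + 6 * s = 0"
        using Y by simp_all
      then have "3 * s ^ 4 = 0" by algebra
      then have "s = 0" by simp
      then show False using s(1) Y by simp
    qed
    moreover from this have "Z = 0" using e(2) by simp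
    ultimately show False using c(2) yc by simp
  qed
  have r: False if "poly ([:0, 1:] * (p * q)) y = 0 \<and> poly (pderiv ([:0, 1:] * (p * q))) y = 0" for y
  proof -
    have d: "poly (pderiv ([:0, 1:] * (p * q))) y = poly p y * poly q y + y * (poly p y * poly (pderiv q) y + poly q y * poly (pderiv p) y)"
      by (simp add: pderiv_mult pderiv_pCons algebra_simps)
    have z: "poly p 0 \<noteq> 0" "poly q 0 \<noteq> 0" using c by (simp_all add: p_q_def)
    have "y = 0 \<or> poly p y = 0 \<or> poly q y = 0" using that by simp
    then show False using that z pp[of y] qq[of y] pq[of y] unfolding d by auto
  qed
  then have "rsquarefree ([:0, 1:] * (p * q))" unfolding rsquarefree_roots by blast
  moreover have "p \<noteq> 0" "q \<noteq> 0" "degree p = 3" "degree q = 3" by (simp_all add: p_q_def)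
  ultimately have "card {y. poly ([:0, 1:] * (p * q)) y = 0} = 7"
    using card_roots_rsquarefree[of "[:0, 1:] * (p * q)"] by (simp add: degree_mult_eq)
  then show ?thesis by (intro exI[of _ "[:0, 1:] * (p * q)"]) (simp add: p q)
qed

lemma form3_poly:
  assumes "form 3 A" shows "\<exists>p. degree p \<le> 3 \<and> (\<forall>y. poly p y = A (1, y, c))"
proof -
  obtain p q r s u v w l m n where A: "\<And>x y z. A (x, y, z) =
    p * x ^ 3 + q * x\<^sup>2 * y + r * x\<^sup>2 * z + s * x * y\<^sup>2 + u * x * y * z + v * x * z\<^sup>2
    + w * y ^ 3 + l * y\<^sup>2 * z + m * y * z\<^sup>2 + n * z ^ 3" using assms unfolding form3 by blast
  have "degree [:p + r * c + v * c\<^sup>2 + n * c ^ 3, q + u * c + m * c\<^sup>2, s + l * c, w:] \<le> 3"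
    by (auto intro!: degree_le simp: coeff_pCons split: nat.splits)
  then show ?thesis
    by (intro exI[of _ "[:p + r * c + v * c\<^sup>2 + n * c ^ 3, q + u * c + m * c\<^sup>2, s + l * c, w:]"])
      (simp add: A algebra_simps power2_eq_square power3_eq_cube)
qed

lemma form3_scale:
  assumes "form 3 A" shows "A (k * x, k * y, k * z) = k ^ 3 * A (x, y, z)"
proof -
  obtain p q r s u v w l m n where A: "\<And>x y z. A (x, y, z) =
    p * x ^ 3 + q * x\<^sup>2 * y + r * x\<^sup>2 * z + s * x * y\<^sup>2 + u * x * y * z + v * x * z\<^sup>2
    + w * y ^ 3 + l * y\<^sup>2 * z + m * y * z\<^sup>2 + n * z ^ 3" using assms unfolding form3 by blast
  show ?thesis unfolding A by (simp add: algebra_simps power2_eq_square power3_eq_cube)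
qed

text \<open>The minor C A' - A C' vanishes on general lines by counting roots, hence everywhere. The
  conic factor 2y^2 - xz of C' must then divide C, and the quotient must be a multiple of x; so A
  and C are the same multiple of A' and C', and B follows from the Euler relation.\<close>

lemma uniqueness:
  assumes \<Omega>: "foliation_form 2 \<Omega>" and t1: "tangent_to \<Omega> cubic1" and t2: "tangent_to \<Omega> cubic2"
  shows "\<exists>c. c \<noteq> 0 \<and> (\<forall>v. \<Omega> v = csc c (H6 v))"
proof -
  define A B C where "A v = fst (\<Omega> v)" "B v = fst (snd (\<Omega> v))" "C v = snd (snd (\<Omega> v))" for v
  define A' B' C' where "A' v = fst (H6 v)" "B' v = fst (snd (H6 v))" "C' v = snd (snd (H6 v))" for v
  have f: "form 3 A" "form 3 B" "form 3 C"
    and eu: "x * A (x, y, z) + y * B (x, y, z) + z * C (x, y, z) = 0"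
    and nc: "\<nexists>m n G P Q R. m \<ge> 1 \<and> m + n = 3 \<and> form m G \<and> form n P \<and> form n Q \<and> form n R \<and>
          (\<forall>v. A v = G v * P v \<and> B v = G v * Q v \<and> C v = G v * R v)" for x y z
    using \<Omega> unfolding foliation_form_def Let_def comp_def A_B_C_def cdot_def by (auto split: prod.splits) 
  have f': "form 3 A'" "form 3 B'" "form 3 C'" 
    and eu': "x * A' (x, y, z) + y * B' (x, y, z) + z * C' (x, y, z) = 0" for x y z
    using foliation_form_H6 unfolding foliation_form_def Let_def comp_def A'_B'_C'_def cdot_def by (auto split: prod.splits)
  have expl: "A' (x, y, z) = x * y\<^sup>2 - x * y * z + x * z\<^sup>2 - 5 * y ^ 3 + y\<^sup>2 * z" "C' (x, y, z) = x * (2 * y\<^sup>2 - x * z)" for x y z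
    by (simp_all add: A'_B'_C'_def H6_def)
  have par: "C v * A' v - A v * C' v = 0"
    if h: "v \<noteq> 0" "F v = 0" "grad F v \<noteq> 0" "tangent_to \<Omega> F" "tangent_to H6 F" for v F
  proof -
    obtain k k' where "\<Omega> v = csc k (grad F v)" "H6 v = csc k' (grad F v)"
      using parallel[OF h(3)] h unfolding tangent_to_def by metis
    then show ?thesis by (cases "grad F v") (simp add: A_B_C_def A'_B'_C'_def csc_def)
  qed
  have K1: "C (1, y, c) * A' (1, y, c) - A (1, y, c) * C' (1, y, c) = 0" if c: "generic c" for y c
  proof -
    have c0: "c \<noteq> 0" "c \<noteq> 2" using c unfolding generic_def by auto
    obtain a b a' b' where p: "degree a \<le> 3" "degree b \<le> 3" "degree a' \<le> 3" "degree b' \<le> 3"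
      "\<And>y. poly a y = A (1, y, c)" "\<And>y. poly b y = C (1, y, c)" "\<And>y. poly a' y = A' (1, y, c)" "\<And>y. poly b' y = C' (1, y, c)"
      using form3_poly[OF f(1)] form3_poly[OF f(3)] form3_poly[OF f'(1)] form3_poly[OF f'(3)] by metis
    \<comment> \<open>K has degree at most six in y. It vanishes at y = 0 by the Euler relation for
      both forms, and at the points of the cubics because both forms are multiples of the gradient
      there.\<close>
    define K where "K = b * a' - a * b'"
    have Kp: "poly K y = C (1, y, c) * A' (1, y, c) - A (1, y, c) * C' (1, y, c)" for y by (simp add: K_def p)
    have "degree K \<le> 6" unfolding K_def
      by (intro degree_diff_le order_trans[OF degree_mult_le]) (use p in linarith)+
    obtain P :: "complex poly" where P: "\<And>y. poly P y = y * cubic1 (1, y, c) * cubic2 (1, y, c)" "card {y. poly P y = 0} = 7"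
      using generic_line[OF c] by blast
    have "poly K y = 0" if "poly P y = 0" for y
    proof -
      have v: "(1 :: complex, y, c) \<noteq> 0" by (simp add: zero_prod_def)
      from that consider "y = 0" | "cubic1 (1, y, c) = 0" | "cubic2 (1, y, c) = 0" unfolding P by auto
      then show ?thesis
      proof cases
        case 1
        show ?thesis unfolding Kp 1 using eu[of 1 0 c] eu'[of 1 0 c] by algebra
      next
        case 2
        have "grad cubic1 (1, y, c) \<noteq> 0" using singular_cubic1 c0 by blast
        then show ?thesis unfolding Kp using par[OF v 2 _ t1 tangent_cubic1] by blast
      next
        case 3
        have "grad cubic2 (1, y, c) \<noteq> 0" using singular_cubic2[of 1 y c] c0 by auto
        then show ?thesis unfolding Kp using par[OF v 3 _ t2 tangent_cubic2] by blast
      qed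
    qed
    then have sub: "{y. poly P y = 0} \<subseteq> {y. poly K y = 0}" by blast
    have "K = 0"
    proof (rule ccontr)
      assume K: "K \<noteq> 0"
      have "7 \<le> card {y. poly K y = 0}" using card_mono[OF poly_roots_finite[OF K] sub] P(2) by simp
      also have "\<dots> \<le> degree K" by (rule card_poly_roots_bound[OF K])
      finally show False using \<open>degree K \<le> 6\<close> by simp
    qed
    then show ?thesis using Kp[of y] by simp
  qed
  have K: "C v * A' v - A v * C' v = 0" for v
  proof -
    \<comment> \<open>The homogenisation of the polynomial in \<open>generic\<close>, times
      x.\<close>
    define e :: "c3 \<Rightarrow> complex" where "e = (\<lambda>(x, y, z). x * z * (z - 2 * x) * (81 * z\<^sup>2 - 14 * x * z + x\<^sup>2) *
      (36 * (5 * x - z)\<^sup>2 - 286 * (5 * x - z) * x + 507 * x\<^sup>2) * (x\<^sup>2 + 6 * x * z - 3 * z\<^sup>2))"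
    show ?thesis
    proof (rule polylike_mult_zero[where e = e])
      show "polylike (\<lambda>v. C v * A' v - A v * C' v)"
        by (intro polylike_diff polylike_mult polylike_form3 f f')
      show "polylike e" unfolding polylike_def e_def prod.case by (intro allI holomorphic_intros)
      show "e (1, 0, 3) \<noteq> 0" by (simp add: e_def)
      fix v assume ev: "e v \<noteq> 0"
      obtain x y z where v: "v = (x, y, z)" by (metis prod.collapse)
      have x: "x \<noteq> 0" using ev by (auto simp: e_def v)
      define c where "c = z / x"
      define y' where "y' = y / x"
      have z: "z = x * c" "y = x * y'" using x by (simp_all add: c_def y'_def)
      have "e v = x ^ 9 * (c * (c - 2) * (81 * c\<^sup>2 - 14 * c + 1) * (36 * (5 - c)\<^sup>2 - 286 * (5 - c) + 507) * (1 + 6 * c - 3 * c\<^sup>2))"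
        unfolding e_def v z prod.case by algebra
      then have "generic c" using ev unfolding generic_def by auto
      note sc = form3_scale[of _ x 1 y' c, unfolded mult_1_right]
      from K1[OF \<open>generic c\<close>, of y'] show "C v * A' v - A v * C' v = 0"
        unfolding v z sc[OF f(1)] sc[OF f(3)] sc[OF f'(1)] sc[OF f'(3)] by algebra
    qed
  qed
  obtain p q r s u t w l m n where Ce: "\<And>x y z. C (x, y, z) =
    p * x ^ 3 + q * x\<^sup>2 * y + r * x\<^sup>2 * z + s * x * y\<^sup>2 + u * x * y * z + t * x * z\<^sup>2
    + w * y ^ 3 + l * y\<^sup>2 * z + m * y * z\<^sup>2 + n * z ^ 3" using f(3) unfolding form3 by blast
  \<comment> \<open>The restriction of C to the conic xz = 2y^2. There C' vanishes while A' equals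
    y^2 (6y - 1)(y - 1), so C vanishes at all but finitely many points of the conic, and comparing
    coefficients makes C a multiple of its equation.\<close>
  define k :: "complex poly" where "k = [:p, q, 2 * r + s, 2 * u + w, 4 * t + 2 * l, 4 * m, 8 * n:]"
  have k: "poly k y = C (1, y, 2 * y\<^sup>2)" for y
    unfolding Ce k_def by (simp add: algebra_simps eval_nat_numeral)
  have "k = 0"
  proof (rule ccontr)
    assume "k \<noteq> 0"
    then have fin: "finite {y. poly k y = 0}" by (rule poly_roots_finite)
    have "UNIV - {0, 1, 1 / 6} \<subseteq> {y. poly k y = 0}"
    proof
      fix y :: complex assume y: "y \<in> UNIV - {0, 1, 1 / 6}"
      have "C (1, y, 2 * y\<^sup>2) * (y\<^sup>2 * ((6 * y - 1) * (y - 1))) = 0"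
        using K[of "(1, y, 2 * y\<^sup>2)"] unfolding expl by algebra
      moreover have "6 * y - 1 \<noteq> 0"
      proof
        assume "6 * y - 1 = 0" then have "y = 1 / 6" by (simp add: field_simps)
        then show False using y by simp
      qed
      ultimately show "y \<in> {y. poly k y = 0}" using y by (simp add: k)
    qed
    then have "finite (UNIV - {0, 1, 1 / 6} :: complex set)" using fin finite_subset by blast
    then have "finite (UNIV :: complex set)" by (subst (asm) finite_Diff2) auto
    then show False using infinite_UNIV_char_0 by blast
  qed
  then have kz: "p = 0" "q = 0" "s = - 2 * r" "w = - 2 * u" "l = - 2 * t" "m = 0" "n = 0"
    unfolding k_def by (auto simp: pCons_eq_0_iff add_eq_0_iff)
  define L where "L = (\<lambda>(x, y, z). - (r * x + u * y + t * z))"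
  have CL: "C (x, y, z) = (2 * y\<^sup>2 - x * z) * L (x, y, z)" for x y z
    unfolding Ce kz L_def prod.case by algebra
  have pl: "polylike fst" "polylike (\<lambda>v. fst (snd v))" "polylike L"
    unfolding polylike_def L_def prod.case fst_conv snd_conv by (intro allI holomorphic_intros)+
  have LA: "L v * A' v - fst v * A v = 0" for v
  proof (rule polylike_mult_zero[where e = "\<lambda>(x, y, z). 2 * y\<^sup>2 - x * z"])
    show "polylike (\<lambda>v. L v * A' v - fst v * A v)" by (intro polylike_diff polylike_mult polylike_form3 f f' pl)
    show "polylike (\<lambda>(x, y, z). 2 * y\<^sup>2 - x * z)" unfolding polylike_def prod.case by (intro allI holomorphic_intros)
    show "(case (0, 1, 0) of (x, y, z) \<Rightarrow> 2 * y\<^sup>2 - x * z) \<noteq> (0 :: complex)" by simp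
    fix v :: c3 assume v: "(case v of (x, y, z) \<Rightarrow> 2 * y\<^sup>2 - x * z) \<noteq> 0"
    obtain x y z where xyz: "v = (x, y, z)" by (metis prod.collapse)
    have "(2 * y\<^sup>2 - x * z) * (L v * A' v - fst v * A v) = C v * A' v - A v * C' v"
      unfolding xyz CL expl(2) fst_conv by algebra
    then show "L v * A' v - fst v * A v = 0" using K[of v] v unfolding xyz by simp
  qed
  \<comment> \<open>On the line x = 0 the product of L with A' = -5y^3 + y^2 z vanishes, so L has no
    terms in y and z.\<close>
  have "u = 0" using LA[of "(0, 1, 0)"] by (simp add: L_def expl)
  moreover from this have "t = 0" using LA[of "(0, 1, 1)"] by (simp add: L_def expl)
  ultimately have L: "L v = - r * fst v" for v by (simp add: L_def case_prod_unfold)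
  have Az: "A v - (- r) * A' v = 0" for v
  proof (rule polylike_mult_zero[where e = fst and w = "(1, 0, 0)"])
    show "polylike (\<lambda>v. A v - (- r) * A' v)" by (intro polylike_diff polylike_cmult polylike_form3 f f')
    show "A v - (- r) * A' v = 0" if "fst v \<noteq> 0" for v
    proof -
      have "fst v * (A v - (- r) * A' v) = 0" using LA[of v] unfolding L by algebra
      then show ?thesis using that by simp
    qed
  qed (simp_all add: pl)
  have Cz: "C v = - r * C' v" for v
    by (cases v) (simp add: CL expl(2) L algebra_simps)
  have Bz: "B v - (- r) * B' v = 0" for v
  proof (rule polylike_mult_zero[where e = "\<lambda>v. fst (snd v)" and w = "(0, 1, 0)"])
    show "polylike (\<lambda>v. B v - (- r) * B' v)" by (intro polylike_diff polylike_cmult polylike_form3 f f')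
    show "B v - (- r) * B' v = 0" if "fst (snd v) \<noteq> 0" for v
    proof -
      obtain x y z where v: "v = (x, y, z)" by (metis prod.collapse)
      have "y * (B v - (- r) * B' v) = 0" using eu[of x y z] eu'[of x y z] Az[of v] Cz[of v] unfolding v by algebra
      then show ?thesis using that by (simp add: v)
    qed
  qed (simp_all add: pl)
  have eq: "\<Omega> v = csc (- r) (H6 v)" for v
    using Az[of v] Bz[of v] Cz[of v] unfolding A_B_C_def A'_B'_C'_def csc_def by (simp add: prod_eq_iff case_prod_unfold add_eq_0_iff2)
  moreover have "- r \<noteq> 0"
  proof
    \<comment> \<open>The zero form is excluded because its coefficients have the common factor
      x^3.\<close>
    assume r: "- r = 0"
    have z: "A v = 0" "B v = 0" "C v = 0" for v
      using eq[of v] unfolding A_B_C_def r csc_def by (simp_all add: case_prod_unfold)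
    have "form 3 (\<lambda>(x, y, z). x ^ 3)" by (rule form3I[of _ 1 0 0 0 0 0 0 0 0 0]) simp
    moreover have "form 0 (\<lambda>_. 0)" unfolding form_def by (intro exI[of _ "\<lambda>_ _. 0"]) simp
    ultimately have "\<exists>m n G P Q R. m \<ge> 1 \<and> m + n = 3 \<and> form m G \<and> form n P \<and> form n Q \<and> form n R \<and>
          (\<forall>v. A v = G v * P v \<and> B v = G v * Q v \<and> C v = G v * R v)"
      by (intro exI[of _ 3] exI[of _ 0] exI[of _ "\<lambda>(x, y, z). x ^ 3"] exI[of _ "\<lambda>_. 0"]) (simp add: z)
    then show False using nc by blast
  qed
  ultimately show ?thesis by blast
qed

theorem theorem3:
  "foliation_form 2 H6 \<and>
   (\<forall>\<omega> (M :: 'm cspace) \<pi> \<F>6. \<omega> ^ 3 = 1 \<and> \<omega> \<noteq> 1 \<and> santos_foliation \<omega> M \<pi> \<F>6 \<longrightarrow>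
      (\<exists>f U V. birational_to_P2 M f U V \<and>
         pulls_back f U (plane_foliation H6) \<F>6 \<and>
         strict_transform M f U (curve cubic1) = santos_link M \<pi>)) \<and>
   nodal_cubic cubic1 \<and> tangent_to H6 cubic1 \<and>
   inflectional_line line_x cubic1 \<and> tangent_to H6 line_x \<and>
   nodal_cubic cubic2 \<and> tangent_to H6 cubic2 \<and>
   (\<forall>\<Omega>. foliation_form 2 \<Omega> \<and> tangent_to \<Omega> cubic1 \<and> tangent_to \<Omega> cubic2 \<longrightarrow>
      (\<exists>c. c \<noteq> 0 \<and> (\<forall>v. \<Omega> v = csc c (H6 v))))"
  by (intro conjI allI impI; (elim conjE)?)
    (rule foliation_form_H6 santos_birational nodal_cubic1 tangent_cubic1 inflection tangent_line
      nodal_cubic2 tangent_cubic2 uniqueness; assumption)+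

end
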